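(* Let $d\ge 1$, let $\Gamma$ be a discrete group with a family $S=(s_1,\dots,s_d)$ of generators, so that $[\Gamma,S]\in X_d$, and let $\varphi_n:\Gamma\to\Gamma_n$, $n\ge1$, be surjective homomorphisms onto discrete groups $\Gamma_n$. Put $S_n=(\varphi_n(s_1),\dots,\varphi_n(s_d))$, a family of generators of $\Gamma_n$. For $f\in L^1(\Gamma)^\times$ set $f_n=\varphi_{n*}(f)\in L^1(\Gamma_n)$. If $[\Gamma_n,S_n]\to[\Gamma,S]$ in $X_d$ as $n\to\infty$, then $$\det\nolimits_{\mathcal{N}\Gamma} f=\lim_{n\to\infty}\det\nolimits_{\mathcal{N}\Gamma_n} f_n .$$
   Context: For a discrete group $\Gamma$ and $p=1,2$, elements of $L^p(\Gamma)$ are written as formal series $\sum_{\gamma\in\Gamma} x_\gamma \gamma$ with $x_\gamma\in\mathbb{C}$, $\sum_\gamma |x_\gamma|^p<\infty$. $L^1(\Gamma)$ is a unital Banach $*$-algebra under convolution, and $L^1(\Gamma)^\times$ is its group of units. The von Neumann algebra $\mathcal{N}\Gamma$ is the algebra of bounded operators $A: L^2(\Gamma)\to L^2(\Gamma)$ that commute with left multiplication by every $\gamma\in\Gamma$. Its canonical trace is $\tau_{\mathcal{N}\Gamma}(A) = (A e, e)$, where $e\in\Gamma\subset L^2(\Gamma)$ is the unit element. Fuglede–Kadison determinant: for invertible $A\in\mathcal{N}\Gamma$, $\det_{\mathcal{N}\Gamma}A = \exp \tau_{\mathcal{N}\Gamma}(\log|A|)$ with $|A|=(A^*A)^{1/2}$;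 for arbitrary $A\in\mathcal{N}\Gamma$, $\det_{\mathcal{N}\Gamma}A=\lim_{\varepsilon\to0+}\det_{\mathcal{N}\Gamma}(|A|+\varepsilon)$. $L^1(\Gamma)$ is viewed as a subalgebra of $\mathcal{N}\Gamma$ via the injective homomorphism $r: L^1(\Gamma)\to\mathcal{N}\Gamma$, $r(\sum_\gamma f_\gamma\gamma)=\sum_\gamma f_\gamma R_{\gamma^{-1}}$, where $R_\gamma(x)=x\gamma$ on $L^2(\Gamma)$. So $\det_{\mathcal{N}\Gamma} f$ means $\det_{\mathcal{N}\Gamma} r(f)$ for $f\in L^1(\Gamma)$. For a homomorphism $\varphi:\Gamma\to\Gamma'$ of discrete groups, $\varphi_*:L^1(\Gamma)\to L^1(\Gamma')$ is defined by $\varphi_*(\sum_\gamma f_\gamma\gamma)=\sum_\gamma f_\gamma\varphi(\gamma)$. Space of marked groups: $X_d$ is the set of isomorphism classes $[\Gamma,S]$ of pairs $(\Gamma,S)$, where $\Gamma$ is a discrete group and $S=(s_1,\dots,s_d)$ is a family of $d$ generators (repetitions allowed); $(\Gamma,S)\cong(\Gamma',S')$ if some group isomorphism $\alpha:\Gamma\to\Gamma'$ satisfies $\alpha(s_i)=s_i'$ for all $i$. $X_d$ is an ultrametric space with distance $2^{-N}$ between $[\Gamma_1,S_1]$ and $[\Gamma_2,S_2]$, where $N\le\infty$ is the largest radius such that the balls of radius $N$ around the origin in the two Cayley graphs are isomorphic as oriented graphs with edges labelled by $1,\dots,d$. An equivalent metric is $\delta([\Gamma_1,S_1],[\Gamma_2,S_2])=2^{-M}$,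 where $M\le\infty$ is maximal such that the correspondence of the $i$-th generators induces a bijection between the $S_1$-relations and the $S_2$-relations of length less than $M$; here an $S$-relation is a finite string of elements of $S$ and their inverses whose evaluation in the group is $e$, and its length is the number of entries in the string. *)

theory Defs
  imports
    "HOL-Analysis.Analysis"
    "HOL-Library.Extended_Nat"
    "HOL-Computational_Algebra.Polynomial"
    "HOL-Algebra.Ring"
    "HOL-Algebra.Generated_Groups"
begin

section \<open>The group algebra $L^1(\Gamma)$ and the Hilbert space $L^2(\Gamma)$\<close>

text \<open>
  The formal series with coefficients \<open>x g\<close> is represented by its coefficient function,
  normalised to be zero outside the carrier, so that equality of functions is equality of series.
\<close>

definition ell1 :: "('a, 'm) monoid_scheme \<Rightarrow> ('a \<Rightarrow> complex) set" where
  "ell1 G = {x. (\<forall>g. g \<notin> carrier G \<longrightarrow> x g = 0) \<and> (\<lambda>g. norm (x g)) summable_on carrier G}"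

definition ell2 :: "('a, 'm) monoid_scheme \<Rightarrow> ('a \<Rightarrow> complex) set" where
  "ell2 G = {x. (\<forall>g. g \<notin> carrier G \<longrightarrow> x g = 0) \<and> (\<lambda>g. (norm (x g))\<^sup>2) summable_on carrier G}"

definition delta :: "'a \<Rightarrow> 'a \<Rightarrow> complex" where
  "delta g = (\<lambda>h. if h = g then 1 else 0)"

definition convolution ::
  "('a, 'm) monoid_scheme \<Rightarrow> ('a \<Rightarrow> complex) \<Rightarrow> ('a \<Rightarrow> complex) \<Rightarrow> ('a \<Rightarrow> complex)" where
  "convolution G x y =
     (\<lambda>g. if g \<in> carrier G
          then \<Sum>\<^sub>\<infinity>h\<in>carrier G. x h * y (inv\<^bsub>G\<^esub> h \<otimes>\<^bsub>G\<^esub> g) else 0)"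

definition L1_alg :: "('a, 'm) monoid_scheme \<Rightarrow> ('a \<Rightarrow> complex) ring" where
  "L1_alg G = \<lparr>carrier = ell1 G, mult = convolution G, one = delta \<one>\<^bsub>G\<^esub>,
               zero = (\<lambda>_. 0), add = (\<lambda>x y g. x g + y g)\<rparr>"

definition L1_map ::
  "('a, 'm) monoid_scheme \<Rightarrow> ('a \<Rightarrow> 'b) \<Rightarrow> ('a \<Rightarrow> complex) \<Rightarrow> ('b \<Rightarrow> complex)" where
  "L1_map G \<phi> f = (\<lambda>h. \<Sum>\<^sub>\<infinity>g\<in>{g \<in> carrier G. \<phi> g = h}. f g)"

definition ell2_inner ::
  "('a, 'm) monoid_scheme \<Rightarrow> ('a \<Rightarrow> complex) \<Rightarrow> ('a \<Rightarrow> complex) \<Rightarrow> complex" where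
  "ell2_inner G x y = (\<Sum>\<^sub>\<infinity>g\<in>carrier G. x g * cnj (y g))"

definition ell2_norm :: "('a, 'm) monoid_scheme \<Rightarrow> ('a \<Rightarrow> complex) \<Rightarrow> real" where
  "ell2_norm G x = sqrt (\<Sum>\<^sub>\<infinity>g\<in>carrier G. (norm (x g))\<^sup>2)"


section \<open>Bounded operators and the group von Neumann algebra\<close>

type_synonym 'a l2op = "('a \<Rightarrow> complex) \<Rightarrow> ('a \<Rightarrow> complex)"

text \<open>
  Operators are extensional functions on \<open>ell2 G\<close> in the sense of \<open>HOL-Library.FuncSet\<close>;
  hence two operators are equal as soon as they agree on \<open>ell2 G\<close>.
\<close>

definition bounded_ops :: "('a, 'm) monoid_scheme \<Rightarrow> 'a l2op set" where
  "bounded_ops G = {A \<in> ell2 G \<rightarrow>\<^sub>E ell2 G.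
     (\<forall>x\<in>ell2 G. \<forall>y\<in>ell2 G. A (\<lambda>g. x g + y g) = (\<lambda>g. A x g + A y g)) \<and>
     (\<forall>c. \<forall>x\<in>ell2 G. A (\<lambda>g. c * x g) = (\<lambda>g. c * A x g)) \<and>
     (\<exists>K. \<forall>x\<in>ell2 G. ell2_norm G (A x) \<le> K * ell2_norm G x)}"

definition op_norm :: "('a, 'm) monoid_scheme \<Rightarrow> 'a l2op \<Rightarrow> real" where
  "op_norm G A = (SUP x\<in>{x \<in> ell2 G. ell2_norm G x \<le> 1}. ell2_norm G (A x))"

definition op_adjoint :: "('a, 'm) monoid_scheme \<Rightarrow> 'a l2op \<Rightarrow> 'a l2op" where
  "op_adjoint G A = (THE B. B \<in> bounded_ops G \<and>
     (\<forall>x\<in>ell2 G. \<forall>y\<in>ell2 G. ell2_inner G (A x) y = ell2_inner G x (B y)))"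

text \<open>The operators $x \mapsto \gamma x$ and $x \mapsto x \gamma$ on formal series.\<close>

definition left_mult :: "('a, 'm) monoid_scheme \<Rightarrow> 'a \<Rightarrow> 'a l2op" where
  "left_mult G \<gamma> = (\<lambda>x\<in>ell2 G. \<lambda>g. if g \<in> carrier G then x (inv\<^bsub>G\<^esub> \<gamma> \<otimes>\<^bsub>G\<^esub> g) else 0)"

definition right_mult :: "('a, 'm) monoid_scheme \<Rightarrow> 'a \<Rightarrow> 'a l2op" where
  "right_mult G \<gamma> = (\<lambda>x\<in>ell2 G. \<lambda>g. if g \<in> carrier G then x (g \<otimes>\<^bsub>G\<^esub> inv\<^bsub>G\<^esub> \<gamma>) else 0)"

definition group_vN :: "('a, 'm) monoid_scheme \<Rightarrow> 'a l2op ring" where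
  "group_vN G =
     \<lparr>carrier = {A \<in> bounded_ops G.
        \<forall>\<gamma>\<in>carrier G. \<forall>x\<in>ell2 G. A (left_mult G \<gamma> x) = left_mult G \<gamma> (A x)},
      mult = (\<lambda>A B. \<lambda>x\<in>ell2 G. A (B x)),
      one = (\<lambda>x\<in>ell2 G. x),
      zero = (\<lambda>x\<in>ell2 G. \<lambda>_. 0),
      add = (\<lambda>A B. \<lambda>x\<in>ell2 G. \<lambda>g. A x g + B x g)\<rparr>"

definition op_scalar :: "('a, 'm) monoid_scheme \<Rightarrow> complex \<Rightarrow> 'a l2op" where
  "op_scalar G z = (\<lambda>x\<in>ell2 G. \<lambda>g. z * x g)"

definition op_diff :: "('a, 'm) monoid_scheme \<Rightarrow> 'a l2op \<Rightarrow> 'a l2op \<Rightarrow> 'a l2op" where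
  "op_diff G A B = (\<lambda>x\<in>ell2 G. \<lambda>g. A x g - B x g)"

definition right_rep :: "('a, 'm) monoid_scheme \<Rightarrow> ('a \<Rightarrow> complex) \<Rightarrow> 'a l2op" where
  "right_rep G f =
     (\<lambda>x\<in>ell2 G. \<lambda>g. \<Sum>\<^sub>\<infinity>\<gamma>\<in>carrier G. f \<gamma> * right_mult G (inv\<^bsub>G\<^esub> \<gamma>) x g)"

definition vN_trace :: "('a, 'm) monoid_scheme \<Rightarrow> 'a l2op \<Rightarrow> complex" where
  "vN_trace G A = ell2_inner G (A (delta \<one>\<^bsub>G\<^esub>)) (delta \<one>\<^bsub>G\<^esub>)"


section \<open>Continuous functional calculus\<close>

definition op_spectrum :: "('a, 'm) monoid_scheme \<Rightarrow> 'a l2op \<Rightarrow> complex set" where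
  "op_spectrum G A = {z. op_diff G (op_scalar G z) A \<notin> Units (group_vN G)}"

definition op_poly :: "('a, 'm) monoid_scheme \<Rightarrow> complex poly \<Rightarrow> 'a l2op \<Rightarrow> 'a l2op" where
  "op_poly G p A = (\<lambda>x\<in>ell2 G. \<lambda>g. \<Sum>k\<le>degree p. coeff p k * (A ^^ k) x g)"

text \<open>
  For self-adjoint \<open>A\<close> and \<open>h\<close> continuous on the spectrum of \<open>A\<close> (which is then a compact
  set of real numbers), $h(A)$ is the norm limit of $p_n(A)$ for polynomials $p_n$ that
  converge to \<open>h\<close> uniformly on the spectrum.
\<close>

definition cont_fun_calc ::
  "('a, 'm) monoid_scheme \<Rightarrow> (complex \<Rightarrow> complex) \<Rightarrow> 'a l2op \<Rightarrow> 'a l2op" where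
  "cont_fun_calc G h A = (THE B. B \<in> carrier (group_vN G) \<and>
     (\<exists>p :: nat \<Rightarrow> complex poly.
        uniform_limit (op_spectrum G A) (\<lambda>n. poly (p n)) h sequentially \<and>
        (\<lambda>n. op_norm G (op_diff G (op_poly G (p n) A) B)) \<longlonglongrightarrow> 0))"

definition op_abs :: "('a, 'm) monoid_scheme \<Rightarrow> 'a l2op \<Rightarrow> 'a l2op" where
  "op_abs G A =
     cont_fun_calc G (\<lambda>z. complex_of_real (sqrt (Re z))) (op_adjoint G A \<otimes>\<^bsub>group_vN G\<^esub> A)"

definition op_log :: "('a, 'm) monoid_scheme \<Rightarrow> 'a l2op \<Rightarrow> 'a l2op" where
  "op_log G A = cont_fun_calc G (\<lambda>z. complex_of_real (ln (Re z))) A"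


section \<open>The Fuglede--Kadison determinant\<close>

text \<open>The real part only changes the type: the trace of a self-adjoint operator is real.\<close>

definition FK_det_invertible :: "('a, 'm) monoid_scheme \<Rightarrow> 'a l2op \<Rightarrow> real" where
  "FK_det_invertible G A = exp (Re (vN_trace G (op_log G (op_abs G A))))"

definition FK_det :: "('a, 'm) monoid_scheme \<Rightarrow> 'a l2op \<Rightarrow> real" where
  "FK_det G A =
     (if A \<in> Units (group_vN G) then FK_det_invertible G A
      else Lim (at_right 0) (\<lambda>\<epsilon>. FK_det_invertible G
             (op_abs G A \<oplus>\<^bsub>group_vN G\<^esub> op_scalar G (complex_of_real \<epsilon>))))"

definition L1_det :: "('a, 'm) monoid_scheme \<Rightarrow> ('a \<Rightarrow> complex) \<Rightarrow> real" where
  "L1_det G f = FK_det G (right_rep G f)"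


section \<open>The space of marked groups\<close>

text \<open>A representative of a point of $X_d$.\<close>

definition marked_group :: "nat \<Rightarrow> ('a, 'm) monoid_scheme \<Rightarrow> 'a list \<Rightarrow> bool" where
  "marked_group d G S \<longleftrightarrow>
     group G \<and> length S = d \<and> set S \<subseteq> carrier G \<and> generate G (set S) = carrier G"

text \<open>
  The vertices of the Cayley graph at distance at most \<open>N\<close> from the origin, i.e. the elements
  represented by words of length at most \<open>N\<close> in the generators and their inverses.
\<close>

definition cayley_ball :: "('a, 'm) monoid_scheme \<Rightarrow> 'a list \<Rightarrow> nat \<Rightarrow> 'a set" where
  "cayley_ball G S N =
     {foldr (mult G) w \<one>\<^bsub>G\<^esub> | w. length w \<le> N \<and> set w \<subseteq> set S \<union> m_inv G ` set S}"

text \<open>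
  The edges with label \<open>i\<close> go from \<open>g\<close> to \<open>g \<otimes> S ! i\<close>; a ball carries all edges between its
  vertices, and isomorphisms of balls respect the origin.
\<close>

definition cayley_ball_iso ::
  "nat \<Rightarrow> nat \<Rightarrow> ('a, 'm) monoid_scheme \<Rightarrow> 'a list \<Rightarrow> ('b, 'k) monoid_scheme \<Rightarrow> 'b list \<Rightarrow> bool" where
  "cayley_ball_iso d N G S H T \<longleftrightarrow>
     (\<exists>\<alpha>. bij_betw \<alpha> (cayley_ball G S N) (cayley_ball H T N) \<and> \<alpha> \<one>\<^bsub>G\<^esub> = \<one>\<^bsub>H\<^esub> \<and>
        (\<forall>g\<in>cayley_ball G S N. \<forall>h\<in>cayley_ball G S N. \<forall>i<d.
           h = g \<otimes>\<^bsub>G\<^esub> S ! i \<longleftrightarrow> \<alpha> h = \<alpha> g \<otimes>\<^bsub>H\<^esub> T ! i))"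

text \<open>
  The distance in $X_d$, computed on representatives; it depends only on their isomorphism
  classes, and the underlying types may differ. Already the balls of radius 0 may fail to be
  isomorphic, because of loops at the origin; the supremum is then 0 and the distance is 1.
\<close>

definition marked_dist ::
  "nat \<Rightarrow> ('a, 'm) monoid_scheme \<Rightarrow> 'a list \<Rightarrow> ('b, 'k) monoid_scheme \<Rightarrow> 'b list \<Rightarrow> real" where
  "marked_dist d G S H T =
     (case Sup (enat ` {N. cayley_ball_iso d N G S H T}) of enat N \<Rightarrow> (1 / 2) ^ N | \<infinity> \<Rightarrow> 0)"

end

theory Submission
  imports Defs "HOL-Library.Function_Algebras" "HOL-Computational_Algebra.Fundamental_Theorem_Algebra"
begin

text \<open>
  For \<open>f\<close> a unit of $L^1(\Gamma)$ with inverse \<open>f'\<close> and \<open>M\<close> a bound for the $L^1$-norms of \<open>f\<close> and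
  \<open>f'\<close>, the spectrum of $A^*A$ for $A = r(f)$ lies in $[M^{-2}, M^2]$. If a polynomial \<open>p\<close> satisfies
  $|p(t) - \log\sqrt t| \le \varepsilon$ on this interval, then $\log\det f$ differs by at most
  $\varepsilon$ from the trace of $p(A^*A)$, which is a finite combination of the coefficients at the unit
  element of the convolution powers of $f^* f$. Since $\varphi_{n*}$ contracts the $L^1$-norms and respects
  convolution and involution, the same \<open>p\<close> and $\varepsilon$ serve all \<open>f\<^sub>n\<close>, and the finitely many
  coefficients converge: any finite subset of \<open>\<Gamma>\<close> eventually meets the kernel of \<open>\<phi>\<^sub>n\<close> at most in the
  unit, because its elements are given by words of bounded length.
\<close>

section \<open>The Hilbert space $L^2(\Gamma)$\<close>

text \<open>A homomorphism of groups need not induce a bounded map of von Neumann algebras, so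
  operator norms over \<Gamma> give no control over the quotients. Here it matters that f is a unit
  already in \<open>ell1\<close>: the \<open>ell1\<close>-norm dominates the operator norm over
  every group and does not grow under push-forward. Hence A' A (with A' the adjoint of A) and its
  inverse D D' have norm at most M^2 over all groups at once.

  The determinant is defined by polynomial approximation on the exact spectrum, which varies with
  the group; only an enclosing interval is common. The functional calculus is therefore set up
  relative to a set containing the spectrum and then identified with the definition. It rests on one
  estimate: p(T), for self-adjoint T, is bounded by the supremum of |p| on the spectrum. This
  follows because the norm of a self-adjoint operator lies, up to sign, in its spectrum.

  Coefficients are accessible for polynomials in A' A, whereas the determinant takes the logarithm
  of the square root of A' A. Composing the two calculi gives a single one, with the function log
  sqrt.\<close>

lemma summable_on_mult_of_squares:
  fixes u v :: "'i \<Rightarrow> real"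
  assumes "(\<lambda>i. (u i)\<^sup>2) summable_on A" "(\<lambda>i. (v i)\<^sup>2) summable_on A"
  shows "(\<lambda>i. u i * v i) summable_on A"
proof -
  have "(\<lambda>i. norm (u i * v i)) summable_on A"
    by (rule Infinite_Sum.abs_summable_product) (use assms in \<open>simp_all add: power2_eq_square\<close>)
  then show ?thesis
    using summable_on_iff_abs_summable_on_real by blast
qed

lemma infsum_Cauchy_Schwarz:
  fixes u v :: "'i \<Rightarrow> real"
  assumes u: "(\<lambda>i. (u i)\<^sup>2) summable_on A" and v: "(\<lambda>i. (v i)\<^sup>2) summable_on A"
  shows "(\<Sum>\<^sub>\<infinity>i\<in>A. u i * v i) \<le> sqrt (\<Sum>\<^sub>\<infinity>i\<in>A. (u i)\<^sup>2) * sqrt (\<Sum>\<^sub>\<infinity>i\<in>A. (v i)\<^sup>2)"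
proof (rule infsum_le_finite_sums)
  show "(\<lambda>i. u i * v i) summable_on A"
    by (rule summable_on_mult_of_squares[OF u v])
  fix F assume F: "finite F" "F \<subseteq> A"
  have "(\<Sum>i\<in>F. u i * v i) \<le> (\<Sum>i\<in>F. \<bar>u i\<bar> * \<bar>v i\<bar>)"
    by (intro sum_mono) (metis abs_ge_self abs_mult)
  also have "\<dots> \<le> L2_set u F * L2_set v F"
    by (rule L2_set_mult_ineq)
  also have "\<dots> \<le> sqrt (\<Sum>\<^sub>\<infinity>i\<in>A. (u i)\<^sup>2) * sqrt (\<Sum>\<^sub>\<infinity>i\<in>A. (v i)\<^sup>2)"
    unfolding L2_set_def
    by (intro mult_mono real_sqrt_le_mono finite_sum_le_infsum u v F)
      (auto intro!: infsum_nonneg sum_nonneg)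
  finally show "(\<Sum>i\<in>F. u i * v i) \<le> sqrt (\<Sum>\<^sub>\<infinity>i\<in>A. (u i)\<^sup>2) * sqrt (\<Sum>\<^sub>\<infinity>i\<in>A. (v i)\<^sup>2)" .
qed

text \<open>Together with pointwise addition this makes coefficient functions a complex vector
  space, so that linearity of an operator becomes an identity between vectors instead of one between
  pointwise values.\<close>

definition cscale :: "complex \<Rightarrow> ('a \<Rightarrow> complex) \<Rightarrow> 'a \<Rightarrow> complex" (infixr "*\<^sub>c" 75) where
  "c *\<^sub>c x = (\<lambda>g. c * x g)"

lemma cscale_apply [simp]: "(c *\<^sub>c x) g = c * x g"
  by (simp add: cscale_def)

interpretation cscale: vector_space cscale
  by standard (auto simp: fun_eq_iff algebra_simps)

lemma fun_diff_apply [simp]: "((x :: 'a \<Rightarrow> complex) - y) g = x g - y g"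
  by (simp add: fun_diff_def)

context group
begin

abbreviation "HG \<equiv> ell2 G"
abbreviation "nrm \<equiv> ell2_norm G"
abbreviation "ip \<equiv> ell2_inner G"

lemma ell2_outside: "x \<in> HG \<Longrightarrow> g \<notin> carrier G \<Longrightarrow> x g = 0"
  by (simp add: ell2_def)

lemma ell2_summable: "x \<in> HG \<Longrightarrow> (\<lambda>g. (norm (x g))\<^sup>2) summable_on carrier G"
  by (simp add: ell2_def)

lemma ell2_zero [simp]: "0 \<in> HG"
  by (simp add: ell2_def)

lemma ell2_cscale [simp]: "x \<in> HG \<Longrightarrow> c *\<^sub>c x \<in> HG"
  by (auto simp: ell2_def norm_mult power_mult_distrib intro: summable_on_cmult_right)

lemma ell2_add [simp]:
  assumes "x \<in> HG" "y \<in> HG" shows "x + y \<in> HG"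
proof -
  have "(\<lambda>g. norm ((norm ((x + y) g))\<^sup>2)) summable_on carrier G"
  proof (rule Infinite_Sum.abs_summable_on_comparison_test')
    show "(\<lambda>g. 2 * (norm (x g))\<^sup>2 + 2 * (norm (y g))\<^sup>2) summable_on carrier G"
      by (intro summable_on_add summable_on_cmult_right ell2_summable assms)
    fix g
    have "norm (x g + y g) ^ 2 \<le> (norm (x g) + norm (y g)) ^ 2"
      by (intro power_mono norm_triangle_ineq) auto
    also have "\<dots> \<le> 2 * (norm (x g))\<^sup>2 + 2 * (norm (y g))\<^sup>2"
      using sum_squares_bound[of "norm (x g)" "norm (y g)"] by (simp add: power2_sum)
    finally show "norm ((norm ((x + y) g))\<^sup>2) \<le> 2 * (norm (x g))\<^sup>2 + 2 * (norm (y g))\<^sup>2" by simp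
  qed
  then show ?thesis
    using assms by (simp add: ell2_def)
qed

lemma ell2_uminus [simp]: "x \<in> HG \<Longrightarrow> - x \<in> HG"
  using ell2_cscale[of x "-1"] by simp

lemma ell2_diff [simp]: "x \<in> HG \<Longrightarrow> y \<in> HG \<Longrightarrow> x - y \<in> HG"
  using ell2_add[of x "- y"] by simp

lemma delta_ell2 [simp]:
  assumes "h \<in> carrier G" shows "delta h \<in> HG"
proof -
  have "(\<lambda>g. (norm (delta h g))\<^sup>2) summable_on carrier G"
    by (rule finite_nonzero_values_imp_summable_on, rule finite_subset[of _ "{h}"])
      (auto simp: delta_def split: if_splits)
  then show ?thesis using assms by (auto simp: ell2_def delta_def)
qed

lemma inner_summable:
  assumes "x \<in> HG" "y \<in> HG"
  shows "(\<lambda>g. norm (x g * cnj (y g))) summable_on carrier G"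
  using summable_on_mult_of_squares[OF ell2_summable ell2_summable, OF assms]
  by (simp add: norm_mult)

lemma inner_summable':
  assumes "x \<in> HG" "y \<in> HG"
  shows "(\<lambda>g. x g * cnj (y g)) summable_on carrier G"
  by (rule Infinite_Sum.abs_summable_summable[OF inner_summable[OF assms]])

lemma nrm_nonneg [simp]: "0 \<le> nrm x"
  by (simp add: ell2_norm_def infsum_nonneg)

lemma nrm_square: "(nrm x)\<^sup>2 = (\<Sum>\<^sub>\<infinity>g\<in>carrier G. (norm (x g))\<^sup>2)"
  by (simp add: ell2_norm_def infsum_nonneg)

text \<open>Serves twice: coordinates are continuous for the norm, which gives completeness, and
  every vector is a bounded function, which can be paired with elements of
  \<open>ell1\<close>.\<close>

lemma norm_coord_le_nrm:
  assumes "x \<in> HG" shows "norm (x g) \<le> nrm x"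
proof (cases "g \<in> carrier G")
  case True
  have "(\<Sum>h\<in>{g}. (norm (x h))\<^sup>2) \<le> (nrm x)\<^sup>2"
    unfolding nrm_square by (rule finite_sum_le_infsum) (use True assms ell2_summable in auto)
  then show ?thesis using power2_le_imp_le by simp
qed (simp add: ell2_outside[OF assms])

lemma nrm_eq_0_iff [simp]:
  assumes "x \<in> HG" shows "nrm x = 0 \<longleftrightarrow> x = 0"
proof
  assume "nrm x = 0"
  then show "x = 0" using norm_coord_le_nrm[OF assms] by (auto simp: fun_eq_iff)
qed (simp add: ell2_norm_def)

lemma nrm_zero [simp]: "nrm 0 = 0"
  by (simp add: ell2_norm_def)

lemma nrm_delta_one: "nrm (delta \<one>) = 1"
proof -
  have "(\<Sum>\<^sub>\<infinity>g\<in>carrier G. (norm (delta \<one> g))\<^sup>2) = (\<Sum>\<^sub>\<infinity>g\<in>{\<one>}. (norm (delta \<one> g))\<^sup>2)"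
    by (rule infsum_cong_neutral) (auto simp: delta_def)
  then show ?thesis by (simp add: ell2_norm_def delta_def)
qed

text \<open>The space is nonzero. On the zero space every operator would be a unit and all spectra
  would be empty.\<close>

lemma nrm_delta_one_pos: "0 < nrm (delta \<one>)"
  by (simp add: nrm_delta_one)

lemma inner_add_left: "x \<in> HG \<Longrightarrow> y \<in> HG \<Longrightarrow> z \<in> HG \<Longrightarrow> ip (x + y) z = ip x z + ip y z"
  unfolding ell2_inner_def
  by (simp add: distrib_right infsum_add inner_summable')

lemma inner_cscale_left: "ip (c *\<^sub>c x) z = c * ip x z"
  unfolding ell2_inner_def
  by (simp add: mult.assoc infsum_cmult_right')

lemma inner_commute: "ip y x = cnj (ip x y)"
  unfolding ell2_inner_def by (simp flip: infsum_cnj add: mult.commute)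

lemma inner_add_right: "x \<in> HG \<Longrightarrow> y \<in> HG \<Longrightarrow> z \<in> HG \<Longrightarrow> ip z (x + y) = ip z x + ip z y"
  by (subst (1 2 3) inner_commute) (simp add: inner_add_left)

lemma inner_cscale_right: "ip z (c *\<^sub>c x) = cnj c * ip z x"
  by (subst (1 2) inner_commute) (simp add: inner_cscale_left)

lemma inner_diff_left: "x \<in> HG \<Longrightarrow> y \<in> HG \<Longrightarrow> z \<in> HG \<Longrightarrow> ip (x - y) z = ip x z - ip y z"
  using inner_add_left[of x "(-1) *\<^sub>c y" z] inner_cscale_left[of "-1" y z] by simp

lemma inner_diff_right: "x \<in> HG \<Longrightarrow> y \<in> HG \<Longrightarrow> z \<in> HG \<Longrightarrow> ip z (x - y) = ip z x - ip z y"
  using inner_add_right[of x "(-1) *\<^sub>c y" z] inner_cscale_right[of z "-1" y] by simp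

lemma inner_self:
  assumes "x \<in> HG" shows "ip x x = complex_of_real ((nrm x)\<^sup>2)"
proof -
  have "((\<lambda>g. complex_of_real ((norm (x g))\<^sup>2)) has_sum complex_of_real ((nrm x)\<^sup>2)) (carrier G)"
    unfolding nrm_square by (intro has_sum_of_real has_sum_infsum ell2_summable assms)
  then show ?thesis
    unfolding ell2_inner_def by (intro infsumI) (simp only: complex_norm_square)
qed

lemma norm_inner_le:
  assumes "x \<in> HG" "y \<in> HG"
  shows "norm (ip x y) \<le> nrm x * nrm y"
proof -
  have "norm (ip x y) \<le> (\<Sum>\<^sub>\<infinity>g\<in>carrier G. norm (x g) * norm (y g))"
    unfolding ell2_inner_def
    using norm_infsum_bound[OF inner_summable[OF assms]] by (simp add: norm_mult)
  also have "\<dots> \<le> nrm x * nrm y"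
    unfolding ell2_norm_def by (intro infsum_Cauchy_Schwarz ell2_summable assms)
  finally show ?thesis .
qed

lemma nrm_cscale [simp]: "nrm (c *\<^sub>c x) = norm c * nrm x"
  by (simp add: ell2_norm_def norm_mult power_mult_distrib infsum_cmult_right' real_sqrt_mult)

lemma nrm_minus [simp]: "nrm (- x) = nrm x"
  using nrm_cscale[of "-1" x] by simp

lemma nrm_add_square:
  assumes "x \<in> HG" "y \<in> HG"
  shows "(nrm (x + y))\<^sup>2 = (nrm x)\<^sup>2 + 2 * Re (ip x y) + (nrm y)\<^sup>2"
proof -
  have "complex_of_real ((nrm (x + y))\<^sup>2) = ip x x + ip x y + (ip y x + ip y y)"
    by (subst inner_self[symmetric]) (simp_all add: assms inner_add_left inner_add_right)
  then have "Re (complex_of_real ((nrm (x + y))\<^sup>2)) = Re (ip x x + ip x y + (ip y x + ip y y))"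
    by (rule arg_cong)
  then show ?thesis
    using assms by (simp add: inner_self inner_commute[of y x])
qed

lemma nrm_triangle:
  assumes "x \<in> HG" "y \<in> HG"
  shows "nrm (x + y) \<le> nrm x + nrm y"
proof (rule power2_le_imp_le)
  have "Re (ip x y) \<le> nrm x * nrm y"
    using norm_inner_le[OF assms] complex_Re_le_cmod order_trans by blast
  then show "(nrm (x + y))\<^sup>2 \<le> (nrm x + nrm y)\<^sup>2"
    by (simp add: nrm_add_square assms power2_sum)
qed simp

lemma nrm_diff_commute: "nrm (x - y) = nrm (y - x)"
  using nrm_minus[of "x - y"] by simp

lemma nrm_triangle3:
  assumes "x \<in> HG" "y \<in> HG" "z \<in> HG"
  shows "nrm (x - z) \<le> nrm (x - y) + nrm (y - z)"
  using nrm_triangle[of "x - y" "y - z"] assms by simp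

text \<open>The limit is taken coordinatewise. On each finite set of coordinates the bound for
  \<open>X n - X m\<close> passes to the limit in m, so \<open>X n - y\<close> is square summable
  with the same bound. Keeping the rate e lets \<open>NG_complete\<close> obtain an error that is
  uniform over vectors.\<close>

lemma ell2_complete:
  fixes X :: "nat \<Rightarrow> 'a \<Rightarrow> complex"
  assumes X: "\<And>n. X n \<in> HG" and e: "e \<longlonglongrightarrow> 0"
    and C: "\<And>n m. n \<le> m \<Longrightarrow> nrm (X n - X m) \<le> e n"
  shows "\<exists>y\<in>HG. \<forall>n. nrm (X n - y) \<le> e n"
proof -
  have "Cauchy (\<lambda>n. X n g)" for g
  proof (rule metric_CauchyI)
    fix \<epsilon> :: real assume "\<epsilon> > 0"
    then have "eventually (\<lambda>n. e n < \<epsilon> / 2) sequentially"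
      by (intro order_tendstoD(2)[OF e]) simp
    then obtain N where N: "e N < \<epsilon> / 2"
      using eventually_happens trivial_limit_sequentially by blast
    have "dist (X m g) (X n g) < \<epsilon>" if "m \<ge> N" "n \<ge> N" for m n
    proof -
      have "norm (X N g - X k g) < \<epsilon> / 2" if "k \<ge> N" for k
        using norm_coord_le_nrm[of "X N - X k" g] C[OF that] X N by fastforce
      from this[OF that(1)] this[OF that(2)] show ?thesis
        using dist_triangle_half_r[of "X N g" "X m g" \<epsilon> "X n g"] by (simp add: dist_norm)
    qed
    then show "\<exists>M. \<forall>m\<ge>M. \<forall>n\<ge>M. dist (X m g) (X n g) < \<epsilon>" by blast
  qed
  then have "\<forall>g. \<exists>l. (\<lambda>n. X n g) \<longlonglongrightarrow> l"
    by (meson Cauchy_convergent convergent_def)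
  then obtain y where y: "\<And>g. (\<lambda>n. X n g) \<longlonglongrightarrow> y g" by metis
  have e0: "0 \<le> e n" for n
    using C[of n n] nrm_nonneg order_trans by blast
  have fin: "(\<Sum>g\<in>F. (norm ((X n - y) g))\<^sup>2) \<le> (e n)\<^sup>2" if "finite F" "F \<subseteq> carrier G" for n F
  proof (rule tendsto_upperbound)
    show "(\<lambda>m. \<Sum>g\<in>F. (norm ((X n - X m) g))\<^sup>2) \<longlonglongrightarrow> (\<Sum>g\<in>F. (norm ((X n - y) g))\<^sup>2)"
      unfolding fun_diff_apply by (intro tendsto_intros y)
    have "(\<Sum>g\<in>F. (norm ((X n - X m) g))\<^sup>2) \<le> (e n)\<^sup>2" if "m \<ge> n" for m
    proof -
      have "(\<Sum>g\<in>F. (norm ((X n - X m) g))\<^sup>2) \<le> (nrm (X n - X m))\<^sup>2"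
        unfolding nrm_square by (intro finite_sum_le_infsum ell2_summable ell2_diff X) (use \<open>finite F\<close> \<open>F \<subseteq> _\<close> in auto)
      also have "\<dots> \<le> (e n)\<^sup>2"
        by (intro power_mono C that) auto
      finally show ?thesis .
    qed
    then show "eventually (\<lambda>m. (\<Sum>g\<in>F. (norm ((X n - X m) g))\<^sup>2) \<le> (e n)\<^sup>2) sequentially"
      using eventually_sequentially by blast
  qed auto
  have y0: "y g = 0" if "g \<notin> carrier G" for g
    using y[of g] ell2_outside[OF X that] by (simp add: LIMSEQ_const_iff)
  have *: "(\<lambda>g. (norm ((X n - y) g))\<^sup>2) summable_on carrier G" for n
    by (rule nonneg_bdd_above_summable_on)
      (auto intro!: bdd_aboveI2[where M = "(e n)\<^sup>2"] fin[unfolded fun_diff_apply])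
  then have d: "X n - y \<in> HG" for n
    using y0 X by (simp add: ell2_def)
  \<comment> \<open>The vector y is recovered as \<open>X 0 - (X 0 - y)\<close>.\<close>
  have "y \<in> HG"
    using ell2_diff[OF X d, of 0 0] by simp
  moreover have "nrm (X n - y) \<le> e n" for n
  proof (rule power2_le_imp_le)
    show "(nrm (X n - y))\<^sup>2 \<le> (e n)\<^sup>2"
      unfolding nrm_square by (intro infsum_le_finite_sums * fin)
  qed (rule e0)
  ultimately show ?thesis by blast
qed

end


section \<open>Operators in the group von Neumann algebra\<close>

text \<open>
  From here on vectors are manipulated as elements of an abelian group; pointwise evaluation would
  rewrite inside eta-expanded vectors.
\<close>
declare plus_fun_apply [simp del] cscale_apply [simp del] fun_diff_apply [simp del]
  zero_fun_apply [simp del] minus_apply [simp del] uminus_apply [simp del]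

lemmas fun_applies = plus_fun_apply cscale_apply minus_apply zero_fun_apply uminus_apply

context group
begin

section \<open>Norm convergence of sequences of vectors\<close>

definition tends :: "(nat \<Rightarrow> 'a \<Rightarrow> complex) \<Rightarrow> ('a \<Rightarrow> complex) \<Rightarrow> bool" where
  "tends X y \<longleftrightarrow> (\<lambda>n. nrm (X n - y)) \<longlonglongrightarrow> 0"

lemma tends_const: "tends (\<lambda>_. x) x"
  by (simp add: tends_def)

lemma tends_unique:
  assumes "tends X x" "tends X y" "\<And>n. X n \<in> HG" "x \<in> HG" "y \<in> HG"
  shows "x = y"
proof -
  have "(\<lambda>n. nrm (X n - x) + nrm (X n - y)) \<longlonglongrightarrow> 0 + 0"
    using assms unfolding tends_def by (intro tendsto_add)
  moreover have "nrm (x - y) \<le> nrm (X n - x) + nrm (X n - y)" for n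
    using nrm_triangle3[of x "X n" y] assms by (simp add: nrm_diff_commute)
  ultimately have "nrm (x - y) \<le> 0"
    by (intro tendsto_lowerbound[where f = "\<lambda>n. nrm (X n - x) + nrm (X n - y)" and F = sequentially]) auto
  then show ?thesis
    using nrm_eq_0_iff[of "x - y"] nrm_nonneg[of "x - y"] assms by simp
qed

lemma tends_le:
  assumes "\<And>n. nrm (X n - y) \<le> e n" "e \<longlonglongrightarrow> 0"
  shows "tends X y"
  unfolding tends_def by (rule tendsto_sandwich[OF _ _ tendsto_const assms(2)]) (auto simp: assms(1))

lemma tends_add:
  assumes "tends X x" "tends Y y" "\<And>n. X n \<in> HG" "\<And>n. Y n \<in> HG" "x \<in> HG" "y \<in> HG"
  shows "tends (\<lambda>n. X n + Y n) (x + y)"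
proof (rule tends_le)
  show "(\<lambda>n. nrm (X n - x) + nrm (Y n - y)) \<longlonglongrightarrow> 0"
    using tendsto_add[OF assms(1,2)[unfolded tends_def]] by simp
  show "nrm (X n + Y n - (x + y)) \<le> nrm (X n - x) + nrm (Y n - y)" for n
    using nrm_triangle[of "X n - x" "Y n - y"] assms by (simp add: algebra_simps)
qed

lemma tends_cscale:
  assumes "tends X x"
  shows "tends (\<lambda>n. c *\<^sub>c X n) (c *\<^sub>c x)"
proof (rule tends_le)
  show "(\<lambda>n. norm c * nrm (X n - x)) \<longlonglongrightarrow> 0"
    using tendsto_mult_right_zero[OF assms(1)[unfolded tends_def]] by simp
qed (simp flip: cscale.scale_right_diff_distrib)

lemma tends_diff:
  assumes "tends X x" "tends Y y" "\<And>n. X n \<in> HG" "\<And>n. Y n \<in> HG" "x \<in> HG" "y \<in> HG"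
  shows "tends (\<lambda>n. X n - Y n) (x - y)"
  using tends_add[OF assms(1) tends_cscale[OF assms(2), of "-1"]] assms by simp

section \<open>Left and right translations\<close>

lemma left_mult_apply:
  "x \<in> HG \<Longrightarrow> left_mult G \<gamma> x = (\<lambda>g. if g \<in> carrier G then x (inv \<gamma> \<otimes> g) else 0)"
  by (simp add: left_mult_def)

lemma left_translation_bij: "\<gamma> \<in> carrier G \<Longrightarrow> bij_betw (\<lambda>g. \<gamma> \<otimes> g) (carrier G) (carrier G)"
  by (rule bij_betwI[where g = "\<lambda>g. inv \<gamma> \<otimes> g"]) (auto simp: m_assoc[symmetric])

lemma right_translation_bij: "\<gamma> \<in> carrier G \<Longrightarrow> bij_betw (\<lambda>g. g \<otimes> \<gamma>) (carrier G) (carrier G)"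
  by (rule bij_betwI[where g = "\<lambda>g. g \<otimes> inv \<gamma>"]) (auto simp: m_assoc)

lemma left_mult_ell2 [simp]:
  assumes "\<gamma> \<in> carrier G" "x \<in> HG" shows "left_mult G \<gamma> x \<in> HG"
proof -
  have "(\<lambda>g. (norm (x (inv \<gamma> \<otimes> g)))\<^sup>2) summable_on carrier G"
    using summable_on_reindex_bij_betw[OF left_translation_bij[of "inv \<gamma>"], of "\<lambda>g. (norm (x g))\<^sup>2"]
      ell2_summable[OF assms(2)] assms by simp
  then have "(\<lambda>g. (norm (left_mult G \<gamma> x g))\<^sup>2) summable_on carrier G"
    using summable_on_cong[of "carrier G" "\<lambda>g. (norm (x (inv \<gamma> \<otimes> g)))\<^sup>2" "\<lambda>g. (norm (left_mult G \<gamma> x g))\<^sup>2"]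
    by (simp add: left_mult_apply assms)
  then show ?thesis
    by (simp add: ell2_def left_mult_apply[OF assms(2)])
qed

lemma nrm_left_mult [simp]:
  assumes "\<gamma> \<in> carrier G" "x \<in> HG" shows "nrm (left_mult G \<gamma> x) = nrm x"
proof -
  have "(\<Sum>\<^sub>\<infinity>g\<in>carrier G. (norm (left_mult G \<gamma> x g))\<^sup>2) = (\<Sum>\<^sub>\<infinity>g\<in>carrier G. (norm (x (inv \<gamma> \<otimes> g)))\<^sup>2)"
    by (rule infsum_cong) (simp add: left_mult_apply assms)
  also have "\<dots> = (\<Sum>\<^sub>\<infinity>g\<in>carrier G. (norm (x g))\<^sup>2)"
    using infsum_reindex_bij_betw[OF left_translation_bij[of "inv \<gamma>"], of "\<lambda>g. (norm (x g))\<^sup>2"] assms by simp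
  finally show ?thesis by (simp add: ell2_norm_def)
qed

lemma left_mult_add:
  "x \<in> HG \<Longrightarrow> y \<in> HG \<Longrightarrow> left_mult G \<gamma> (x + y) = left_mult G \<gamma> x + left_mult G \<gamma> y"
  by (auto simp: left_mult_apply fun_applies)

lemma left_mult_cscale: "x \<in> HG \<Longrightarrow> left_mult G \<gamma> (c *\<^sub>c x) = c *\<^sub>c left_mult G \<gamma> x"
  by (auto simp: left_mult_apply fun_applies)

lemma left_mult_diff:
  "x \<in> HG \<Longrightarrow> y \<in> HG \<Longrightarrow> left_mult G \<gamma> (x - y) = left_mult G \<gamma> x - left_mult G \<gamma> y"
  by (auto simp: left_mult_apply fun_applies)

lemma tends_left_mult:
  assumes "tends X x" "\<And>n. X n \<in> HG" "x \<in> HG" "\<gamma> \<in> carrier G"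
  shows "tends (\<lambda>n. left_mult G \<gamma> (X n)) (left_mult G \<gamma> x)"
  using assms by (simp add: tends_def flip: left_mult_diff)

section \<open>Elements of the von Neumann algebra and their bounds\<close>

abbreviation "NG \<equiv> carrier (group_vN G)"

text \<open>Trades the pointwise lambda terms of the definition for vector space operations, the
  form in which membership is used from here on.\<close>

lemma NG_iff:
  "T \<in> NG \<longleftrightarrow> T \<in> extensional HG \<and> (\<forall>x\<in>HG. T x \<in> HG) \<and>
     (\<forall>x\<in>HG. \<forall>y\<in>HG. T (x + y) = T x + T y) \<and> (\<forall>c. \<forall>x\<in>HG. T (c *\<^sub>c x) = c *\<^sub>c T x) \<and>
     (\<exists>K. \<forall>x\<in>HG. nrm (T x) \<le> K * nrm x) \<and>
     (\<forall>\<gamma>\<in>carrier G. \<forall>x\<in>HG. T (left_mult G \<gamma> x) = left_mult G \<gamma> (T x))"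
  by (auto simp: group_vN_def bounded_ops_def PiE_def Pi_def cscale_def plus_fun_def)

lemma NG_extensional: "T \<in> NG \<Longrightarrow> T \<in> extensional HG"
  and NG_closed [simp]: "T \<in> NG \<Longrightarrow> x \<in> HG \<Longrightarrow> T x \<in> HG"
  and NG_add: "T \<in> NG \<Longrightarrow> x \<in> HG \<Longrightarrow> y \<in> HG \<Longrightarrow> T (x + y) = T x + T y"
  and NG_cscale: "T \<in> NG \<Longrightarrow> x \<in> HG \<Longrightarrow> T (c *\<^sub>c x) = c *\<^sub>c T x"
  and NG_left_mult: "T \<in> NG \<Longrightarrow> \<gamma> \<in> carrier G \<Longrightarrow> x \<in> HG \<Longrightarrow> T (left_mult G \<gamma> x) = left_mult G \<gamma> (T x)"
  by (simp_all add: NG_iff)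

lemma NG_zero [simp]: "T \<in> NG \<Longrightarrow> T 0 = 0"
  using NG_add[of T 0 0] by simp

lemma NG_diff: "T \<in> NG \<Longrightarrow> x \<in> HG \<Longrightarrow> y \<in> HG \<Longrightarrow> T (x - y) = T x - T y"
  using NG_add[of T x "(-1) *\<^sub>c y"] NG_cscale[of T y "-1"] by simp

lemma NG_eqI: "A \<in> NG \<Longrightarrow> B \<in> NG \<Longrightarrow> (\<And>x. x \<in> HG \<Longrightarrow> A x = B x) \<Longrightarrow> A = B"
  by (meson NG_extensional extensionalityI)

text \<open>As a relation, a bound passes through sums, products and limits without handling the
  supremum in \<open>op_norm\<close>; \<open>op_bound_op_norm\<close> and \<open>op_norm_le\<close>
  translate between the two.\<close>

definition op_bound :: "'a l2op \<Rightarrow> real \<Rightarrow> bool" where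
  "op_bound T c \<longleftrightarrow> (\<forall>x\<in>HG. nrm (T x) \<le> c * nrm x)"

lemma op_boundD: "op_bound T c \<Longrightarrow> x \<in> HG \<Longrightarrow> nrm (T x) \<le> c * nrm x"
  by (simp add: op_bound_def)

lemma op_bound_mono: "op_bound T c \<Longrightarrow> c \<le> c' \<Longrightarrow> op_bound T c'"
  unfolding op_bound_def by (meson mult_right_mono nrm_nonneg order_trans)

lemma NG_bounded:
  assumes "T \<in> NG" obtains K where "0 \<le> K" "op_bound T K"
proof -
  obtain K where "op_bound T K"
    using assms by (auto simp: NG_iff op_bound_def)
  then have "op_bound T (max K 0)" by (rule op_bound_mono) simp
  then show ?thesis using that[of "max K 0"] by simp
qed

lemma NG_I:
  assumes "T \<in> extensional HG" "\<And>x. x \<in> HG \<Longrightarrow> T x \<in> HG"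
    "\<And>x y. x \<in> HG \<Longrightarrow> y \<in> HG \<Longrightarrow> T (x + y) = T x + T y"
    "\<And>c x. x \<in> HG \<Longrightarrow> T (c *\<^sub>c x) = c *\<^sub>c T x" "op_bound T K"
    "\<And>\<gamma> x. \<gamma> \<in> carrier G \<Longrightarrow> x \<in> HG \<Longrightarrow> T (left_mult G \<gamma> x) = left_mult G \<gamma> (T x)"
  shows "T \<in> NG"
  using assms unfolding NG_iff op_bound_def by blast

lemma op_bound_op_norm:
  assumes "T \<in> NG" shows "op_bound T (op_norm G T)"
  unfolding op_bound_def
proof
  fix x assume x: "x \<in> HG"
  obtain K where K: "0 \<le> K" "op_bound T K" using NG_bounded[OF assms] .
  have bdd: "bdd_above ((\<lambda>x. nrm (T x)) ` {x \<in> HG. nrm x \<le> 1})"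
  proof (rule bdd_aboveI2)
    fix y assume "y \<in> {x \<in> HG. nrm x \<le> 1}"
    then show "nrm (T y) \<le> K"
      using op_boundD[OF K(2), of y] K(1) mult_left_mono[of "nrm y" 1 K] by simp
  qed
  show "nrm (T x) \<le> op_norm G T * nrm x"
  proof (cases "x = 0")
    case False
    then have p: "nrm x > 0" using x nrm_eq_0_iff nrm_nonneg[of x] by (simp add: less_le)
    let ?y = "complex_of_real (1 / nrm x) *\<^sub>c x"
    have "nrm ?y = 1" using p by (simp add: norm_divide)
    then have "nrm (T ?y) \<le> op_norm G T"
      unfolding op_norm_def by (intro cSUP_upper bdd) (use x in simp)
    then show ?thesis
      using p x assms by (simp add: NG_cscale norm_divide field_simps)
  qed (use assms in simp)
qed

lemma op_norm_le:
  assumes "op_bound T c" "0 \<le> c" shows "op_norm G T \<le> c"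
  unfolding op_norm_def
proof (rule cSUP_least)
  show "{x \<in> HG. nrm x \<le> 1} \<noteq> {}"
    using ell2_zero by (auto intro!: exI[of _ 0])
  fix x assume "x \<in> {x \<in> HG. nrm x \<le> 1}"
  then show "nrm (T x) \<le> c"
    using op_boundD[OF assms(1), of x] assms(2) mult_left_mono[of "nrm x" 1 c] by simp
qed

lemma op_norm_nonneg:
  assumes "T \<in> NG" shows "0 \<le> op_norm G T"
proof -
  have "0 \<le> op_norm G T * nrm (delta \<one>)"
    by (rule order_trans[OF nrm_nonneg op_boundD[OF op_bound_op_norm[OF assms]]]) simp
  then show ?thesis by (simp add: nrm_delta_one)
qed

lemma tends_NG:
  assumes "T \<in> NG" "tends X x" "\<And>n. X n \<in> HG" "x \<in> HG"
  shows "tends (\<lambda>n. T (X n)) (T x)"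
proof -
  obtain K where K: "0 \<le> K" "op_bound T K" using NG_bounded[OF assms(1)] .
  show ?thesis
  proof (rule tends_le)
    show "(\<lambda>n. K * nrm (X n - x)) \<longlonglongrightarrow> 0"
      using tendsto_mult_right_zero[OF assms(2)[unfolded tends_def]] by simp
    show "nrm (T (X n) - T x) \<le> K * nrm (X n - x)" for n
      using op_boundD[OF K(2), of "X n - x"] assms by (simp add: NG_diff)
  qed
qed

section \<open>Algebraic operations on operators\<close>

definition op_mult :: "'a l2op \<Rightarrow> 'a l2op \<Rightarrow> 'a l2op" where
  "op_mult A B = (\<lambda>x\<in>HG. A (B x))"

definition op_add :: "'a l2op \<Rightarrow> 'a l2op \<Rightarrow> 'a l2op" where
  "op_add A B = (\<lambda>x\<in>HG. A x + B x)"

lemma op_mult_apply [simp]: "x \<in> HG \<Longrightarrow> op_mult A B x = A (B x)"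
  and op_add_apply [simp]: "x \<in> HG \<Longrightarrow> op_add A B x = A x + B x"
  and op_diff_apply [simp]: "x \<in> HG \<Longrightarrow> op_diff G A B x = A x - B x"
  and op_scalar_apply [simp]: "x \<in> HG \<Longrightarrow> op_scalar G z x = z *\<^sub>c x"
  by (simp_all add: op_mult_def op_add_def op_diff_def op_scalar_def cscale_def fun_diff_def)

lemma group_vN_mult: "A \<otimes>\<^bsub>group_vN G\<^esub> B = op_mult A B"
  by (simp add: group_vN_def op_mult_def)

lemma op_bound_scalar: "op_bound (op_scalar G z) (norm z)"
  by (simp add: op_bound_def)

lemma op_bound_mult:
  assumes "op_bound A c" "op_bound B d" "0 \<le> c" "B \<in> NG"
  shows "op_bound (op_mult A B) (c * d)"
  unfolding op_bound_def
proof
  fix x assume x: "x \<in> HG"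
  have "nrm (A (B x)) \<le> c * nrm (B x)"
    using assms x by (simp add: op_boundD)
  also have "\<dots> \<le> c * (d * nrm x)"
    using assms x by (intro mult_left_mono op_boundD)
  finally show "nrm (op_mult A B x) \<le> c * d * nrm x" using x by (simp add: mult.assoc)
qed

lemma op_bound_add:
  assumes "op_bound A c" "op_bound B d" "A \<in> NG" "B \<in> NG"
  shows "op_bound (op_add A B) (c + d)"
  unfolding op_bound_def
proof
  fix x assume x: "x \<in> HG"
  show "nrm (op_add A B x) \<le> (c + d) * nrm x"
    using nrm_triangle[of "A x" "B x"] op_boundD[OF assms(1) x] op_boundD[OF assms(2) x] assms x
    by (simp add: distrib_right)
qed

lemma op_bound_diff:
  assumes "op_bound A c" "op_bound B d" "A \<in> NG" "B \<in> NG"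
  shows "op_bound (op_diff G A B) (c + d)"
  unfolding op_bound_def
proof
  fix x assume x: "x \<in> HG"
  show "nrm (op_diff G A B x) \<le> (c + d) * nrm x"
    using nrm_triangle[of "A x" "- B x"] op_boundD[OF assms(1) x] op_boundD[OF assms(2) x] assms x
    by (simp add: distrib_right)
qed

lemma NG_scalar [simp]: "op_scalar G z \<in> NG"
  by (rule NG_I[OF _ _ _ _ op_bound_scalar])
    (auto simp: left_mult_cscale cscale.scale_right_distrib mult.commute, simp add: op_scalar_def)

lemma NG_mult [simp]:
  assumes "A \<in> NG" "B \<in> NG" shows "op_mult A B \<in> NG"
proof -
  obtain c where c: "0 \<le> c" "op_bound A c" using NG_bounded[OF assms(1)] .
  obtain d where d: "0 \<le> d" "op_bound B d" using NG_bounded[OF assms(2)] .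
  show ?thesis
    by (rule NG_I[OF _ _ _ _ op_bound_mult[OF c(2) d(2) c(1) assms(2)]])
      (use assms in \<open>auto simp: NG_add NG_cscale NG_left_mult\<close>, simp add: op_mult_def)
qed

lemma NG_op_add [simp]:
  assumes "A \<in> NG" "B \<in> NG" shows "op_add A B \<in> NG"
proof -
  obtain c where c: "0 \<le> c" "op_bound A c" using NG_bounded[OF assms(1)] .
  obtain d where d: "0 \<le> d" "op_bound B d" using NG_bounded[OF assms(2)] .
  show ?thesis
    by (rule NG_I[OF _ _ _ _ op_bound_add[OF c(2) d(2) assms]])
      (use assms in \<open>auto simp: NG_add NG_cscale NG_left_mult left_mult_add cscale.scale_right_distrib\<close>,
       simp add: op_add_def)
qed

lemma NG_op_diff [simp]:
  assumes "A \<in> NG" "B \<in> NG" shows "op_diff G A B \<in> NG"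
proof -
  obtain c where c: "0 \<le> c" "op_bound A c" using NG_bounded[OF assms(1)] .
  obtain d where d: "0 \<le> d" "op_bound B d" using NG_bounded[OF assms(2)] .
  show ?thesis
    by (rule NG_I[OF _ _ _ _ op_bound_diff[OF c(2) d(2) assms]])
      (use assms in \<open>auto simp: NG_add NG_cscale NG_left_mult left_mult_diff cscale.scale_right_diff_distrib\<close>,
       simp add: op_diff_def)
qed

text \<open>For each vector x, completeness of the Hilbert space gives a limit with error
  \<open>e n * nrm x\<close>. Since e is the same for all x, the pointwise limit is a limit in norm.
  Linearity and commutation with left translations survive because limits are unique.\<close>

lemma NG_complete:
  fixes T :: "nat \<Rightarrow> 'a l2op"
  assumes T: "\<And>n. T n \<in> NG" and e: "e \<longlonglongrightarrow> 0"
    and C: "\<And>n m. n \<le> m \<Longrightarrow> op_bound (op_diff G (T n) (T m)) (e n)"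
  shows "\<exists>B\<in>NG. \<forall>n. op_bound (op_diff G (T n) B) (e n)"
proof -
  have "\<exists>y\<in>HG. \<forall>n. nrm (T n x - y) \<le> e n * nrm x" if x: "x \<in> HG" for x
  proof (rule ell2_complete)
    show "(\<lambda>n. e n * nrm x) \<longlonglongrightarrow> 0" using tendsto_mult_left_zero[OF e] .
    show "nrm (T n x - T m x) \<le> e n * nrm x" if "n \<le> m" for n m
      using op_boundD[OF C[OF that] x] x by simp
  qed (use T x in auto)
  then obtain b where b: "\<And>x. x \<in> HG \<Longrightarrow> b x \<in> HG"
    "\<And>x n. x \<in> HG \<Longrightarrow> nrm (T n x - b x) \<le> e n * nrm x"
    by metis
  have lim: "tends (\<lambda>n. T n x) (b x)" if "x \<in> HG" for x
    by (rule tends_le[OF b(2)[OF that] tendsto_mult_left_zero[OF e]])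
  obtain K where K: "0 \<le> K" "op_bound (T 0) K" using NG_bounded[OF T] .
  define B where "B = (\<lambda>x\<in>HG. b x)"
  have "B \<in> NG"
  proof (rule NG_I)
    show "B (x + y) = B x + B y" if "x \<in> HG" "y \<in> HG" for x y
      using tends_unique[OF lim[of "x + y"], of "b x + b y"] tends_add[OF lim lim, of x y] that T b
      by (simp add: B_def NG_add)
    show "B (c *\<^sub>c x) = c *\<^sub>c B x" if "x \<in> HG" for c x
      using tends_unique[OF lim[of "c *\<^sub>c x"], of "c *\<^sub>c b x"] tends_cscale[OF lim, of x c] that T b
      by (simp add: B_def NG_cscale)
    show "B (left_mult G \<gamma> x) = left_mult G \<gamma> (B x)" if "\<gamma> \<in> carrier G" "x \<in> HG" for \<gamma> x
      using tends_unique[OF lim[of "left_mult G \<gamma> x"], of "left_mult G \<gamma> (b x)"]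
        tends_left_mult[OF lim, of x \<gamma>] that T b
      by (simp add: B_def NG_left_mult)
    show "op_bound B (K + e 0)"
      unfolding op_bound_def
    proof
      fix x assume x: "x \<in> HG"
      have "nrm (b x) \<le> nrm (T 0 x) + nrm (b x - T 0 x)"
        using nrm_triangle[of "T 0 x" "b x - T 0 x"] x b T by simp
      then show "nrm (B x) \<le> (K + e 0) * nrm x"
        using b(2)[OF x, of 0] op_boundD[OF K(2) x] x
        by (simp add: B_def distrib_right nrm_diff_commute)
    qed
  qed (use b in \<open>auto simp: B_def\<close>)
  moreover have "op_bound (op_diff G (T n) B) (e n)" for n
    using b(2) by (simp add: op_bound_def B_def)
  ultimately show ?thesis by blast
qed

section \<open>Units and the Neumann series\<close>

lemma NG_unit_iff:
  "A \<in> Units (group_vN G) \<longleftrightarrow> A \<in> NG \<and> (\<exists>B\<in>NG. \<forall>x\<in>HG. A (B x) = x \<and> B (A x) = x)"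
proof -
  have "(\<forall>x\<in>HG. A (B x) = x \<and> B (A x) = x) \<longleftrightarrow>
      (B \<otimes>\<^bsub>group_vN G\<^esub> A = \<one>\<^bsub>group_vN G\<^esub> \<and> A \<otimes>\<^bsub>group_vN G\<^esub> B = \<one>\<^bsub>group_vN G\<^esub>)" for B
    by (auto simp: group_vN_def fun_eq_iff restrict_def)
  then show ?thesis
    unfolding Units_def by blast
qed

lemma NG_unit_mult:
  assumes "A \<in> Units (group_vN G)" "B \<in> Units (group_vN G)"
  shows "op_mult A B \<in> Units (group_vN G)"
proof -
  obtain A' B' where "A' \<in> NG" "\<forall>x\<in>HG. A (A' x) = x \<and> A' (A x) = x"
    "B' \<in> NG" "\<forall>x\<in>HG. B (B' x) = x \<and> B' (B x) = x"
    using assms by (auto simp: NG_unit_iff)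
  then show ?thesis
    using assms unfolding NG_unit_iff by (auto intro!: bexI[of _ "op_mult B' A'"])
qed

text \<open>The partial sums of the geometric series for the inverse of z - T are the iterates,
  starting at 0, of the map sending S to (1 + T S) / z. This map contracts with factor
  \<open>q / norm z\<close>, which is below 1.\<close>

lemma Neumann:
  assumes T: "T \<in> NG" "op_bound T q" "0 \<le> q" "q < norm z"
  shows "op_diff G (op_scalar G z) T \<in> Units (group_vN G)"
proof -
  define S where "S = rec_nat (op_scalar G 0) (\<lambda>_ S. op_mult (op_scalar G (1 / z)) (op_add (op_scalar G 1) (op_mult T S)))"
  have S0: "S 0 = op_scalar G 0"
    and SS: "S (Suc n) = op_mult (op_scalar G (1 / z)) (op_add (op_scalar G 1) (op_mult T (S n)))" for n
    by (simp_all add: S_def)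
  have S [simp]: "S n \<in> NG" for n
    by (induction n) (simp_all add: S0 SS T(1))
  have z: "norm z > 0" "z \<noteq> 0" using T by auto
  have Sx: "S (Suc n) x = (1 / z) *\<^sub>c (x + T (S n x))" if "x \<in> HG" for n x
    using that T by (simp add: SS)
  \<comment> \<open>The fixed point of c \<mapsto> (1 + q c) / |z|, the recursion that bounds on the
    iterates obey. A bound by C is therefore preserved, and it holds for \<open>S 0\<close>, which
    is 0.\<close>
  define C where "C = 1 / (norm z - q)"
  have C0: "C \<ge> 0" and CC: "(1 + q * C) / norm z = C"
    using T z by (simp_all add: C_def field_simps)
  have bound: "op_bound (S n) C" for n
    unfolding op_bound_def
  proof
    fix x assume x: "x \<in> HG"
    show "nrm (S n x) \<le> C * nrm x"
    proof (induction n)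
      case (Suc n)
      have "nrm (S (Suc n) x) \<le> (nrm x + nrm (T (S n x))) / norm z"
        using x T z nrm_triangle[of x "T (S n x)"]
        by (simp add: Sx norm_divide divide_right_mono del: cscale.scale_right_distrib)
      also have "\<dots> \<le> (nrm x + q * (C * nrm x)) / norm z"
        using op_boundD[OF T(2), of "S n x"] x Suc mult_left_mono[OF Suc T(3)]
        by (intro divide_right_mono add_left_mono) auto
      also have "\<dots> = C * nrm x"
        using arg_cong[OF CC, of "\<lambda>t. t * nrm x"] by (simp add: field_simps)
      finally show ?case .
    qed (use x C0 in \<open>simp add: S0\<close>)
  qed
  define e where "e n = (q / norm z) ^ n * C" for n
  have "(\<lambda>n. (q / norm z) ^ n) \<longlonglongrightarrow> 0"
    using T by (intro LIMSEQ_realpow_zero) (auto simp: divide_simps)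
  then have e: "e \<longlonglongrightarrow> 0"
    unfolding e_def using tendsto_mult_left_zero by blast
  \<comment> \<open>\<open>S n\<close> and \<open>S (n + m)\<close> arise by n contractions from 0
    and from \<open>S m\<close>, and these two starting points differ by at most C in norm.\<close>
  have shift: "nrm (S n x - S (n + m) x) \<le> e n * nrm x" if x: "x \<in> HG" for n m x
  proof (induction n)
    case 0
    then show ?case using op_boundD[OF bound x] x by (simp add: S0 e_def)
  next
    case (Suc n)
    have "S (Suc n) x - S (Suc n + m) x = (1 / z) *\<^sub>c T (S n x - S (n + m) x)"
      using x T by (simp add: Sx NG_diff algebra_simps flip: cscale.scale_right_diff_distrib)
    then have "nrm (S (Suc n) x - S (Suc n + m) x) \<le> q * nrm (S n x - S (n + m) x) / norm z"
      using op_boundD[OF T(2), of "S n x - S (n + m) x"] x z by (simp add: norm_divide divide_right_mono)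
    also have "\<dots> \<le> q * (e n * nrm x) / norm z"
      using Suc T by (intro divide_right_mono mult_left_mono) auto
    also have "\<dots> = e (Suc n) * nrm x" by (simp add: e_def)
    finally show ?case .
  qed
  have "op_bound (op_diff G (S n) (S m)) (e n)" if "n \<le> m" for n m
    using shift[of _ n "m - n"] that by (simp add: op_bound_def)
  from NG_complete[OF S e this] obtain B where B: "B \<in> NG" "\<And>n. op_bound (op_diff G (S n) B) (e n)"
    by blast
  have lim: "tends (\<lambda>n. S n x) (B x)" if x: "x \<in> HG" for x
    by (rule tends_le[OF _ tendsto_mult_left_zero[OF e]]) (use op_boundD[OF B(2) x] x in simp)
  have 1: "z *\<^sub>c B x - T (B x) = x" if x: "x \<in> HG" for x
  proof (rule tends_unique[symmetric])
    have *: "tends (\<lambda>n. S (Suc n) x) (B x)"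
      using LIMSEQ_Suc[OF lim[OF x, unfolded tends_def]] by (simp add: tends_def)
    show "tends (\<lambda>n. z *\<^sub>c S (Suc n) x - T (S n x)) (z *\<^sub>c B x - T (B x))"
      by (rule tends_diff[OF tends_cscale[OF *] tends_NG[OF T(1) lim[OF x]]]) (use x T B in auto)
    have "z *\<^sub>c S (Suc n) x - T (S n x) = x" for n
      using x z by (simp add: Sx cscale.scale_right_distrib)
    then show "tends (\<lambda>n. z *\<^sub>c S (Suc n) x - T (S n x)) x"
      by (simp add: tends_const)
  qed (use x T B in auto)
  \<comment> \<open>So far B is only a right inverse of z - T. The iterates are polynomials in T and
    hence commute with z - T; in the limit B becomes a left inverse as well.\<close>
  have comm: "S n (z *\<^sub>c x - T x) = z *\<^sub>c S n x - T (S n x)" if x: "x \<in> HG" for n x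
  proof (induction n)
    case (Suc n)
    then show ?case
      using x T z by (simp add: Sx NG_diff NG_add NG_cscale cscale.scale_right_distrib cscale.scale_right_diff_distrib)
  qed (use x T in \<open>simp add: S0\<close>)
  have 2: "B (z *\<^sub>c x - T x) = x" if x: "x \<in> HG" for x
  proof -
    have "B (z *\<^sub>c x - T x) = z *\<^sub>c B x - T (B x)"
    proof (rule tends_unique)
      show "tends (\<lambda>n. S n (z *\<^sub>c x - T x)) (B (z *\<^sub>c x - T x))"
        by (rule lim) (use x T in auto)
      show "tends (\<lambda>n. S n (z *\<^sub>c x - T x)) (z *\<^sub>c B x - T (B x))"
        unfolding comm[OF x]
        by (rule tends_diff[OF tends_cscale[OF lim[OF x]] tends_NG[OF T(1) lim[OF x]]]) (use x T B in auto)
    qed (use x T B in auto)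
    then show ?thesis using 1[OF x] by simp
  qed
  show ?thesis
    unfolding NG_unit_iff using T B 1 2 by (auto intro!: bexI[of _ B])
qed

end


section \<open>Spectra of self-adjoint operators\<close>

lemma sum_fun_apply: "(\<Sum>k\<in>F. (f k :: 'a \<Rightarrow> complex)) g = (\<Sum>k\<in>F. f k g)"
  by (induction F rule: infinite_finite_induct) (auto simp: fun_applies)

lemma map_poly_cnj_mult: "map_poly cnj (p * q) = map_poly cnj p * map_poly cnj q"
  by (rule poly_eqI) (simp add: coeff_map_poly coeff_mult)

lemma map_poly_cnj_cnj [simp]: "map_poly cnj (map_poly cnj p) = p"
  by (rule poly_eqI) (simp add: coeff_map_poly)

context group
begin

lemma inner_minus_right: "ip z (- x) = - ip z x"
  using inner_cscale_right[of z "-1" x] by simp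

lemma NG_uminus: "T \<in> NG \<Longrightarrow> x \<in> HG \<Longrightarrow> T (- x) = - T x"
  using NG_cscale[of T x "-1"] by simp

lemma ell2_sum: "(\<And>k. k \<in> F \<Longrightarrow> f k \<in> HG) \<Longrightarrow> sum f F \<in> HG"
  by (induction F rule: infinite_finite_induct) auto

lemma NG_sum:
  assumes "A \<in> NG" "\<And>k. k \<in> F \<Longrightarrow> f k \<in> HG"
  shows "A (\<Sum>k\<in>F. f k) = (\<Sum>k\<in>F. A (f k))"
  using assms(2)
  by (induction F rule: infinite_finite_induct) (use assms(1) in \<open>auto simp: NG_add ell2_sum\<close>)

lemma NG_funpow [simp]: "A \<in> NG \<Longrightarrow> x \<in> HG \<Longrightarrow> (A ^^ k) x \<in> HG"
  by (induction k) auto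

section \<open>Polynomials in an operator\<close>

lemma op_poly_apply:
  "x \<in> HG \<Longrightarrow> op_poly G p A x = (\<Sum>k\<le>degree p. coeff p k *\<^sub>c (A ^^ k) x)"
  by (simp add: op_poly_def fun_eq_iff sum_fun_apply cscale_apply)

lemma op_poly_0 [simp]: "x \<in> HG \<Longrightarrow> op_poly G 0 A x = 0"
  by (simp add: op_poly_apply)

text \<open>Horner's scheme. It replaces the sum up to the degree by a recursion, so that
  additivity, multiplicativity and adjoints follow by induction on the polynomial.\<close>

lemma op_poly_pCons_apply:
  assumes A: "A \<in> NG" and x: "x \<in> HG"
  shows "op_poly G (pCons a p) A x = a *\<^sub>c x + A (op_poly G p A x)"
proof (cases "p = 0")
  case False
  have "op_poly G (pCons a p) A x = a *\<^sub>c x + (\<Sum>k\<le>degree p. coeff p k *\<^sub>c A ((A ^^ k) x))"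
    using False x by (simp add: op_poly_apply sum.atMost_Suc_shift del: sum.atMost_Suc)
  also have "(\<Sum>k\<le>degree p. coeff p k *\<^sub>c A ((A ^^ k) x)) = A (op_poly G p A x)"
    using A x by (simp add: op_poly_apply NG_sum NG_cscale)
  finally show ?thesis .
qed (use assms in \<open>simp add: op_poly_apply\<close>)

lemma op_poly_extensional: "op_poly G p A \<in> extensional HG"
  by (simp add: op_poly_def)

lemma op_poly_pCons:
  assumes A: "A \<in> NG"
  shows "op_poly G (pCons a p) A = op_add (op_scalar G a) (op_mult A (op_poly G p A))"
  by (rule extensionalityI[OF op_poly_extensional])
    (auto simp: op_poly_pCons_apply A, simp add: op_add_def)

lemma op_poly_NG [simp]:
  assumes A: "A \<in> NG" shows "op_poly G p A \<in> NG"
proof (induction p)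
  case 0
  have "op_poly G 0 A = op_scalar G 0"
    by (rule extensionalityI[OF op_poly_extensional]) (auto, simp add: op_scalar_def)
  then show ?case by simp
qed (simp add: op_poly_pCons A)

lemma op_poly_const [simp]:
  assumes "A \<in> NG" shows "op_poly G [:c:] A = op_scalar G c"
  by (rule NG_eqI) (use assms in \<open>auto simp: op_poly_pCons_apply\<close>)

lemma op_poly_add:
  assumes A: "A \<in> NG" and x: "x \<in> HG"
  shows "op_poly G (p + q) A x = op_poly G p A x + op_poly G q A x"
proof (induction p q rule: poly_induct2)
  case (pCons a p b q)
  then show ?case using A x
    by (simp add: op_poly_pCons_apply NG_add cscale.scale_left_distrib algebra_simps)
qed (use x in simp)

lemma op_poly_smult:
  assumes A: "A \<in> NG" and x: "x \<in> HG"
  shows "op_poly G (smult c p) A x = c *\<^sub>c op_poly G p A x"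
proof (induction p)
  case (pCons a p)
  then show ?case using A x
    by (simp add: op_poly_pCons_apply NG_cscale cscale.scale_right_distrib)
qed (use x in simp)

lemma op_poly_diff:
  assumes A: "A \<in> NG" and x: "x \<in> HG"
  shows "op_poly G (p - q) A x = op_poly G p A x - op_poly G q A x"
  using op_poly_add[OF A x, of p "smult (-1) q"] op_poly_smult[OF A x, of "-1" q] by simp

lemma op_poly_mult:
  assumes A: "A \<in> NG" and x: "x \<in> HG"
  shows "op_poly G (p * q) A x = op_poly G p A (op_poly G q A x)"
proof (induction p)
  case (pCons a p)
  then show ?case using A x
    by (simp add: op_poly_pCons_apply op_poly_add op_poly_smult)
qed (use A x in simp)

section \<open>Self-adjoint operators: real spectrum, norm and spectral mapping\<close>

definition self_adjoint :: "'a l2op \<Rightarrow> bool" where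
  "self_adjoint T \<longleftrightarrow> (\<forall>x\<in>HG. \<forall>y\<in>HG. ip (T x) y = ip x (T y))"

lemma self_adjointD: "self_adjoint T \<Longrightarrow> x \<in> HG \<Longrightarrow> y \<in> HG \<Longrightarrow> ip (T x) y = ip x (T y)"
  by (simp add: self_adjoint_def)

lemma inner_op_poly:
  assumes T: "T \<in> NG" "self_adjoint T" and xy: "x \<in> HG" "y \<in> HG"
  shows "ip (op_poly G p T x) y = ip x (op_poly G (map_poly cnj p) T y)"
  using xy
proof (induction p arbitrary: x y)
  case (pCons a p)
  \<comment> \<open>T commutes with polynomials in T: both sides evaluate the product with
    \<open>[:0, 1:]\<close>, taken in the two orders.\<close>
  have "op_poly G (map_poly cnj p) T (T y) = T (op_poly G (map_poly cnj p) T y)"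
    using op_poly_mult[of T y "map_poly cnj p" "[:0, 1:]"] op_poly_mult[of T y "[:0, 1:]" "map_poly cnj p"] T pCons.prems
    by (simp add: mult.commute op_poly_pCons_apply)
  then show ?case using pCons T
    by (simp add: op_poly_pCons_apply map_poly_pCons inner_add_left inner_add_right
        inner_cscale_left inner_cscale_right self_adjointD)
qed (simp add: ell2_inner_def fun_applies)

lemma NG_unit_scalar:
  assumes "c \<noteq> 0" shows "op_scalar G c \<in> Units (group_vN G)"
  using assms by (auto simp: NG_unit_iff intro!: bexI[of _ "op_scalar G (1 / c)"])

lemma self_adjoint_spectrum_real:
  assumes T: "T \<in> NG" "self_adjoint T" and z: "z \<in> op_spectrum G T"
  shows "Im z = 0"
proof (rule ccontr)
  assume b: "Im z \<noteq> 0"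
  obtain K where K: "0 \<le> K" "op_bound T K" using NG_bounded[OF T(1)] .
  \<comment> \<open>Shifting by \<open>\<i>t\<close> increases \<open>\<bar>z + \<i>t\<bar>\<^sup>2\<close> by more than \<open>\<parallel>T + \<i>t\<parallel>\<^sup>2\<close>, so a Neumann series applies.\<close>
  define t where "t = K\<^sup>2 / (2 * Im z)"
  define w where "w = \<i> * complex_of_real t"
  have "op_bound (op_add T (op_scalar G w)) (sqrt (K\<^sup>2 + t\<^sup>2))"
    unfolding op_bound_def
  proof
    fix x assume x: "x \<in> HG"
    \<comment> \<open>Since \<open>ip (T x) x\<close> is real and w is purely imaginary, the cross
      term in the square of the norm of T x + w x vanishes.\<close>
    have "cnj (ip (T x) x) = ip (T x) x"
      using self_adjointD[OF T(2) x x] by (metis inner_commute)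
    then have "Im (ip (T x) x) = 0"
      by (simp add: complex_eq_iff)
    then have "Re (ip (T x) (w *\<^sub>c x)) = 0"
      by (simp add: inner_cscale_right w_def)
    then have "(nrm (T x + w *\<^sub>c x))\<^sup>2 = (nrm (T x))\<^sup>2 + t\<^sup>2 * (nrm x)\<^sup>2"
      using x T by (simp add: nrm_add_square w_def norm_mult power_mult_distrib)
    also have "\<dots> \<le> (K * nrm x)\<^sup>2 + t\<^sup>2 * (nrm x)\<^sup>2"
      using op_boundD[OF K(2) x] by (intro add_right_mono power_mono) auto
    also have "\<dots> = (sqrt (K\<^sup>2 + t\<^sup>2) * nrm x)\<^sup>2"
      by (simp add: power_mult_distrib distrib_right)
    finally show "nrm (op_add T (op_scalar G w) x) \<le> sqrt (K\<^sup>2 + t\<^sup>2) * nrm x"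
      using x by (auto intro: power2_le_imp_le)
  qed
  \<comment> \<open>By the choice of t, 2 t Im z cancels K^2, so the difference of the squared sides
    is |z|^2, which is positive because Im z is nonzero.\<close>
  moreover have "sqrt (K\<^sup>2 + t\<^sup>2) < norm (z + w)"
  proof -
    have "K\<^sup>2 + t\<^sup>2 < (Re z)\<^sup>2 + (Im z + t)\<^sup>2"
    proof -
      have "2 * Im z * t = K\<^sup>2" using b by (simp add: t_def)
      moreover have "0 < (Im z)\<^sup>2" using b by simp
      moreover have "0 \<le> (Re z)\<^sup>2" by simp
      ultimately show ?thesis unfolding power2_sum by linarith
    qed
    then show ?thesis by (simp add: cmod_def w_def)
  qed
  ultimately have "op_diff G (op_scalar G (z + w)) (op_add T (op_scalar G w)) \<in> Units (group_vN G)"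
    using T by (intro Neumann) auto
  also have "op_diff G (op_scalar G (z + w)) (op_add T (op_scalar G w)) = op_diff G (op_scalar G z) T"
    by (rule NG_eqI) (use T in \<open>auto simp: cscale.scale_left_distrib\<close>)
  finally show False using z by (simp add: op_spectrum_def)
qed

text \<open>Let c be the norm. If neither c nor -c is in the spectrum, then T^2 - c^2 has a bounded
  inverse. But T^2 x - c^2 x is small for unit vectors x with |T x| close to c, and such vectors
  exist. Besides the bound, this shows that the spectrum is nonempty.\<close>

lemma self_adjoint_norm_in_spectrum:
  assumes T: "T \<in> NG" "self_adjoint T"
  shows "\<exists>\<mu>\<in>op_spectrum G T. op_bound T (norm \<mu>)"
proof -
  define c where "c = op_norm G T"
  have c: "0 \<le> c" "op_bound T c"
    using op_norm_nonneg op_bound_op_norm T by (auto simp: c_def)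
  have "complex_of_real c \<in> op_spectrum G T \<or> - complex_of_real c \<in> op_spectrum G T"
  proof (rule ccontr)
    assume "\<not> ?thesis"
    then have "op_mult (op_diff G (op_scalar G c) T) (op_diff G (op_scalar G (- c)) T) \<in> Units (group_vN G)"
      by (intro NG_unit_mult) (simp_all add: op_spectrum_def)
    then obtain S where S: "S \<in> NG"
      "\<And>x. x \<in> HG \<Longrightarrow> S (op_mult (op_diff G (op_scalar G c) T) (op_diff G (op_scalar G (- c)) T) x) = x"
      unfolding NG_unit_iff by blast
    obtain K where K: "0 \<le> K" "op_bound S K" using NG_bounded[OF S(1)] .
    have key: "(nrm x)\<^sup>2 \<le> K\<^sup>2 * (c\<^sup>2 * (c\<^sup>2 * (nrm x)\<^sup>2 - (nrm (T x))\<^sup>2))" if x: "x \<in> HG" for x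
    proof -
      let ?v = "T (T x) + (- complex_of_real (c\<^sup>2)) *\<^sub>c x"
      have "op_mult (op_diff G (op_scalar G c) T) (op_diff G (op_scalar G (- c)) T) x = ?v"
        using x T by (simp add: NG_diff NG_uminus NG_cscale cscale.scale_right_diff_distrib power2_eq_square)
      then have "nrm x \<le> K * nrm ?v"
        using op_boundD[OF K(2), of ?v] S(2)[OF x] x T by simp
      then have "(nrm x)\<^sup>2 \<le> K\<^sup>2 * (nrm ?v)\<^sup>2"
        using power_mono[of "nrm x" "K * nrm ?v" 2] by (simp add: power_mult_distrib)
      \<comment> \<open>The inner product of T T x with x is |T x|^2. Expanding the square and using
        |T T x| \<le> c |T x| leaves c^4 |x|^2 - c^2 |T x|^2.\<close>
      also have "(nrm ?v)\<^sup>2 \<le> c\<^sup>2 * (c\<^sup>2 * (nrm x)\<^sup>2 - (nrm (T x))\<^sup>2)"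
      proof -
        have "ip (T (T x)) x = complex_of_real ((nrm (T x))\<^sup>2)"
          using self_adjointD[OF T(2), of "T x" x] inner_self[of "T x"] x T by simp
        then have "(nrm ?v)\<^sup>2 = (nrm (T (T x)))\<^sup>2 - 2 * c\<^sup>2 * (nrm (T x))\<^sup>2 + (c\<^sup>2)\<^sup>2 * (nrm x)\<^sup>2"
          using x T by (subst nrm_add_square)
            (simp_all add: inner_minus_right inner_cscale_right norm_power power_mult_distrib del: of_real_power)
        moreover have "(nrm (T (T x)))\<^sup>2 \<le> c\<^sup>2 * (nrm (T x))\<^sup>2"
          using power_mono[OF op_boundD[OF c(2), of "T x"], of 2] x T by (simp add: power_mult_distrib)
        ultimately show ?thesis by (simp add: algebra_simps power2_eq_square)
      qed
      finally show ?thesis by (simp add: mult_left_mono)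
    qed
    have p: "0 < K\<^sup>2 * c\<^sup>2"
    proof (rule ccontr)
      assume "\<not> 0 < K\<^sup>2 * c\<^sup>2"
      then have "K\<^sup>2 * c\<^sup>2 = 0" by (simp add: zero_less_mult_iff)
      then show False using key[of "delta \<one>"] nrm_delta_one_pos by auto
    qed
    \<comment> \<open>The bounded inverse keeps |T x|^2 below c^2 |x|^2 by the gap |x|^2 / (K^2
      c^2). Then sqrt d bounds T and is smaller than c, against the minimality of
      \<open>op_norm\<close>.\<close>
    define d where "d = c\<^sup>2 - 1 / (K\<^sup>2 * c\<^sup>2)"
    have le: "(nrm (T x))\<^sup>2 \<le> d * (nrm x)\<^sup>2" if x: "x \<in> HG" for x
    proof -
      have "(nrm x)\<^sup>2 / (K\<^sup>2 * c\<^sup>2) \<le> c\<^sup>2 * (nrm x)\<^sup>2 - (nrm (T x))\<^sup>2"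
        using key[OF x] p by (simp add: pos_divide_le_eq mult.commute mult.left_commute)
      then show ?thesis by (simp add: d_def algebra_simps)
    qed
    have "0 \<le> d * (nrm (delta \<one>))\<^sup>2"
      using le[of "delta \<one>"] order_trans[OF zero_le_power2] by simp
    then have "0 \<le> d"
      using nrm_delta_one_pos by (auto simp: zero_le_mult_iff)
    have "op_bound T (sqrt d)"
      unfolding op_bound_def
    proof
      fix x assume x: "x \<in> HG"
      show "nrm (T x) \<le> sqrt d * nrm x"
      proof (rule power2_le_imp_le)
        show "(nrm (T x))\<^sup>2 \<le> (sqrt d * nrm x)\<^sup>2"
          using le[OF x] \<open>0 \<le> d\<close> by (simp only: power_mult_distrib real_sqrt_pow2)
      qed (use \<open>0 \<le> d\<close> in simp)
    qed
    then have "c \<le> sqrt d"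
      unfolding c_def using \<open>0 \<le> d\<close> by (intro op_norm_le) auto
    then have "c\<^sup>2 \<le> d"
      using c(1) \<open>0 \<le> d\<close> power_mono[of c "sqrt d" 2] by simp
    moreover have "0 < 1 / (K\<^sup>2 * c\<^sup>2)" using p by simp
    ultimately show False unfolding d_def by linarith
  qed
  then show ?thesis
  proof
    assume "complex_of_real c \<in> op_spectrum G T"
    then show ?thesis using c by (intro bexI) auto
  next
    assume "- complex_of_real c \<in> op_spectrum G T"
    then show ?thesis using c by (intro bexI) auto
  qed
qed

text \<open>Over the complex numbers q splits into linear factors, and a factor whose root is
  outside the spectrum gives a unit. The induction removes one root at a time.\<close>

lemma op_poly_unit:
  assumes T: "T \<in> NG"
  shows "q \<noteq> 0 \<Longrightarrow> (\<And>\<mu>. poly q \<mu> = 0 \<Longrightarrow> \<mu> \<notin> op_spectrum G T) \<Longrightarrow> op_poly G q T \<in> Units (group_vN G)"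
proof (induction "degree q" arbitrary: q rule: less_induct)
  case less
  show ?case
  proof (cases "degree q = 0")
    case True
    then obtain c where "q = [:c:]" by (rule degree_eq_zeroE)
    then show ?thesis using less.prems T by (simp add: NG_unit_scalar)
  next
    case False
    then have "\<not> constant (poly q)" by (simp add: constant_degree)
    then obtain \<mu> where mu: "poly q \<mu> = 0" using fundamental_theorem_of_algebra by blast
    then obtain r where r: "q = [:- \<mu>, 1:] * r" by (auto simp: poly_eq_0_iff_dvd elim: dvdE)
    have r0: "r \<noteq> 0" using less.prems r by auto
    have "degree q = Suc (degree r)"
      unfolding r using r0 by (subst degree_mult_eq) auto
    then have "op_poly G r T \<in> Units (group_vN G)"
      using less.prems r0 r by (intro less.hyps) auto
    \<comment> \<open>The factor \<open>[:- \<mu>, 1:]\<close> evaluates to T - \<mu>, while the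
      spectrum is defined through \<mu> - T; hence the scalar -1.\<close>
    moreover have "op_mult (op_scalar G (-1)) (op_diff G (op_scalar G \<mu>) T) \<in> Units (group_vN G)"
      using less.prems mu by (intro NG_unit_mult NG_unit_scalar) (auto simp: op_spectrum_def)
    ultimately have "op_mult (op_mult (op_scalar G (-1)) (op_diff G (op_scalar G \<mu>) T)) (op_poly G r T) \<in> Units (group_vN G)"
      by (metis NG_unit_mult)
    also have "op_mult (op_mult (op_scalar G (-1)) (op_diff G (op_scalar G \<mu>) T)) (op_poly G r T) = op_poly G q T"
    proof (rule NG_eqI)
      show "op_mult (op_mult (op_scalar G (-1)) (op_diff G (op_scalar G \<mu>) T)) (op_poly G r T) x = op_poly G q T x"
        if "x \<in> HG" for x
        using that T unfolding r
          by (subst op_poly_mult) (simp_all add: op_poly_pCons_apply)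
    qed (use T in auto)
    finally show ?thesis .
  qed
qed

text \<open>If \<mu> is not a value of p on the spectrum, then \<mu> - p has no root there, and
  \<open>op_poly_unit\<close> makes \<mu> - p(T) a unit.\<close>

lemma spectral_mapping_poly:
  assumes T: "T \<in> NG" "self_adjoint T" and m: "\<mu> \<in> op_spectrum G (op_poly G p T)"
  shows "\<exists>\<nu>\<in>op_spectrum G T. poly p \<nu> = \<mu>"
proof (rule ccontr)
  assume *: "\<not> ?thesis"
  have "op_poly G ([:\<mu>:] - p) T \<in> Units (group_vN G)"
  proof (rule op_poly_unit[OF T(1)])
    \<comment> \<open>If p were the constant \<mu>, it would take this value at any point of the
      spectrum, and there is such a point.\<close>
    show "[:\<mu>:] - p \<noteq> 0"
      using * self_adjoint_norm_in_spectrum[OF T] by auto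
  qed (use * in auto)
  also have "op_poly G ([:\<mu>:] - p) T = op_diff G (op_scalar G \<mu>) (op_poly G p T)"
    by (rule NG_eqI) (use T in \<open>auto simp: op_poly_diff\<close>)
  finally show False using m by (simp add: op_spectrum_def)
qed

text \<open>The C*-identity: |p(T) x|^2 is the inner product of x with q(T) x, where q is p times
  its coefficientwise conjugate. The operator q(T) is self-adjoint, so its norm is |q(\<nu>)| for
  some \<nu> in the spectrum of T; as \<nu> is real, this equals |p(\<nu>)|^2.\<close>

lemma op_bound_poly:
  assumes T: "T \<in> NG" "self_adjoint T" and c: "\<And>\<nu>. \<nu> \<in> op_spectrum G T \<Longrightarrow> norm (poly p \<nu>) \<le> c"
  shows "op_bound (op_poly G p T) c"
proof -
  let ?q = "map_poly cnj p * p"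
  have sa: "self_adjoint (op_poly G ?q T)"
    unfolding self_adjoint_def
  proof (intro ballI)
    fix x y assume "x \<in> HG" "y \<in> HG"
    then show "ip (op_poly G ?q T x) y = ip x (op_poly G ?q T y)"
      using inner_op_poly[OF T, of x y "map_poly cnj p * p"] T
      by (simp add: map_poly_cnj_mult mult.commute)
  qed
  obtain \<mu> where mu: "\<mu> \<in> op_spectrum G (op_poly G ?q T)" "op_bound (op_poly G ?q T) (norm \<mu>)"
    using self_adjoint_norm_in_spectrum[OF _ sa] T by auto
  then obtain \<nu> where nu: "\<nu> \<in> op_spectrum G T" "poly ?q \<nu> = \<mu>"
    using spectral_mapping_poly[OF T] by blast
  have "cnj \<nu> = \<nu>"
    using self_adjoint_spectrum_real[OF T nu(1)] by (simp add: complex_eq_iff)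
  then have "norm \<mu> = (norm (poly p \<nu>))\<^sup>2"
    using nu(2) by (auto simp: norm_mult power2_eq_square)
  also have "\<dots> \<le> c\<^sup>2"
    using c[OF nu(1)] by (intro power_mono) auto
  finally have mc: "norm \<mu> \<le> c\<^sup>2" .
  have c0: "0 \<le> c"
    using c[OF nu(1)] norm_ge_zero order_trans by blast
  show ?thesis
    unfolding op_bound_def
  proof
    fix x assume x: "x \<in> HG"
    let ?y = "op_poly G p T x"
    have "complex_of_real ((nrm ?y)\<^sup>2) = ip x (op_poly G ?q T x)"
      using x T inner_op_poly[OF T x, of ?y p] inner_self[of ?y] by (simp add: op_poly_mult)
    then have "(nrm ?y)\<^sup>2 = norm (ip x (op_poly G ?q T x))"
      by (metis abs_of_nonneg norm_of_real zero_le_power2)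
    also have "\<dots> \<le> nrm x * nrm (op_poly G ?q T x)"
      using x T by (intro norm_inner_le) auto
    also have "\<dots> \<le> nrm x * (c\<^sup>2 * nrm x)"
      using op_boundD[OF op_bound_mono[OF mu(2) mc] x] by (intro mult_left_mono) auto
    also have "\<dots> = (c * nrm x)\<^sup>2" by (simp add: power2_eq_square)
    finally show "nrm ?y \<le> c * nrm x"
      using c0 by (auto intro: power2_le_imp_le)
  qed
qed

end


section \<open>The continuous functional calculus\<close>

lemma complex_poly_approximation:
  fixes h :: "real \<Rightarrow> real"
  assumes "continuous_on {a..b} h" "0 < \<epsilon>"
  shows "\<exists>p. \<forall>t\<in>{a..b}. norm (poly p (complex_of_real t) - complex_of_real (h t)) \<le> \<epsilon>"
proof -
  obtain g where g: "real_polynomial_function g" "\<And>t. t \<in> {a..b} \<Longrightarrow> \<bar>h t - g t\<bar> < \<epsilon>"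
    using Stone_Weierstrass_real_polynomial_function[OF compact_Icc assms] by metis
  then obtain c n where "g = (\<lambda>t. \<Sum>i\<le>n. c i * t ^ i)"
    using real_polynomial_function_iff_sum by auto
  then have "poly (\<Sum>i\<le>n. monom (complex_of_real (c i)) i) (complex_of_real t) = complex_of_real (g t)" for t
    by (simp add: poly_sum poly_monom)
  then have "norm (poly (\<Sum>i\<le>n. monom (complex_of_real (c i)) i) (complex_of_real t) - complex_of_real (h t)) \<le> \<epsilon>"
    if "t \<in> {a..b}" for t
    using g(2)[OF that] by (simp flip: of_real_diff add: norm_of_real abs_minus_commute)
  then show ?thesis by blast
qed

context group
begin

text \<open>Expresses that B is h(T), seen from a set X that will contain the spectrum but may be
  larger, so that one interval can serve all groups. Being a relation, it allows B to be exhibited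
  directly, with existence and uniqueness treated separately; the form with \<epsilon> lets
  approximants be combined without choosing sequences.\<close>

definition calculus :: "'a l2op \<Rightarrow> complex set \<Rightarrow> (complex \<Rightarrow> complex) \<Rightarrow> 'a l2op \<Rightarrow> bool" where
  "calculus T X h B \<longleftrightarrow> B \<in> NG \<and>
     (\<forall>\<epsilon>>0. \<exists>p. (\<forall>t\<in>X. norm (poly p t - h t) \<le> \<epsilon>) \<and> op_bound (op_diff G (op_poly G p T) B) \<epsilon>)"

lemma calculus_NG: "calculus T X h B \<Longrightarrow> B \<in> NG"
  by (simp add: calculus_def)

lemma calculusE:
  assumes "calculus T X h B" "0 < \<epsilon>"
  obtains p where "\<And>t. t \<in> X \<Longrightarrow> norm (poly p t - h t) \<le> \<epsilon>" "op_bound (op_diff G (op_poly G p T) B) \<epsilon>"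
  using assms unfolding calculus_def by meson

lemma calculus_poly: "T \<in> NG \<Longrightarrow> calculus T X (poly p) (op_poly G p T)"
  unfolding calculus_def by (auto intro!: exI[of _ p] simp: op_bound_def)

lemma calculus_const: "T \<in> NG \<Longrightarrow> calculus T X (\<lambda>_. c) (op_scalar G c)"
  using calculus_poly[of T X "[:c:]"] by (simp add: calculus_def)

lemma calculus_cong: "(\<And>t. t \<in> X \<Longrightarrow> h t = h' t) \<Longrightarrow> calculus T X h B \<Longrightarrow> calculus T X h' B"
  by (simp add: calculus_def)

lemma calculus_subset: "calculus T X h B \<Longrightarrow> Y \<subseteq> X \<Longrightarrow> calculus T Y h B"
  unfolding calculus_def by (meson subsetD)

text \<open>Carries \<open>op_bound_poly\<close> over to limits. Uniqueness is the case c = 0, and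
  the error of a polynomial approximation to the logarithm is another instance.\<close>

lemma calculus_bound:
  assumes T: "T \<in> NG" "self_adjoint T" "op_spectrum G T \<subseteq> X" and B: "calculus T X h B"
    and c: "\<And>t. t \<in> X \<Longrightarrow> norm (h t) \<le> c"
  shows "op_bound B c"
  unfolding op_bound_def
proof
  fix x assume x: "x \<in> HG"
  have le: "nrm (B x) \<le> c * nrm x + 2 * \<epsilon> * nrm x" if e: "\<epsilon> > 0" for \<epsilon>
  proof -
    obtain p where p: "\<And>t. t \<in> X \<Longrightarrow> norm (poly p t - h t) \<le> \<epsilon>"
      "op_bound (op_diff G (op_poly G p T) B) \<epsilon>"
      using calculusE[OF B e] by metis
    have "norm (poly p t) \<le> c + \<epsilon>" if "t \<in> op_spectrum G T" for t
      using norm_triangle_sub[of "poly p t" "h t"] p(1)[of t] c[of t] that T(3) by fastforce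
    then have "op_bound (op_poly G p T) (c + \<epsilon>)" by (rule op_bound_poly[OF T(1,2)])
    then have "nrm (op_poly G p T x) \<le> (c + \<epsilon>) * nrm x" using x by (rule op_boundD)
    moreover have "nrm (op_poly G p T x - B x) \<le> \<epsilon> * nrm x" using op_boundD[OF p(2) x] x by simp
    moreover have "nrm (B x) \<le> nrm (op_poly G p T x) + nrm (B x - op_poly G p T x)"
      using nrm_triangle[of "op_poly G p T x" "B x - op_poly G p T x"] x T calculus_NG[OF B] by simp
    ultimately show ?thesis by (simp add: algebra_simps nrm_diff_commute)
  qed
  show "nrm (B x) \<le> c * nrm x"
  proof (rule field_le_epsilon)
    fix e :: real assume e: "0 < e"
    \<comment> \<open>The summand 1 keeps the denominator positive for x = 0.\<close>
    define \<epsilon> where "\<epsilon> = e / (2 * (nrm x + 1))"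
    have pos: "0 < nrm x + 1" using nrm_nonneg[of x] by linarith
    then have "0 < \<epsilon>" using e by (simp add: \<epsilon>_def)
    moreover have "2 * \<epsilon> * nrm x \<le> e"
      using pos e by (simp add: \<epsilon>_def field_simps)
    ultimately show "nrm (B x) \<le> c * nrm x + e" using le[of \<epsilon>] by linarith
  qed
qed

lemma calculus_diff:
  assumes T: "T \<in> NG" and B: "calculus T X h B" "calculus T X h' B'"
  shows "calculus T X (\<lambda>t. h t - h' t) (op_diff G B B')"
  unfolding calculus_def
proof (intro conjI allI impI)
  show "op_diff G B B' \<in> NG" using B calculus_NG by simp
  fix \<epsilon> :: real assume "\<epsilon> > 0"
  then have e: "\<epsilon> / 2 > 0" by simp
  obtain p where p: "\<And>t. t \<in> X \<Longrightarrow> norm (poly p t - h t) \<le> \<epsilon> / 2"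
    "op_bound (op_diff G (op_poly G p T) B) (\<epsilon> / 2)" using calculusE[OF B(1) e] by metis
  obtain q where q: "\<And>t. t \<in> X \<Longrightarrow> norm (poly q t - h' t) \<le> \<epsilon> / 2"
    "op_bound (op_diff G (op_poly G q T) B') (\<epsilon> / 2)" using calculusE[OF B(2) e] by metis
  have "norm (poly (p - q) t - (h t - h' t)) \<le> \<epsilon>" if "t \<in> X" for t
    using norm_triangle_ineq4[of "poly p t - h t" "poly q t - h' t"] p(1)[OF that] q(1)[OF that]
    by (simp add: algebra_simps)
  moreover have "op_bound (op_diff G (op_diff G (op_poly G p T) B) (op_diff G (op_poly G q T) B')) (\<epsilon> / 2 + \<epsilon> / 2)"
    using B T calculus_NG by (intro op_bound_diff p q) auto
  then have "op_bound (op_diff G (op_poly G (p - q) T) (op_diff G B B')) \<epsilon>"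
    using T by (simp add: op_bound_def op_poly_diff algebra_simps)
  ultimately show "\<exists>p. (\<forall>t\<in>X. norm (poly p t - (h t - h' t)) \<le> \<epsilon>) \<and>
      op_bound (op_diff G (op_poly G p T) (op_diff G B B')) \<epsilon>" by blast
qed

lemma calculus_add:
  assumes T: "T \<in> NG" and B: "calculus T X h B" "calculus T X h' B'"
  shows "calculus T X (\<lambda>t. h t + h' t) (op_add B B')"
proof -
  have "calculus T X (\<lambda>t. h t - (0 - h' t)) (op_diff G B (op_diff G (op_scalar G 0) B'))"
    by (intro calculus_diff calculus_const T B)
  moreover have "op_diff G B (op_diff G (op_scalar G 0) B') = op_add B B'"
    by (rule NG_eqI) (use B calculus_NG in auto)
  ultimately show ?thesis by simp
qed

lemma calculus_mult:
  assumes T: "T \<in> NG" "self_adjoint T" "op_spectrum G T \<subseteq> X"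
    and B: "calculus T X h B" "calculus T X h' B'" and bdd: "bounded (h ` X)" "bounded (h' ` X)"
  shows "calculus T X (\<lambda>t. h t * h' t) (op_mult B B')"
  unfolding calculus_def
proof (intro conjI allI impI)
  have NG: "B \<in> NG" "B' \<in> NG" using B calculus_NG by auto
  then show "op_mult B B' \<in> NG" by simp
  obtain c where c: "0 < c" "\<And>t. t \<in> X \<Longrightarrow> norm (h t) \<le> c"
    using bdd(1) by (auto simp: bounded_pos)
  obtain d where d: "0 < d" "\<And>t. t \<in> X \<Longrightarrow> norm (h' t) \<le> d"
    using bdd(2) by (auto simp: bounded_pos)
  fix \<epsilon> :: real assume e: "\<epsilon> > 0"
  \<comment> \<open>The error splits as p (q - h') + (p - h) h', both for functions and for
    operators. The cap at 1 gives |p| \<le> c + 1, and the quotient makes (c + 1) \<eta> + \<eta> d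
    at most \<epsilon>.\<close>
  define \<eta> where "\<eta> = min 1 (\<epsilon> / (c + 1 + d))"
  have eta: "\<eta> > 0" "\<eta> \<le> 1" using e c d by (auto simp: \<eta>_def)
  have "\<eta> \<le> \<epsilon> / (c + 1 + d)" by (simp add: \<eta>_def)
  then have eta': "(c + 1) * \<eta> + \<eta> * d \<le> \<epsilon>"
    using c d by (simp add: pos_le_divide_eq algebra_simps)
  obtain p where p: "\<And>t. t \<in> X \<Longrightarrow> norm (poly p t - h t) \<le> \<eta>"
    "op_bound (op_diff G (op_poly G p T) B) \<eta>" using calculusE[OF B(1) eta(1)] by metis
  obtain q where q: "\<And>t. t \<in> X \<Longrightarrow> norm (poly q t - h' t) \<le> \<eta>"
    "op_bound (op_diff G (op_poly G q T) B') \<eta>" using calculusE[OF B(2) eta(1)] by metis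
  have pb: "norm (poly p t) \<le> c + 1" if "t \<in> X" for t
    using norm_triangle_sub[of "poly p t" "h t"] p(1)[OF that] c(2)[OF that] eta by linarith
  have "norm (poly (p * q) t - h t * h' t) \<le> \<epsilon>" if t: "t \<in> X" for t
  proof -
    have "poly (p * q) t - h t * h' t = poly p t * (poly q t - h' t) + (poly p t - h t) * h' t"
      by (simp add: algebra_simps)
    also have "norm \<dots> \<le> norm (poly p t) * norm (poly q t - h' t) + norm (poly p t - h t) * norm (h' t)"
      by (metis norm_mult norm_triangle_ineq)
    also have "\<dots> \<le> (c + 1) * \<eta> + \<eta> * d"
      using pb[OF t] p(1)[OF t] q(1)[OF t] c d(2)[OF t] eta by (intro add_mono mult_mono) auto
    finally show ?thesis using eta' by linarith
  qed
  moreover have "op_bound (op_diff G (op_poly G (p * q) T) (op_mult B B')) \<epsilon>"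
  proof -
    have "op_bound (op_poly G p T) (c + 1)"
      by (rule op_bound_poly[OF T(1,2)]) (use pb T(3) in auto)
    moreover have "op_bound B' d" by (rule calculus_bound[OF T B(2) d(2)])
    ultimately have "op_bound (op_add (op_mult (op_poly G p T) (op_diff G (op_poly G q T) B'))
        (op_mult (op_diff G (op_poly G p T) B) B')) ((c + 1) * \<eta> + \<eta> * d)"
      using c eta NG T by (intro op_bound_add op_bound_mult p q) auto
    then show ?thesis
      using eta' NG T by (intro op_bound_mono[OF _ eta']) (simp add: op_bound_def op_poly_mult NG_diff)
  qed
  ultimately show "\<exists>p. (\<forall>t\<in>X. norm (poly p t - h t * h' t) \<le> \<epsilon>) \<and>
      op_bound (op_diff G (op_poly G p T) (op_mult B B')) \<epsilon>" by blast
qed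

text \<open>With h the square root, polynomials in |A| become functions of A' A. Boundedness of h
  confines its values to a compact set, on which q is bounded, as the product rule requires.\<close>

lemma calculus_poly_comp:
  assumes T: "T \<in> NG" "self_adjoint T" "op_spectrum G T \<subseteq> X"
    and B: "calculus T X h B" and bdd: "bounded (h ` X)"
  shows "calculus T X (\<lambda>t. poly q (h t)) (op_poly G q B)"
proof (induction q)
  case 0
  have "op_poly G 0 B = op_scalar G 0"
    by (rule NG_eqI) (use calculus_NG[OF B] in auto)
  then show ?case using calculus_const[OF T(1)] by simp
next
  case (pCons a q)
  have "compact (closure (h ` X))" using bdd by (simp add: compact_closure)
  then have "bounded (poly q ` closure (h ` X))"
    by (intro compact_imp_bounded compact_continuous_image continuous_intros)
  then have "bounded ((\<lambda>t. poly q (h t)) ` X)"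
    by (rule bounded_subset) (use closure_subset[of "h ` X"] in auto)
  then show ?case
    using calculus_add[OF T(1) calculus_const[OF T(1)] calculus_mult[OF T B pCons.IH bdd]] calculus_NG[OF B]
    by (simp add: op_poly_pCons)
qed

text \<open>Admits approximants that are themselves only functions of T and not polynomials in T. It
  is applied to polynomials in |A|, seen as functions of A' A.\<close>

lemma calculus_limit:
  assumes T: "T \<in> NG" and B: "B \<in> NG"
    and lim: "\<And>\<epsilon>. \<epsilon> > 0 \<Longrightarrow> \<exists>h' B'. calculus T X h' B' \<and> (\<forall>t\<in>X. norm (h' t - h t) \<le> \<epsilon>) \<and>
      op_bound (op_diff G B' B) \<epsilon>"
  shows "calculus T X h B"
  unfolding calculus_def
proof (intro conjI allI impI)
  fix \<epsilon> :: real assume "\<epsilon> > 0"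
  then have e: "\<epsilon> / 2 > 0" by simp
  obtain h' B' where h': "calculus T X h' B'" "\<And>t. t \<in> X \<Longrightarrow> norm (h' t - h t) \<le> \<epsilon> / 2"
    "op_bound (op_diff G B' B) (\<epsilon> / 2)" using lim[OF e] by auto
  obtain p where p: "\<And>t. t \<in> X \<Longrightarrow> norm (poly p t - h' t) \<le> \<epsilon> / 2"
    "op_bound (op_diff G (op_poly G p T) B') (\<epsilon> / 2)" using calculusE[OF h'(1) e] by metis
  have "norm (poly p t - h t) \<le> \<epsilon>" if "t \<in> X" for t
    using norm_triangle_ineq[of "poly p t - h' t" "h' t - h t"] p(1)[OF that] h'(2)[OF that] by simp
  moreover have "op_bound (op_add (op_diff G (op_poly G p T) B') (op_diff G B' B)) (\<epsilon> / 2 + \<epsilon> / 2)"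
    using calculus_NG[OF h'(1)] T B by (intro op_bound_add p h') auto
  then have "op_bound (op_diff G (op_poly G p T) B) \<epsilon>"
    by (simp add: op_bound_def)
  ultimately show "\<exists>p. (\<forall>t\<in>X. norm (poly p t - h t) \<le> \<epsilon>) \<and> op_bound (op_diff G (op_poly G p T) B) \<epsilon>"
    by blast
qed (rule B)

text \<open>By \<open>op_bound_poly\<close>, polynomials converging uniformly on X give a Cauchy
  sequence of operators. The factor 2 in the rate comes from comparing two approximants through
  h.\<close>

lemma calculus_exists:
  assumes T: "T \<in> NG" "self_adjoint T" "op_spectrum G T \<subseteq> X"
    and approx: "\<And>\<epsilon>. \<epsilon> > 0 \<Longrightarrow> \<exists>p. \<forall>t\<in>X. norm (poly p t - h t) \<le> \<epsilon>"
  shows "\<exists>B. calculus T X h B"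
proof -
  have "\<exists>p. \<forall>t\<in>X. norm (poly p t - h t) \<le> inverse (real (Suc n))" for n
    by (rule approx) simp
  then obtain p where p: "\<And>n t. t \<in> X \<Longrightarrow> norm (poly (p n) t - h t) \<le> inverse (real (Suc n))"
    by metis
  define e where "e n = 2 * inverse (real (Suc n))" for n
  have e: "e \<longlonglongrightarrow> 0"
    unfolding e_def using tendsto_mult_right_zero[OF LIMSEQ_inverse_real_of_nat] by simp
  have "op_bound (op_diff G (op_poly G (p n) T) (op_poly G (p m) T)) (e n)" if nm: "n \<le> m" for n m
  proof -
    have "op_bound (op_poly G (p n - p m) T) (e n)"
    proof (rule op_bound_poly[OF T(1,2)])
      fix t assume "t \<in> op_spectrum G T"
      then have t: "t \<in> X" using T by auto
      have "inverse (real (Suc m)) \<le> inverse (real (Suc n))" using nm by simp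
      moreover have eq: "poly (p n - p m) t = (poly (p n) t - h t) - (poly (p m) t - h t)" by simp
      ultimately show "norm (poly (p n - p m) t) \<le> e n"
        using norm_triangle_ineq4[of "poly (p n) t - h t" "poly (p m) t - h t"] p[OF t, of n] p[OF t, of m]
        unfolding e_def eq by linarith
    qed
    then show ?thesis using T by (simp add: op_bound_def op_poly_diff)
  qed
  from NG_complete[OF op_poly_NG[OF T(1)] e this]
  obtain B where B: "B \<in> NG" "\<And>n. op_bound (op_diff G (op_poly G (p n) T) B) (e n)" by blast
  have "calculus T X h B"
    unfolding calculus_def
  proof (intro conjI allI impI)
    fix \<epsilon> :: real assume "\<epsilon> > 0"
    then obtain n where n: "e n < \<epsilon>"
      using eventually_happens[OF order_tendstoD(2)[OF e]] by auto
    have "inverse (real (Suc n)) \<le> e n" by (simp add: e_def)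
    then have "norm (poly (p n) t - h t) \<le> \<epsilon>" if "t \<in> X" for t
      using p[OF that, of n] n by linarith
    moreover have "op_bound (op_diff G (op_poly G (p n) T) B) \<epsilon>"
      by (rule op_bound_mono[OF B(2) less_imp_le[OF n]])
    ultimately show "\<exists>p. (\<forall>t\<in>X. norm (poly p t - h t) \<le> \<epsilon>) \<and> op_bound (op_diff G (op_poly G p T) B) \<epsilon>"
      by blast
  qed (rule B)
  then show ?thesis by blast
qed

lemma calculus_unique:
  assumes T: "T \<in> NG" "self_adjoint T" "op_spectrum G T \<subseteq> X"
    and B: "calculus T X h B" "calculus T X h B'"
  shows "B = B'"
proof (rule NG_eqI)
  fix x assume x: "x \<in> HG"
  have "op_bound (op_diff G B B') 0"
    by (rule calculus_bound[OF T calculus_diff[OF T(1) B]]) simp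
  from op_boundD[OF this x] have "nrm (B x - B' x) = 0"
    using nrm_nonneg[of "B x - B' x"] x by simp
  then show "B x = B' x"
    using x B calculus_NG by simp
qed (use B calculus_NG in auto)

text \<open>The definite description refers to the exact spectrum. Approximants on X restrict to it,
  which makes B a candidate; conversely any candidate is related to h by \<open>calculus\<close> on
  the spectrum, where uniqueness identifies it with B.\<close>

lemma cont_fun_calc_eq:
  assumes T: "T \<in> NG" "self_adjoint T" "op_spectrum G T \<subseteq> X" and B: "calculus T X h B"
  shows "cont_fun_calc G h T = B"
  unfolding cont_fun_calc_def
proof (rule the_equality)
  have "\<exists>p. (\<forall>t\<in>X. norm (poly p t - h t) \<le> inverse (real (Suc n))) \<and>
      op_bound (op_diff G (op_poly G p T) B) (inverse (real (Suc n)))" for n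
    using B unfolding calculus_def by simp
  then obtain p where p: "\<And>n t. t \<in> X \<Longrightarrow> norm (poly (p n) t - h t) \<le> inverse (real (Suc n))"
      "\<And>n. op_bound (op_diff G (op_poly G (p n) T) B) (inverse (real (Suc n)))"
    by metis
  have small: "\<forall>\<^sub>F n in sequentially. inverse (real (Suc n)) < \<epsilon>" if "\<epsilon> > 0" for \<epsilon>
    using order_tendstoD(2)[OF LIMSEQ_inverse_real_of_nat that] .
  have "uniform_limit (op_spectrum G T) (\<lambda>n. poly (p n)) h sequentially"
    unfolding uniform_limit_iff dist_norm
    using p(1) T(3) by (auto elim!: eventually_mono[OF small] intro: le_less_trans simp del: of_nat_Suc)
  moreover have "(\<lambda>n. op_norm G (op_diff G (op_poly G (p n) T) B)) \<longlonglongrightarrow> 0"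
    by (rule tendsto_sandwich[OF _ _ tendsto_const LIMSEQ_inverse_real_of_nat])
      (use T calculus_NG[OF B] in \<open>auto intro!: always_eventually op_norm_nonneg op_norm_le[OF p(2)] simp del: of_nat_Suc\<close>)
  ultimately show "B \<in> NG \<and> (\<exists>p. uniform_limit (op_spectrum G T) (\<lambda>n. poly (p n)) h sequentially \<and>
      (\<lambda>n. op_norm G (op_diff G (op_poly G (p n) T) B)) \<longlonglongrightarrow> 0)"
    using calculus_NG[OF B] by blast
next
  fix B' assume "B' \<in> NG \<and> (\<exists>p. uniform_limit (op_spectrum G T) (\<lambda>n. poly (p n)) h sequentially \<and>
      (\<lambda>n. op_norm G (op_diff G (op_poly G (p n) T) B')) \<longlonglongrightarrow> 0)"
  then obtain p where B': "B' \<in> NG" and p: "uniform_limit (op_spectrum G T) (\<lambda>n. poly (p n)) h sequentially"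
      "(\<lambda>n. op_norm G (op_diff G (op_poly G (p n) T) B')) \<longlonglongrightarrow> 0"
    by blast
  have "calculus T (op_spectrum G T) h B'"
    unfolding calculus_def
  proof (intro conjI allI impI)
    fix \<epsilon> :: real assume e: "\<epsilon> > 0"
    have "\<forall>\<^sub>F n in sequentially. (\<forall>t\<in>op_spectrum G T. norm (poly (p n) t - h t) < \<epsilon>) \<and>
        op_norm G (op_diff G (op_poly G (p n) T) B') < \<epsilon>"
      using p(1)[unfolded uniform_limit_iff dist_norm, rule_format, OF e] order_tendstoD(2)[OF p(2) e]
      by (rule eventually_conj)
    then obtain n where n: "\<forall>t\<in>op_spectrum G T. norm (poly (p n) t - h t) < \<epsilon>"
        "op_norm G (op_diff G (op_poly G (p n) T) B') < \<epsilon>"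
      using eventually_happens by fastforce
    have "op_bound (op_diff G (op_poly G (p n) T) B') \<epsilon>"
      by (rule op_bound_mono[OF op_bound_op_norm less_imp_le[OF n(2)]]) (use T B' in simp)
    then show "\<exists>p. (\<forall>t\<in>op_spectrum G T. norm (poly p t - h t) \<le> \<epsilon>) \<and>
        op_bound (op_diff G (op_poly G p T) B') \<epsilon>" using n(1) less_imp_le by blast
  qed (rule B')
  then show "B' = B"
    by (rule calculus_unique[OF T(1,2) order_refl _ calculus_subset[OF B T(3)]])
qed

text \<open>The approximating p may have non-real coefficients. Since h and the spectrum are real,
  the conjugated polynomial approximates h there as well, so B is close to p(T) and also to its
  adjoint. The errors \<epsilon> and 2 \<epsilon> + \<epsilon> add up to the factor 4.\<close>

lemma calculus_self_adjoint:
  assumes T: "T \<in> NG" "self_adjoint T" "op_spectrum G T \<subseteq> X" and B: "calculus T X h B"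
    and real: "\<And>t. t \<in> X \<Longrightarrow> cnj (h t) = h t"
  shows "self_adjoint B"
  unfolding self_adjoint_def
proof (intro ballI)
  fix x y assume x: "x \<in> HG" and y: "y \<in> HG"
  have NG: "B \<in> NG" using calculus_NG[OF B] .
  have le: "norm (ip (B x) y - ip x (B y)) \<le> 4 * \<epsilon> * (nrm x * nrm y)" if e: "\<epsilon> > 0" for \<epsilon>
  proof -
    obtain p where p: "\<And>t. t \<in> X \<Longrightarrow> norm (poly p t - h t) \<le> \<epsilon>"
      "op_bound (op_diff G (op_poly G p T) B) \<epsilon>" using calculusE[OF B e] by metis
    let ?q = "map_poly cnj p"
    have "op_bound (op_poly G (?q - p) T) (2 * \<epsilon>)"
    proof (rule op_bound_poly[OF T(1,2)])
      fix t assume t: "t \<in> op_spectrum G T"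
      then have tX: "t \<in> X" using T by auto
      have "cnj t = t" using self_adjoint_spectrum_real[OF T(1,2) t] by (simp add: complex_eq_iff)
      then have "poly (?q - p) t = cnj (poly p t - h t) - (poly p t - h t)"
        using real[OF tX] by simp
      also have "norm \<dots> \<le> norm (poly p t - h t) + norm (poly p t - h t)"
        by (metis norm_triangle_ineq4 complex_mod_cnj)
      finally show "norm (poly (?q - p) t) \<le> 2 * \<epsilon>" using p(1)[OF tX] by linarith
    qed
    then have "nrm (op_poly G ?q T y - op_poly G p T y) \<le> 2 * \<epsilon> * nrm y"
      using op_boundD[of "op_poly G (?q - p) T" "2 * \<epsilon>" y] y T by (simp add: op_poly_diff)
    moreover have "nrm (op_poly G p T y - B y) \<le> \<epsilon> * nrm y" using op_boundD[OF p(2) y] y by simp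
    ultimately have 1: "nrm (op_poly G ?q T y - B y) \<le> 3 * \<epsilon> * nrm y"
      using nrm_triangle3[of "op_poly G ?q T y" "op_poly G p T y" "B y"] y T NG by simp
    have 2: "nrm (B x - op_poly G p T x) \<le> \<epsilon> * nrm x"
      using op_boundD[OF p(2) x] x by (simp add: nrm_diff_commute)
    have eq: "ip (B x) y - ip x (B y) = ip (B x - op_poly G p T x) y + ip x (op_poly G ?q T y - B y)"
      using x y T NG inner_op_poly[OF T(1,2) x y, of p] by (simp add: inner_diff_left inner_diff_right)
    have "norm (ip (B x) y - ip x (B y)) \<le>
        nrm (B x - op_poly G p T x) * nrm y + nrm x * nrm (op_poly G ?q T y - B y)"
      unfolding eq by (rule order_trans[OF norm_triangle_ineq add_mono[OF norm_inner_le norm_inner_le]]) (use x y T NG in auto)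
    also have "\<dots> \<le> \<epsilon> * nrm x * nrm y + nrm x * (3 * \<epsilon> * nrm y)"
      by (rule add_mono[OF mult_right_mono[OF 2 nrm_nonneg] mult_left_mono[OF 1 nrm_nonneg]])
    finally show ?thesis by (simp add: algebra_simps)
  qed
  have "norm (ip (B x) y - ip x (B y)) \<le> 0"
  proof (rule field_le_epsilon)
    fix e :: real assume e: "0 < e"
    have pos: "0 < nrm x * nrm y + 1" using mult_nonneg_nonneg[OF nrm_nonneg nrm_nonneg, of x y] by linarith
    define \<epsilon> where "\<epsilon> = e / (4 * (nrm x * nrm y + 1))"
    have "0 < \<epsilon>" using pos e by (simp add: \<epsilon>_def)
    moreover have "4 * \<epsilon> * (nrm x * nrm y) \<le> e"
      using pos e by (simp add: \<epsilon>_def field_simps)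
    ultimately show "norm (ip (B x) y - ip x (B y)) \<le> 0 + e" using le[of \<epsilon>] by linarith
  qed
  then show "ip (B x) y = ip x (B y)" by simp
qed

end


section \<open>The logarithm of the absolute value of an invertible operator\<close>

context group
begin

section \<open>Trace, adjoint and the spectrum of a positive invertible operator\<close>

lemma norm_vN_trace_diff_le:
  assumes "A \<in> NG" "B \<in> NG" "op_bound (op_diff G A B) \<epsilon>"
  shows "norm (vN_trace G A - vN_trace G B) \<le> \<epsilon>"
proof -
  have "vN_trace G A - vN_trace G B = ip (A (delta \<one>) - B (delta \<one>)) (delta \<one>)"
    using assms by (simp add: vN_trace_def inner_diff_left)
  also have "norm \<dots> \<le> nrm (A (delta \<one>) - B (delta \<one>)) * nrm (delta \<one>)"
    using assms by (intro norm_inner_le) auto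
  also have "\<dots> \<le> \<epsilon>"
    using op_boundD[OF assms(3), of "delta \<one>"] by (simp add: nrm_delta_one)
  finally show ?thesis .
qed

text \<open>Only uniqueness of adjoints is at stake: in the application the adjoint is known
  explicitly, as \<open>right_rep\<close> of \<open>ell1_star G f\<close>.\<close>

lemma op_adjoint_eq:
  assumes A: "A \<in> NG" "A' \<in> NG" and adj: "\<And>x y. x \<in> HG \<Longrightarrow> y \<in> HG \<Longrightarrow> ip (A x) y = ip x (A' y)"
  shows "op_adjoint G A = A'"
  unfolding op_adjoint_def
proof (rule the_equality)
  show "A' \<in> bounded_ops G \<and> (\<forall>x\<in>HG. \<forall>y\<in>HG. ip (A x) y = ip x (A' y))"
    using A adj by (auto simp: group_vN_def)
next
  fix B assume "B \<in> bounded_ops G \<and> (\<forall>x\<in>HG. \<forall>y\<in>HG. ip (A x) y = ip x (B y))"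
  then have B: "B \<in> HG \<rightarrow>\<^sub>E HG" "\<And>x y. x \<in> HG \<Longrightarrow> y \<in> HG \<Longrightarrow> ip (A x) y = ip x (B y)"
    by (auto simp: bounded_ops_def)
  show "B = A'"
  proof (rule extensionalityI)
    fix y assume y: "y \<in> HG"
    have By: "B y \<in> HG" using B(1) y by auto
    let ?d = "B y - A' y"
    have d: "?d \<in> HG" using By y A by simp
    have "ip ?d ?d = 0"
      using B(2)[OF d y] adj[OF d y] d By y A by (simp add: inner_diff_right[of "B y" "A' y" ?d])
    then have "nrm ?d = 0" using inner_self[OF d] by simp
    then have "?d = 0" using d by simp
    then show "B y = A' y" by simp
  qed (use B(1) A NG_extensional in \<open>auto simp: PiE_def\<close>)
qed

text \<open>T = A' A and its inverse S = D D' both have norm at most M^2. The Neumann series for T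
  bounds the spectrum above by M^2, and the one for S keeps it away from 0 by 1 / M^2.
  Self-adjointness makes it real, positivity of T nonnegative.\<close>

lemma spectrum_of_positive_invertible:
  assumes NG: "A \<in> NG" "A' \<in> NG" "D \<in> NG" "D' \<in> NG"
    and adj: "\<And>x y. x \<in> HG \<Longrightarrow> y \<in> HG \<Longrightarrow> ip (A x) y = ip x (A' y)"
    and inv: "\<And>x. x \<in> HG \<Longrightarrow> A (D x) = x" "\<And>x. x \<in> HG \<Longrightarrow> D (A x) = x"
      "\<And>x. x \<in> HG \<Longrightarrow> A' (D' x) = x" "\<And>x. x \<in> HG \<Longrightarrow> D' (A' x) = x"
    and M: "0 < M" "op_bound A M" "op_bound A' M" "op_bound D M" "op_bound D' M"
  shows "self_adjoint (op_mult A' A)"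
    and "op_spectrum G (op_mult A' A) \<subseteq> complex_of_real ` {1 / M\<^sup>2..M\<^sup>2}"
proof -
  let ?T = "op_mult A' A" and ?S = "op_mult D D'"
  have adj': "ip (A' x) y = ip x (A y)" if "x \<in> HG" "y \<in> HG" for x y
    using adj[OF that(2,1)] by (metis inner_commute)
  show sa: "self_adjoint ?T"
    using NG by (simp add: self_adjoint_def adj adj')
  have T: "?T \<in> NG" "?S \<in> NG" using NG by auto
  have bT: "op_bound ?T (M\<^sup>2)" "op_bound ?S (M\<^sup>2)"
    unfolding power2_eq_square using NG M by (auto intro!: op_bound_mult)
  have uT: "?T \<in> Units (group_vN G)"
    unfolding NG_unit_iff using T NG inv by (auto intro!: bexI[of _ ?S])
  show "op_spectrum G ?T \<subseteq> complex_of_real ` {1 / M\<^sup>2..M\<^sup>2}"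
  proof
    fix z assume z: "z \<in> op_spectrum G ?T"
    then have Im: "Im z = 0" by (rule self_adjoint_spectrum_real[OF T(1) sa])
    then obtain r where r: "z = complex_of_real r"
      by (metis complex_is_Real_iff Reals_cases)
    have nu: "op_diff G (op_scalar G z) ?T \<notin> Units (group_vN G)"
      using z by (simp add: op_spectrum_def)
    have up: "\<bar>r\<bar> \<le> M\<^sup>2"
    proof (rule ccontr)
      assume "\<not> ?thesis"
      then have "op_diff G (op_scalar G z) ?T \<in> Units (group_vN G)"
        by (intro Neumann[OF T(1) bT(1)]) (auto simp: r)
      then show False using nu by simp
    qed
    have nz: "r \<noteq> 0"
    proof
      assume "r = 0"
      then have "op_diff G (op_scalar G z) ?T = op_mult (op_scalar G (-1)) ?T"
        by (intro NG_eqI) (use T NG r in auto)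
      then show False using nu NG_unit_mult[OF NG_unit_scalar uT, of "-1"] by simp
    qed
    have lo: "1 / M\<^sup>2 \<le> \<bar>r\<bar>"
    proof (rule ccontr)
      assume "\<not> ?thesis"
      then have "M\<^sup>2 < norm (1 / z)"
        using nz M(1) by (simp add: r norm_divide field_simps)
      then have "op_diff G (op_scalar G (1 / z)) ?S \<in> Units (group_vN G)"
        by (intro Neumann[OF T(2) bT(2)]) auto
      \<comment> \<open>Since T S = 1, the operator z - T equals -z T (1/z - S), a product of
        units.\<close>
      then have "op_mult (op_scalar G (- z)) (op_mult ?T (op_diff G (op_scalar G (1 / z)) ?S)) \<in> Units (group_vN G)"
        using nz r by (intro NG_unit_mult NG_unit_scalar uT) auto
      also have "op_mult (op_scalar G (- z)) (op_mult ?T (op_diff G (op_scalar G (1 / z)) ?S)) =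
          op_diff G (op_scalar G z) ?T"
        by (rule NG_eqI)
          (use T NG inv nz r in \<open>auto simp: NG_diff NG_cscale cscale.scale_right_diff_distrib\<close>)
      finally show False using nu by simp
    qed
    have pos: "0 \<le> r"
    proof (rule ccontr)
      assume neg: "\<not> ?thesis"
      \<comment> \<open>Since \<open>0 \<le> T \<le> M\<^sup>2\<close>, the operator \<open>M\<^sup>2 - T\<close> has norm at most \<open>M\<^sup>2 < M\<^sup>2 - r\<close>.\<close>
      define c where "c = M\<^sup>2"
      have c: "0 \<le> c" by (simp add: c_def)
      let ?W = "op_diff G (op_scalar G c) ?T"
      have "op_bound ?W c"
        unfolding op_bound_def
      proof
        fix x assume x: "x \<in> HG"
        show "nrm (?W x) \<le> c * nrm x"
        proof (rule power2_le_imp_le)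
          \<comment> \<open>The inner product of c x with T x is c |A x|^2, and |A' A x|^2 \<le> c
            |A x|^2 because c = M^2. So the squared norm of c x - T x is at most c^2 |x|^2 - c |A
            x|^2.\<close>
          have ipx: "ip (complex_of_real c *\<^sub>c x) (A' (A x)) = complex_of_real (c * (nrm (A x))\<^sup>2)"
            using adj[of x "A x"] inner_self[of "A x"] x NG by (simp add: inner_cscale_left)
          have "(nrm (complex_of_real c *\<^sub>c x + - A' (A x)))\<^sup>2 = c\<^sup>2 * (nrm x)\<^sup>2 - 2 * c * (nrm (A x))\<^sup>2 + (nrm (A' (A x)))\<^sup>2"
            using x NG c by (subst nrm_add_square)
              (simp_all add: inner_minus_right ipx power_mult_distrib)
          moreover have "(nrm (A' (A x)))\<^sup>2 \<le> c * (nrm (A x))\<^sup>2"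
            using power_mono[OF op_boundD[OF M(3), of "A x"], of 2] x NG by (simp add: c_def power_mult_distrib)
          moreover have "0 \<le> c * (nrm (A x))\<^sup>2" using c by simp
          ultimately show "(nrm (?W x))\<^sup>2 \<le> (c * nrm x)\<^sup>2"
            using x by (simp add: power_mult_distrib)
        qed (use c in simp)
      qed
      then have "op_diff G (op_scalar G (complex_of_real (c - r))) ?W \<in> Units (group_vN G)"
        using T c neg by (intro Neumann) (auto simp: norm_of_real simp del: of_real_diff)
      then have "op_mult (op_scalar G (-1)) (op_diff G (op_scalar G (complex_of_real (c - r))) ?W) \<in> Units (group_vN G)"
        by (intro NG_unit_mult NG_unit_scalar) auto
      \<comment> \<open>With W = c - T this is -((c - r) - (c - T)) = r - T.\<close>
      also have "op_mult (op_scalar G (-1)) (op_diff G (op_scalar G (complex_of_real (c - r))) ?W) =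
          op_diff G (op_scalar G z) ?T"
        by (rule NG_eqI) (use T NG r in \<open>auto simp: cscale.scale_left_diff_distrib\<close>)
      finally show False using nu by simp
    qed
    show "z \<in> complex_of_real ` {1 / M\<^sup>2..M\<^sup>2}"
      using r up lo pos by auto
  qed
qed

lemma calculus_exists_real:
  assumes T: "T \<in> NG" "self_adjoint T" "op_spectrum G T \<subseteq> complex_of_real ` {a..b}"
    and h: "continuous_on {a..b} h" "\<And>t. H (complex_of_real t) = complex_of_real (h t)"
  shows "\<exists>B. calculus T (complex_of_real ` {a..b}) H B"
proof (rule calculus_exists[OF T])
  fix \<epsilon> :: real assume "\<epsilon> > 0"
  then show "\<exists>p. \<forall>t\<in>complex_of_real ` {a..b}. norm (poly p t - H t) \<le> \<epsilon>"
    using complex_poly_approximation[OF h(1)] by (simp add: h(2))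
qed

lemma bounded_real_image:
  assumes "continuous_on {a..b} h" "\<And>t. H (complex_of_real t) = complex_of_real (h t)"
  shows "bounded (H ` complex_of_real ` {a..b})"
proof -
  have "bounded ((\<lambda>t. complex_of_real (h t)) ` {a..b})"
    by (intro compact_imp_bounded compact_continuous_image continuous_intros assms(1) compact_Icc)
  then show ?thesis by (simp add: image_image assms(2))
qed

text \<open>For real m outside the claimed interval, t \<mapsto> 1 / (m - sqrt t) is continuous on
  {a..b}. Its value under the calculus of T inverts m - P by multiplicativity, so m is not in the
  spectrum.\<close>

lemma spectrum_sqrt:
  assumes T: "T \<in> NG" "self_adjoint T" "op_spectrum G T \<subseteq> complex_of_real ` {a..b}"
    and a: "0 < a"
    and P: "calculus T (complex_of_real ` {a..b}) (\<lambda>z. complex_of_real (sqrt (Re z))) P"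
  shows "self_adjoint P" "op_spectrum G P \<subseteq> complex_of_real ` {sqrt a..sqrt b}"
proof -
  let ?X = "complex_of_real ` {a..b}"
  show sa: "self_adjoint P"
    by (rule calculus_self_adjoint[OF T P]) simp
  have NG: "P \<in> NG" by (rule calculus_NG[OF P])
  show "op_spectrum G P \<subseteq> complex_of_real ` {sqrt a..sqrt b}"
  proof
    fix z assume z: "z \<in> op_spectrum G P"
    then have "Im z = 0" by (rule self_adjoint_spectrum_real[OF NG sa])
    then obtain m where m: "z = complex_of_real m"
      by (metis complex_is_Real_iff Reals_cases)
    show "z \<in> complex_of_real ` {sqrt a..sqrt b}"
    proof (rule ccontr)
      assume nz: "\<not> ?thesis"
      have ne: "m - sqrt t \<noteq> 0" if "t \<in> {a..b}" for t
      proof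
        assume "m - sqrt t = 0"
        then have "m \<in> {sqrt a..sqrt b}" using that by simp
        with m nz show False by blast
      qed
      let ?r = "\<lambda>t. 1 / (m - sqrt t)" and ?s = "\<lambda>t. m - sqrt t"
      have one_eq: "complex_of_real (?r t) * complex_of_real (?s t) = 1"
          "complex_of_real (?s t) * complex_of_real (?r t) = 1" if "t \<in> {a..b}" for t
        using ne[OF that] by (simp_all flip: of_real_mult)
      have cr: "continuous_on {a..b} ?r" by (intro continuous_intros ballI ne)
      have cs: "continuous_on {a..b} ?s" by (intro continuous_intros)
      obtain R where R: "calculus T ?X (\<lambda>z. complex_of_real (?r (Re z))) R"
        using calculus_exists_real[OF T cr, of "\<lambda>z. complex_of_real (?r (Re z))"] by auto
      have Q: "calculus T ?X (\<lambda>w. complex_of_real (?s (Re w))) (op_diff G (op_scalar G z) P)"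
        using calculus_diff[OF T(1) calculus_const[OF T(1)] P, of z] by (simp add: m)
      have b: "bounded ((\<lambda>z. complex_of_real (?r (Re z))) ` ?X)" "bounded ((\<lambda>z. complex_of_real (?s (Re z))) ` ?X)"
        by (rule bounded_real_image[OF cr], simp, rule bounded_real_image[OF cs], simp)
      have one: "calculus T ?X (\<lambda>_. 1) B \<Longrightarrow> B = op_scalar G 1" for B
        using calculus_unique[OF T _ calculus_const[OF T(1)]] by blast
      have RQ: "op_mult R (op_diff G (op_scalar G z) P) = op_scalar G 1"
        by (rule one, rule calculus_cong[OF _ calculus_mult[OF T R Q b]])
          (elim imageE, simp only: Re_complex_of_real one_eq)
      have QR: "op_mult (op_diff G (op_scalar G z) P) R = op_scalar G 1"
        by (rule one, rule calculus_cong[OF _ calculus_mult[OF T Q R b(2,1)]])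
          (elim imageE, simp only: Re_complex_of_real one_eq)
      have "op_diff G (op_scalar G z) P (R x) = x \<and> R (op_diff G (op_scalar G z) P x) = x" if "x \<in> HG" for x
        using fun_cong[OF RQ, of x] fun_cong[OF QR, of x] that by simp
      then have "op_diff G (op_scalar G z) P \<in> Units (group_vN G)"
        unfolding NG_unit_iff using NG calculus_NG[OF R] NG_op_diff[OF NG_scalar NG] by blast
      then show False using z by (simp add: op_spectrum_def)
    qed
  qed
qed

text \<open>\<open>op_abs\<close> uses the calculus of A' A, and \<open>op_log\<close> that of the
  operator so obtained. A polynomial q close to ln on {sqrt a..sqrt b} gives q(|A|), which is q
  composed with sqrt applied to A' A; the limit is log sqrt. Positivity of a keeps ln
  continuous.\<close>

lemma log_abs_calculus:
  assumes T: "op_mult A' A \<in> NG" "self_adjoint (op_mult A' A)"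
      "op_spectrum G (op_mult A' A) \<subseteq> complex_of_real ` {a..b}"
    and a: "0 < a"
    and adj: "op_adjoint G A = A'"
  shows "calculus (op_mult A' A) (complex_of_real ` {a..b}) (\<lambda>z. complex_of_real (ln (sqrt (Re z))))
           (op_log G (op_abs G A))"
proof -
  let ?T = "op_mult A' A" and ?X = "complex_of_real ` {a..b}" and ?Y = "complex_of_real ` {sqrt a..sqrt b}"
  let ?sqrt = "\<lambda>z. complex_of_real (sqrt (Re z))" and ?ln = "\<lambda>z. complex_of_real (ln (Re z))"
  have cs: "continuous_on {a..b} sqrt" by (intro continuous_intros)
  obtain P where P: "calculus ?T ?X ?sqrt P"
    using calculus_exists_real[OF T cs, of ?sqrt] by auto
  have abs: "op_abs G A = P"
    unfolding op_abs_def adj group_vN_mult by (rule cont_fun_calc_eq[OF T P])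
  have NG: "P \<in> NG" by (rule calculus_NG[OF P])
  note PP = spectrum_sqrt[OF T a P]
  have cl: "continuous_on {sqrt a..sqrt b} ln"
    using a by (intro continuous_intros) (auto dest: less_le_trans[of 0 "sqrt a"])
  obtain C where C: "calculus P ?Y ?ln C"
    using calculus_exists_real[OF NG PP cl, of ?ln] by auto
  have log: "op_log G P = C"
    unfolding op_log_def by (rule cont_fun_calc_eq[OF NG PP C])
  have "calculus ?T ?X (\<lambda>z. complex_of_real (ln (sqrt (Re z)))) C"
  proof (rule calculus_limit[OF T(1) calculus_NG[OF C]])
    fix \<epsilon> :: real assume "\<epsilon> > 0"
    from calculusE[OF C this] obtain q where
      q: "\<And>t. t \<in> ?Y \<Longrightarrow> norm (poly q t - ?ln t) \<le> \<epsilon>" "op_bound (op_diff G (op_poly G q P) C) \<epsilon>" by metis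
    have "calculus ?T ?X (\<lambda>z. poly q (?sqrt z)) (op_poly G q P)"
      by (rule calculus_poly_comp[OF T P bounded_real_image[OF cs]]) simp
    moreover have "norm (poly q (?sqrt t) - complex_of_real (ln (sqrt (Re t)))) \<le> \<epsilon>" if "t \<in> ?X" for t
      using q(1)[of "?sqrt t"] that by auto
    ultimately show "\<exists>h' B'. calculus ?T ?X h' B' \<and>
        (\<forall>t\<in>?X. norm (h' t - complex_of_real (ln (sqrt (Re t)))) \<le> \<epsilon>) \<and> op_bound (op_diff G B' C) \<epsilon>"
      using q(2) by blast
  qed
  then show ?thesis by (simp add: abs log)
qed

text \<open>Replaces the logarithm by a polynomial in A' A, the form in which traces over different
  groups can be compared.\<close>

lemma vN_trace_log_abs_approx:
  assumes NG: "A \<in> NG" "A' \<in> NG" "D \<in> NG" "D' \<in> NG"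
    and adj: "\<And>x y. x \<in> HG \<Longrightarrow> y \<in> HG \<Longrightarrow> ip (A x) y = ip x (A' y)"
    and inv: "\<And>x. x \<in> HG \<Longrightarrow> A (D x) = x" "\<And>x. x \<in> HG \<Longrightarrow> D (A x) = x"
      "\<And>x. x \<in> HG \<Longrightarrow> A' (D' x) = x" "\<And>x. x \<in> HG \<Longrightarrow> D' (A' x) = x"
    and M: "0 < M" "op_bound A M" "op_bound A' M" "op_bound D M" "op_bound D' M"
    and p: "\<And>t. t \<in> {1 / M\<^sup>2..M\<^sup>2} \<Longrightarrow> norm (poly p (complex_of_real t) - complex_of_real (ln (sqrt t))) \<le> \<epsilon>"
  shows "norm (vN_trace G (op_log G (op_abs G A)) - vN_trace G (op_poly G p (op_mult A' A))) \<le> \<epsilon>"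
proof -
  let ?X = "complex_of_real ` {1 / M\<^sup>2..M\<^sup>2}"
  have T: "op_mult A' A \<in> NG" using NG by simp
  note sa = spectrum_of_positive_invertible[OF NG adj inv M]
  have C: "calculus (op_mult A' A) ?X (\<lambda>z. complex_of_real (ln (sqrt (Re z)))) (op_log G (op_abs G A))"
    using M(1) by (intro log_abs_calculus[OF T sa] op_adjoint_eq NG adj) auto
  have "op_bound (op_diff G (op_log G (op_abs G A)) (op_poly G p (op_mult A' A))) \<epsilon>"
    by (rule calculus_bound[OF T sa calculus_diff[OF T C calculus_poly[OF T]]])
      (use p in \<open>auto simp: norm_minus_commute\<close>)
  then show ?thesis
    using T calculus_NG[OF C] by (intro norm_vN_trace_diff_le) auto
qed

end


section \<open>The right regular representation of $L^1(\Gamma)$\<close>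

definition ell1_norm :: "('a, 'm) monoid_scheme \<Rightarrow> ('a \<Rightarrow> complex) \<Rightarrow> real" where
  "ell1_norm G f = (\<Sum>\<^sub>\<infinity>g\<in>carrier G. norm (f g))"

definition ell1_star :: "('a, 'm) monoid_scheme \<Rightarrow> ('a \<Rightarrow> complex) \<Rightarrow> 'a \<Rightarrow> complex" where
  "ell1_star G f = (\<lambda>g. if g \<in> carrier G then cnj (f (inv\<^bsub>G\<^esub> g)) else 0)"

definition conv_power :: "('a, 'm) monoid_scheme \<Rightarrow> ('a \<Rightarrow> complex) \<Rightarrow> nat \<Rightarrow> 'a \<Rightarrow> complex" where
  "conv_power G f k = (convolution G f ^^ k) (delta \<one>\<^bsub>G\<^esub>)"

lemma ell1_norm_nonneg [simp]: "0 \<le> ell1_norm G f"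
  by (simp add: ell1_norm_def infsum_nonneg)

lemma ell1_summable: "f \<in> ell1 G \<Longrightarrow> (\<lambda>g. norm (f g)) summable_on carrier G"
  by (simp add: ell1_def)

text \<open>Elements of \<open>ell1\<close> are handled through their pairing with bounded functions
  u. Translates of an \<open>ell2\<close> vector give the values of \<open>right_rep\<close>, and
  \<open>delta k\<close> gives a coefficient, so one convolution formula covers both.\<close>

lemma ell1_pairing_abs_summable:
  assumes f: "f \<in> ell1 G" and u: "\<And>g. g \<in> carrier G \<Longrightarrow> norm (u g) \<le> K"
  shows "(\<lambda>g. norm (f g * u g)) summable_on carrier G"
proof (rule Infinite_Sum.abs_summable_on_comparison_test')
  show "(\<lambda>g. norm (f g) * K) summable_on carrier G"
    by (intro summable_on_cmult_left ell1_summable f)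
  show "norm (f g * u g) \<le> norm (f g) * K" if "g \<in> carrier G" for g
    unfolding norm_mult by (intro mult_left_mono u that) simp
qed

lemma ell1_pairing_summable:
  assumes "f \<in> ell1 G" "\<And>g. g \<in> carrier G \<Longrightarrow> norm (u g) \<le> K"
  shows "(\<lambda>g. f g * u g) summable_on carrier G"
  by (rule Infinite_Sum.abs_summable_summable[OF ell1_pairing_abs_summable[OF assms]])

lemma norm_ell1_pairing_le:
  assumes f: "f \<in> ell1 G" and u: "\<And>g. g \<in> carrier G \<Longrightarrow> norm (u g) \<le> K"
  shows "norm (\<Sum>\<^sub>\<infinity>g\<in>carrier G. f g * u g) \<le> ell1_norm G f * K"
proof -
  have "norm (\<Sum>\<^sub>\<infinity>g\<in>carrier G. f g * u g) \<le> (\<Sum>\<^sub>\<infinity>g\<in>carrier G. norm (f g * u g))"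
    by (rule norm_infsum_bound[OF ell1_pairing_abs_summable[OF assms]])
  also have "\<dots> \<le> (\<Sum>\<^sub>\<infinity>g\<in>carrier G. norm (f g) * K)"
  proof (rule infsum_mono)
    show "(\<lambda>g. norm (f g) * K) summable_on carrier G"
      by (intro summable_on_cmult_left ell1_summable f)
    show "norm (f g * u g) \<le> norm (f g) * K" if "g \<in> carrier G" for g
      unfolding norm_mult by (intro mult_left_mono u that) simp
  qed (rule ell1_pairing_abs_summable[OF assms])
  also have "\<dots> = ell1_norm G f * K"
    unfolding ell1_norm_def by (rule infsum_cmult_left')
  finally show ?thesis .
qed

lemma norm_delta_le: "norm (delta h g) \<le> 1"
  by (simp add: delta_def)

lemma infsum_mult_delta:
  assumes "k \<in> A"
  shows "(\<Sum>\<^sub>\<infinity>g\<in>A. f g * delta k g) = f k"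
proof -
  have "(\<Sum>\<^sub>\<infinity>g\<in>A. f g * delta k g) = (\<Sum>\<^sub>\<infinity>g\<in>{k}. f g * delta k g)"
    by (rule infsum_cong_neutral) (use assms in \<open>auto simp: delta_def\<close>)
  then show ?thesis by (simp add: delta_def)
qed

lemma delta_ell1:
  assumes "h \<in> carrier G" shows "delta h \<in> ell1 G"
proof -
  have "(\<lambda>g. norm (delta h g)) summable_on carrier G"
    by (rule finite_nonzero_values_imp_summable_on, rule finite_subset[of _ "{h}"])
      (auto simp: delta_def split: if_splits)
  then show ?thesis using assms by (auto simp: ell1_def delta_def)
qed

context group
begin

section \<open>Translation invariance, convolution and involution\<close>

lemma infsum_left_translate: "\<gamma> \<in> carrier G \<Longrightarrow> (\<Sum>\<^sub>\<infinity>g\<in>carrier G. u (\<gamma> \<otimes> g)) = (\<Sum>\<^sub>\<infinity>g\<in>carrier G. u g)"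
  by (rule infsum_reindex_bij_betw[OF left_translation_bij])

lemma infsum_right_translate: "\<gamma> \<in> carrier G \<Longrightarrow> (\<Sum>\<^sub>\<infinity>g\<in>carrier G. u (g \<otimes> \<gamma>)) = (\<Sum>\<^sub>\<infinity>g\<in>carrier G. u g)"
  by (rule infsum_reindex_bij_betw[OF right_translation_bij])

lemma inv_bij: "bij_betw (\<lambda>g. inv g) (carrier G) (carrier G)"
  by (rule bij_betwI[where g = "\<lambda>g. inv g"]) auto

text \<open>The hypothesis of Fubini for convolutions: by translation invariance the inner sum over
  g is |f \<gamma>| times the norm of h.\<close>

lemma convolution_pairs_summable:
  assumes f: "f \<in> ell1 G" and h: "h \<in> ell1 G"
  shows "(\<lambda>(\<gamma>, g). norm (f \<gamma> * h (inv \<gamma> \<otimes> g))) summable_on carrier G \<times> carrier G"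
proof (rule summable_on_SigmaI)
  show "((\<lambda>g. (\<lambda>(\<gamma>, g). norm (f \<gamma> * h (inv \<gamma> \<otimes> g))) (\<gamma>, g)) has_sum norm (f \<gamma>) * ell1_norm G h) (carrier G)"
    if "\<gamma> \<in> carrier G" for \<gamma>
    unfolding prod.case norm_mult ell1_norm_def
    by (rule has_sum_cmult_right)
      (use has_sum_reindex_bij_betw[OF left_translation_bij[of "inv \<gamma>"], of "\<lambda>g. norm (h g)"]
        ell1_summable[OF h] that in auto)
  show "(\<lambda>\<gamma>. norm (f \<gamma>) * ell1_norm G h) summable_on carrier G"
    by (intro summable_on_cmult_left ell1_summable f)
qed auto

lemma convolution_ell1:
  assumes f: "f \<in> ell1 G" and h: "h \<in> ell1 G"
  shows "convolution G f h \<in> ell1 G"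
proof -
  have *: "(\<lambda>(g, \<gamma>). norm (f \<gamma> * h (inv \<gamma> \<otimes> g))) summable_on carrier G \<times> carrier G"
    using convolution_pairs_summable[OF assms] by (subst summable_on_swap) simp
  have sum: "(\<lambda>g. \<Sum>\<^sub>\<infinity>\<gamma>\<in>carrier G. norm (f \<gamma> * h (inv \<gamma> \<otimes> g))) summable_on carrier G"
    by (rule summable_on_Sigma_banach[OF *])
  have "(\<lambda>g. norm (convolution G f h g)) summable_on carrier G"
  proof (rule Infinite_Sum.abs_summable_on_comparison_test'[OF sum])
    fix g assume g: "g \<in> carrier G"
    have "(\<lambda>\<gamma>. norm (f \<gamma> * h (inv \<gamma> \<otimes> g))) summable_on carrier G"
      using summable_on_SigmaD1[OF * g] .
    then show "norm (convolution G f h g) \<le> (\<Sum>\<^sub>\<infinity>\<gamma>\<in>carrier G. norm (f \<gamma> * h (inv \<gamma> \<otimes> g)))"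
      using g by (simp add: convolution_def norm_infsum_bound)
  qed
  then show ?thesis by (simp add: ell1_def convolution_def)
qed

text \<open>Interchange the sums and substitute g = \<gamma> \<otimes> \<eta>. With u a translate of
  a vector this yields multiplicativity of \<open>right_rep\<close>; with u obtained from
  \<open>delta k\<close>, multiplicativity of \<open>L1_map\<close>.\<close>

lemma convolution_pairing:
  assumes f: "f \<in> ell1 G" and h: "h \<in> ell1 G" and u: "\<And>g. g \<in> carrier G \<Longrightarrow> norm (u g) \<le> K"
  shows "(\<Sum>\<^sub>\<infinity>g\<in>carrier G. convolution G f h g * u g) =
    (\<Sum>\<^sub>\<infinity>\<gamma>\<in>carrier G. f \<gamma> * (\<Sum>\<^sub>\<infinity>\<eta>\<in>carrier G. h \<eta> * u (\<gamma> \<otimes> \<eta>)))"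
proof -
  have "(\<lambda>p. norm ((\<lambda>(\<gamma>, g). f \<gamma> * h (inv \<gamma> \<otimes> g) * u g) p)) summable_on carrier G \<times> carrier G"
  proof (rule Infinite_Sum.abs_summable_on_comparison_test')
    show "(\<lambda>p. (case p of (\<gamma>, g) \<Rightarrow> norm (f \<gamma> * h (inv \<gamma> \<otimes> g))) * K) summable_on carrier G \<times> carrier G"
      by (intro summable_on_cmult_left convolution_pairs_summable f h)
    show "norm ((\<lambda>(\<gamma>, g). f \<gamma> * h (inv \<gamma> \<otimes> g) * u g) p) \<le> (case p of (\<gamma>, g) \<Rightarrow> norm (f \<gamma> * h (inv \<gamma> \<otimes> g))) * K"
      if "p \<in> carrier G \<times> carrier G" for p
      using that by (auto simp: norm_mult intro!: mult_left_mono u)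
  qed
  then have sum: "(\<lambda>(\<gamma>, g). f \<gamma> * h (inv \<gamma> \<otimes> g) * u g) summable_on carrier G \<times> carrier G"
    by (rule Infinite_Sum.abs_summable_summable)
  have "(\<Sum>\<^sub>\<infinity>g\<in>carrier G. convolution G f h g * u g) =
      (\<Sum>\<^sub>\<infinity>g\<in>carrier G. \<Sum>\<^sub>\<infinity>\<gamma>\<in>carrier G. f \<gamma> * h (inv \<gamma> \<otimes> g) * u g)"
    by (rule infsum_cong) (simp add: convolution_def infsum_cmult_left')
  also have "\<dots> = (\<Sum>\<^sub>\<infinity>\<gamma>\<in>carrier G. \<Sum>\<^sub>\<infinity>g\<in>carrier G. f \<gamma> * h (inv \<gamma> \<otimes> g) * u g)"
    by (rule infsum_swap_banach[symmetric, OF sum])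
  also have "\<dots> = (\<Sum>\<^sub>\<infinity>\<gamma>\<in>carrier G. f \<gamma> * (\<Sum>\<^sub>\<infinity>\<eta>\<in>carrier G. h \<eta> * u (\<gamma> \<otimes> \<eta>)))"
  proof (rule infsum_cong)
    fix \<gamma> assume g: "\<gamma> \<in> carrier G"
    have "(\<Sum>\<^sub>\<infinity>g\<in>carrier G. f \<gamma> * h (inv \<gamma> \<otimes> g) * u g) =
        (\<Sum>\<^sub>\<infinity>g\<in>carrier G. f \<gamma> * h (inv \<gamma> \<otimes> (\<gamma> \<otimes> g)) * u (\<gamma> \<otimes> g))"
      using infsum_left_translate[OF g, of "\<lambda>g. f \<gamma> * h (inv \<gamma> \<otimes> g) * u g"] by simp
    also have "\<dots> = (\<Sum>\<^sub>\<infinity>g\<in>carrier G. f \<gamma> * (h g * u (\<gamma> \<otimes> g)))"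
      by (rule infsum_cong) (use g in \<open>simp add: m_assoc[symmetric] mult.assoc\<close>)
    finally show "(\<Sum>\<^sub>\<infinity>g\<in>carrier G. f \<gamma> * h (inv \<gamma> \<otimes> g) * u g) =
        f \<gamma> * (\<Sum>\<^sub>\<infinity>\<eta>\<in>carrier G. h \<eta> * u (\<gamma> \<otimes> \<eta>))"
      by (simp add: infsum_cmult_right')
  qed
  finally show ?thesis .
qed

lemma ell1_star_ell1:
  assumes f: "f \<in> ell1 G"
  shows "ell1_star G f \<in> ell1 G" "ell1_norm G (ell1_star G f) = ell1_norm G f"
proof -
  have "(\<lambda>g. norm (f (inv g))) summable_on carrier G"
    using summable_on_reindex_bij_betw[OF inv_bij, of "\<lambda>g. norm (f g)"] ell1_summable[OF f] by simp
  then have "(\<lambda>g. norm (ell1_star G f g)) summable_on carrier G"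
    by (rule summable_on_cong[THEN iffD1, rotated]) (simp add: ell1_star_def)
  then show "ell1_star G f \<in> ell1 G" by (simp add: ell1_def ell1_star_def)
  have "ell1_norm G (ell1_star G f) = (\<Sum>\<^sub>\<infinity>g\<in>carrier G. norm (f (inv g)))"
    unfolding ell1_norm_def by (rule infsum_cong) (simp add: ell1_star_def)
  then show "ell1_norm G (ell1_star G f) = ell1_norm G f"
    unfolding ell1_norm_def using infsum_reindex_bij_betw[OF inv_bij, of "\<lambda>g. norm (f g)"] by simp
qed

text \<open>The inverse in \<open>right_rep\<close> cancels the one in \<open>right_mult\<close>, so
  f acts by right translations of the argument, and these commute with left multiplication.\<close>

lemma right_rep_apply:
  assumes "x \<in> HG"
  shows "right_rep G f x g = (if g \<in> carrier G then \<Sum>\<^sub>\<infinity>\<gamma>\<in>carrier G. f \<gamma> * x (g \<otimes> \<gamma>) else 0)"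
  using assms by (auto simp: right_rep_def right_mult_def intro!: infsum_cong infsum_0)

lemma translates_pairs_summable:
  assumes f: "f \<in> ell1 G" and x: "x \<in> HG"
    and s: "\<And>\<gamma>. \<gamma> \<in> carrier G \<Longrightarrow> bij_betw (s \<gamma>) (carrier G) (carrier G)"
  shows "(\<lambda>(\<gamma>, g). norm (f \<gamma>) * (norm (x (s \<gamma> g)))\<^sup>2) summable_on carrier G \<times> carrier G"
proof (rule summable_on_SigmaI)
  show "((\<lambda>g. (\<lambda>(\<gamma>, g). norm (f \<gamma>) * (norm (x (s \<gamma> g)))\<^sup>2) (\<gamma>, g)) has_sum norm (f \<gamma>) * (nrm x)\<^sup>2) (carrier G)"
    if "\<gamma> \<in> carrier G" for \<gamma>
    unfolding prod.case nrm_square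
    by (rule has_sum_cmult_right)
      (use has_sum_reindex_bij_betw[OF s[OF that], of "\<lambda>g. (norm (x g))\<^sup>2"] ell2_summable[OF x] in auto)
  show "(\<lambda>\<gamma>. norm (f \<gamma>) * (nrm x)\<^sup>2) summable_on carrier G"
    by (intro summable_on_cmult_left ell1_summable f)
qed auto

text \<open>Fubini for the adjoint: there the translation sits on x before the substitution and on y
  after it, hence two families s and t. The product is dominated by means of |a b| \<le> |a|^2 +
  |b|^2.\<close>

lemma inner_pairs_summable:
  assumes f: "f \<in> ell1 G" and x: "x \<in> HG" and y: "y \<in> HG"
    and s: "\<And>\<gamma>. \<gamma> \<in> carrier G \<Longrightarrow> bij_betw (s \<gamma>) (carrier G) (carrier G)"
    and t: "\<And>\<gamma>. \<gamma> \<in> carrier G \<Longrightarrow> bij_betw (t \<gamma>) (carrier G) (carrier G)"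
  shows "(\<lambda>(\<gamma>, g). f \<gamma> * (x (s \<gamma> g) * cnj (y (t \<gamma> g)))) summable_on carrier G \<times> carrier G"
proof -
  have "(\<lambda>p. norm ((\<lambda>(\<gamma>, g). f \<gamma> * (x (s \<gamma> g) * cnj (y (t \<gamma> g)))) p)) summable_on carrier G \<times> carrier G"
  proof (rule Infinite_Sum.abs_summable_on_comparison_test')
    show "(\<lambda>p. (case p of (\<gamma>, g) \<Rightarrow> norm (f \<gamma>) * (norm (x (s \<gamma> g)))\<^sup>2) +
        (case p of (\<gamma>, g) \<Rightarrow> norm (f \<gamma>) * (norm (y (t \<gamma> g)))\<^sup>2)) summable_on carrier G \<times> carrier G"
      by (intro summable_on_add translates_pairs_summable f x y s t)
    have "norm a * norm b \<le> (norm a)\<^sup>2 + (norm b)\<^sup>2" for a b :: complex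
      using sum_squares_bound[of "norm a" "norm b"] mult_nonneg_nonneg[OF norm_ge_zero norm_ge_zero, of a b] by linarith
    then show "norm ((\<lambda>(\<gamma>, g). f \<gamma> * (x (s \<gamma> g) * cnj (y (t \<gamma> g)))) p) \<le>
        (case p of (\<gamma>, g) \<Rightarrow> norm (f \<gamma>) * (norm (x (s \<gamma> g)))\<^sup>2) +
        (case p of (\<gamma>, g) \<Rightarrow> norm (f \<gamma>) * (norm (y (t \<gamma> g)))\<^sup>2)" for p
      by (auto simp: norm_mult mult_left_mono simp flip: distrib_left split: prod.split)
  qed
  then show ?thesis by (rule Infinite_Sum.abs_summable_summable)
qed

text \<open>Young's inequality. Cauchy-Schwarz is applied to |f| |x| written as sqrt |f| times sqrt
  |f| |x|; what remains is |f| |x|^2, whose sum over pairs is computed by translation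
  invariance.\<close>

lemma right_rep_bounded:
  assumes f: "f \<in> ell1 G" and x: "x \<in> HG"
  shows "right_rep G f x \<in> HG" "nrm (right_rep G f x) \<le> ell1_norm G f * nrm x"
proof -
  let ?F = "\<lambda>\<gamma> g. norm (f \<gamma>) * (norm (x (g \<otimes> \<gamma>)))\<^sup>2"
  have F: "(\<lambda>(\<gamma>, g). ?F \<gamma> g) summable_on carrier G \<times> carrier G"
    by (rule translates_pairs_summable[OF f x right_translation_bij])
  then have F': "(\<lambda>(g, \<gamma>). ?F \<gamma> g) summable_on carrier G \<times> carrier G"
    by (subst summable_on_swap) simp
  have pt: "(norm (right_rep G f x g))\<^sup>2 \<le> ell1_norm G f * (\<Sum>\<^sub>\<infinity>\<gamma>\<in>carrier G. ?F \<gamma> g)"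
    if g: "g \<in> carrier G" for g
  proof -
    let ?u = "\<lambda>\<gamma>. sqrt (norm (f \<gamma>))" and ?v = "\<lambda>\<gamma>. sqrt (norm (f \<gamma>)) * norm (x (g \<otimes> \<gamma>))"
    have uv: "?u \<gamma> * ?v \<gamma> = norm (f \<gamma> * x (g \<otimes> \<gamma>))" for \<gamma>
      by (simp add: norm_mult mult.assoc[symmetric])
    have u2: "(\<lambda>\<gamma>. (?u \<gamma>)\<^sup>2) = (\<lambda>\<gamma>. norm (f \<gamma>))" by simp
    have v2: "(\<lambda>\<gamma>. (?v \<gamma>)\<^sup>2) = (\<lambda>\<gamma>. ?F \<gamma> g)" by (simp add: power_mult_distrib)
    have sv: "(\<lambda>\<gamma>. ?F \<gamma> g) summable_on carrier G"
      using summable_on_SigmaD1[OF F' g] .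
    have "norm (right_rep G f x g) \<le> (\<Sum>\<^sub>\<infinity>\<gamma>\<in>carrier G. norm (f \<gamma> * x (g \<otimes> \<gamma>)))"
      using g x norm_infsum_bound[OF ell1_pairing_abs_summable[OF f norm_coord_le_nrm[OF x]]]
      by (simp add: right_rep_apply)
    also have "\<dots> \<le> sqrt (ell1_norm G f) * sqrt (\<Sum>\<^sub>\<infinity>\<gamma>\<in>carrier G. ?F \<gamma> g)"
      using infsum_Cauchy_Schwarz[of ?u "carrier G" ?v] ell1_summable[OF f] sv
      unfolding uv u2 v2 ell1_norm_def by simp
    finally have "(norm (right_rep G f x g))\<^sup>2 \<le> (sqrt (ell1_norm G f) * sqrt (\<Sum>\<^sub>\<infinity>\<gamma>\<in>carrier G. ?F \<gamma> g))\<^sup>2"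
      by (rule power_mono) simp
    then show ?thesis by (simp add: power_mult_distrib infsum_nonneg)
  qed
  have S: "(\<lambda>g. ell1_norm G f * (\<Sum>\<^sub>\<infinity>\<gamma>\<in>carrier G. ?F \<gamma> g)) summable_on carrier G"
    by (intro summable_on_cmult_right summable_on_Sigma_banach F')
  have "(\<lambda>g. norm ((norm (right_rep G f x g))\<^sup>2)) summable_on carrier G"
    by (rule Infinite_Sum.abs_summable_on_comparison_test'[OF S]) (use pt in simp)
  then have sum: "(\<lambda>g. (norm (right_rep G f x g))\<^sup>2) summable_on carrier G" by simp
  then show "right_rep G f x \<in> HG"
    by (simp add: ell2_def right_rep_apply[OF x])
  have "(nrm (right_rep G f x))\<^sup>2 \<le> (\<Sum>\<^sub>\<infinity>g\<in>carrier G. ell1_norm G f * (\<Sum>\<^sub>\<infinity>\<gamma>\<in>carrier G. ?F \<gamma> g))"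
    unfolding nrm_square by (rule infsum_mono[OF sum S pt])
  also have "\<dots> = ell1_norm G f * (\<Sum>\<^sub>\<infinity>g\<in>carrier G. \<Sum>\<^sub>\<infinity>\<gamma>\<in>carrier G. ?F \<gamma> g)"
    by (rule infsum_cmult_right')
  also have "(\<Sum>\<^sub>\<infinity>g\<in>carrier G. \<Sum>\<^sub>\<infinity>\<gamma>\<in>carrier G. ?F \<gamma> g) = (\<Sum>\<^sub>\<infinity>\<gamma>\<in>carrier G. \<Sum>\<^sub>\<infinity>g\<in>carrier G. ?F \<gamma> g)"
    by (rule infsum_swap_banach[OF F'])
  also have "\<dots> = (\<Sum>\<^sub>\<infinity>\<gamma>\<in>carrier G. norm (f \<gamma>) * (nrm x)\<^sup>2)"
    by (rule infsum_cong)
      (simp add: infsum_cmult_right' nrm_square infsum_right_translate[of _ "\<lambda>g. (norm (x g))\<^sup>2"])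
  also have "\<dots> = ell1_norm G f * (nrm x)\<^sup>2"
    unfolding ell1_norm_def by (rule infsum_cmult_left')
  finally have "(nrm (right_rep G f x))\<^sup>2 \<le> (ell1_norm G f * nrm x)\<^sup>2"
    by (simp add: power2_eq_square mult_ac)
  then show "nrm (right_rep G f x) \<le> ell1_norm G f * nrm x"
    by (rule power2_le_imp_le) simp
qed

lemma op_bound_right_rep: "f \<in> ell1 G \<Longrightarrow> op_bound (right_rep G f) (ell1_norm G f)"
  by (simp add: op_bound_def right_rep_bounded)

lemma right_rep_summable:
  assumes f: "f \<in> ell1 G" and x: "x \<in> HG"
  shows "(\<lambda>\<gamma>. f \<gamma> * x (g \<otimes> \<gamma>)) summable_on carrier G"
  by (rule ell1_pairing_summable[OF f norm_coord_le_nrm[OF x]])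

lemma right_rep_NG:
  assumes f: "f \<in> ell1 G"
  shows "right_rep G f \<in> NG"
proof (rule NG_I)
  show "right_rep G f \<in> extensional HG" by (simp add: right_rep_def)
  show "right_rep G f x \<in> HG" if "x \<in> HG" for x by (rule right_rep_bounded[OF f that])
  show "op_bound (right_rep G f) (ell1_norm G f)" by (rule op_bound_right_rep[OF f])
  fix x assume x: "x \<in> HG"
  show "right_rep G f (c *\<^sub>c x) = c *\<^sub>c right_rep G f x" for c
    using x by (simp add: fun_eq_iff right_rep_apply cscale_apply mult.left_commute infsum_cmult_right')
  show "right_rep G f (x + y) = right_rep G f x + right_rep G f y" if y: "y \<in> HG" for y
    using x y by (simp add: fun_eq_iff right_rep_apply plus_fun_apply distrib_left infsum_add right_rep_summable f)
  show "right_rep G f (left_mult G \<gamma> x) = left_mult G \<gamma> (right_rep G f x)" if g: "\<gamma> \<in> carrier G" for \<gamma>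
  proof
    fix g
    show "right_rep G f (left_mult G \<gamma> x) g = left_mult G \<gamma> (right_rep G f x) g"
      using g
      unfolding right_rep_apply[OF left_mult_ell2[OF g x]]
      by (auto simp: right_rep_apply[OF x] left_mult_apply[OF x]
          left_mult_apply[OF right_rep_bounded(1)[OF f x]] m_assoc intro!: infsum_cong)
  qed
qed

lemma right_rep_convolution:
  assumes f: "f \<in> ell1 G" and h: "h \<in> ell1 G" and x: "x \<in> HG"
  shows "right_rep G (convolution G f h) x = right_rep G f (right_rep G h x)"
proof
  fix g
  show "right_rep G (convolution G f h) x g = right_rep G f (right_rep G h x) g"
  proof (cases "g \<in> carrier G")
    case True
    have "right_rep G (convolution G f h) x g =
        (\<Sum>\<^sub>\<infinity>\<gamma>\<in>carrier G. f \<gamma> * (\<Sum>\<^sub>\<infinity>\<eta>\<in>carrier G. h \<eta> * x (g \<otimes> (\<gamma> \<otimes> \<eta>))))"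
      using x True by (simp add: right_rep_apply convolution_pairing[OF f h norm_coord_le_nrm[OF x]])
    also have "\<dots> = right_rep G f (right_rep G h x) g"
      using x True right_rep_bounded[OF h x]
      by (auto simp: right_rep_apply m_assoc intro!: infsum_cong)
    finally show ?thesis .
  qed (use x right_rep_bounded[OF h x] in \<open>simp add: right_rep_apply\<close>)
qed

lemma right_rep_delta_one:
  assumes "x \<in> HG" shows "right_rep G (delta \<one>) x = x"
proof
  fix g
  show "right_rep G (delta \<one>) x g = x g"
    using assms ell2_outside[OF assms, of g] infsum_mult_delta[of \<one> "carrier G" "\<lambda>\<gamma>. x (g \<otimes> \<gamma>)"]
    by (simp add: right_rep_apply mult.commute)
qed

text \<open>Translating g moves the right translation by \<gamma> from x to y, where it becomes the
  one by the inverse; inverting the summation variable then turns f into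
  \<open>ell1_star G f\<close>.\<close>

lemma right_rep_adjoint:
  assumes f: "f \<in> ell1 G" and x: "x \<in> HG" and y: "y \<in> HG"
  shows "ip (right_rep G f x) y = ip x (right_rep G (ell1_star G f) y)"
proof -
  let ?C = "carrier G"
  have s1: "(\<lambda>(\<gamma>, g). f \<gamma> * (x (g \<otimes> \<gamma>) * cnj (y g))) summable_on ?C \<times> ?C"
    by (rule inner_pairs_summable[OF f x y right_translation_bij bij_betw_id[unfolded id_def]])
  have s2: "(\<lambda>(\<gamma>, g). f \<gamma> * (x g * cnj (y (g \<otimes> inv \<gamma>)))) summable_on ?C \<times> ?C"
    by (rule inner_pairs_summable[OF f x y bij_betw_id[unfolded id_def] right_translation_bij]) simp
  have "ip (right_rep G f x) y = (\<Sum>\<^sub>\<infinity>g\<in>?C. \<Sum>\<^sub>\<infinity>\<gamma>\<in>?C. f \<gamma> * (x (g \<otimes> \<gamma>) * cnj (y g)))"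
    unfolding ell2_inner_def
    by (rule infsum_cong) (simp add: right_rep_apply x mult.assoc flip: infsum_cmult_left')
  also have "\<dots> = (\<Sum>\<^sub>\<infinity>\<gamma>\<in>?C. \<Sum>\<^sub>\<infinity>g\<in>?C. f \<gamma> * (x (g \<otimes> \<gamma>) * cnj (y g)))"
    by (rule infsum_swap_banach[symmetric, OF s1])
  also have "\<dots> = (\<Sum>\<^sub>\<infinity>\<gamma>\<in>?C. \<Sum>\<^sub>\<infinity>g\<in>?C. f \<gamma> * (x g * cnj (y (g \<otimes> inv \<gamma>))))"
  proof (rule infsum_cong)
    fix \<gamma> assume g: "\<gamma> \<in> ?C"
    show "(\<Sum>\<^sub>\<infinity>g\<in>?C. f \<gamma> * (x (g \<otimes> \<gamma>) * cnj (y g))) = (\<Sum>\<^sub>\<infinity>g\<in>?C. f \<gamma> * (x g * cnj (y (g \<otimes> inv \<gamma>))))"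
      using infsum_right_translate[OF g, of "\<lambda>g. f \<gamma> * (x g * cnj (y (g \<otimes> inv \<gamma>)))"] g
      by (auto simp: m_assoc intro!: infsum_cong elim!: trans[rotated])
  qed
  also have "\<dots> = (\<Sum>\<^sub>\<infinity>g\<in>?C. \<Sum>\<^sub>\<infinity>\<gamma>\<in>?C. f \<gamma> * (x g * cnj (y (g \<otimes> inv \<gamma>))))"
    by (rule infsum_swap_banach[OF s2])
  also have "\<dots> = ip x (right_rep G (ell1_star G f) y)"
    unfolding ell2_inner_def
  proof (rule infsum_cong)
    fix g assume g: "g \<in> ?C"
    have "(\<Sum>\<^sub>\<infinity>\<gamma>\<in>?C. f \<gamma> * (x g * cnj (y (g \<otimes> inv \<gamma>)))) = x g * (\<Sum>\<^sub>\<infinity>\<gamma>\<in>?C. f \<gamma> * cnj (y (g \<otimes> inv \<gamma>)))"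
      by (subst infsum_cmult_right'[symmetric]) (simp add: mult.left_commute)
    also have "(\<Sum>\<^sub>\<infinity>\<gamma>\<in>?C. f \<gamma> * cnj (y (g \<otimes> inv \<gamma>))) = (\<Sum>\<^sub>\<infinity>\<gamma>\<in>?C. f (inv \<gamma>) * cnj (y (g \<otimes> inv (inv \<gamma>))))"
      by (rule infsum_reindex_bij_betw[OF inv_bij, symmetric])
    also have "\<dots> = (\<Sum>\<^sub>\<infinity>\<gamma>\<in>?C. cnj (ell1_star G f \<gamma> * y (g \<otimes> \<gamma>)))"
      by (rule infsum_cong) (simp add: ell1_star_def)
    also have "\<dots> = cnj (right_rep G (ell1_star G f) y g)"
      using g y by (simp only: infsum_cnj right_rep_apply if_True)
    finally show "(\<Sum>\<^sub>\<infinity>\<gamma>\<in>?C. f \<gamma> * (x g * cnj (y (g \<otimes> inv \<gamma>)))) = x g * cnj (right_rep G (ell1_star G f) y g)" .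
  qed
  finally show ?thesis .
qed

section \<open>Powers, coefficients at the unit element and inverses\<close>

lemma conv_power_ell1: "f \<in> ell1 G \<Longrightarrow> conv_power G f k \<in> ell1 G"
  by (induction k) (simp_all add: conv_power_def delta_ell1 convolution_ell1)

lemma right_rep_funpow:
  assumes f: "f \<in> ell1 G" and x: "x \<in> HG"
  shows "(right_rep G f ^^ k) x = right_rep G (conv_power G f k) x"
proof (induction k)
  case (Suc k)
  then show ?case
    using right_rep_convolution[OF f conv_power_ell1[OF f] x, of k] by (simp add: conv_power_def)
qed (simp add: conv_power_def right_rep_delta_one x)

lemma inner_delta_one: "ip x (delta \<one>) = x \<one>"
proof -
  have "ip x (delta \<one>) = (\<Sum>\<^sub>\<infinity>g\<in>carrier G. x g * delta \<one> g)"
    unfolding ell2_inner_def by (rule infsum_cong) (simp add: delta_def)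
  then show ?thesis by (simp add: infsum_mult_delta)
qed

lemma right_rep_delta_at_one:
  "right_rep G f (delta \<one>) \<one> = f \<one>"
proof -
  have "right_rep G f (delta \<one>) \<one> = (\<Sum>\<^sub>\<infinity>g\<in>carrier G. f g * delta \<one> g)"
    by (simp add: right_rep_apply) (rule infsum_cong, simp)
  then show ?thesis by (simp add: infsum_mult_delta)
qed

lemma vN_trace_op_poly_right_rep:
  assumes f: "f \<in> ell1 G"
  shows "vN_trace G (op_poly G p (right_rep G f)) = (\<Sum>k\<le>degree p. coeff p k * conv_power G f k \<one>)"
  by (simp add: vN_trace_def inner_delta_one op_poly_apply sum_fun_apply cscale_apply
      right_rep_funpow f right_rep_delta_at_one)

lemma right_rep_inverse:
  assumes "f \<in> ell1 G" "h \<in> ell1 G" "convolution G f h = delta \<one>" "x \<in> HG"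
  shows "right_rep G f (right_rep G h x) = x"
  using right_rep_convolution[of f h x] right_rep_delta_one[of x] assms by simp

lemma right_rep_unit:
  assumes f: "f \<in> ell1 G" and h: "h \<in> ell1 G"
    and inv: "convolution G f h = delta \<one>" "convolution G h f = delta \<one>"
  shows "right_rep G f \<in> Units (group_vN G)"
  unfolding NG_unit_iff
  using right_rep_NG[OF f] right_rep_NG[OF h] right_rep_inverse[OF f h inv(1)] right_rep_inverse[OF h f inv(2)]
  by blast

text \<open>Take adjoints in r(h) r(f) = 1, by testing against an arbitrary vector z; both
  involutions are moved to the other side of the inner product.\<close>

lemma right_rep_star_inverse:
  assumes f: "f \<in> ell1 G" and h: "h \<in> ell1 G" and fh: "convolution G h f = delta \<one>" and x: "x \<in> HG"
  shows "right_rep G (ell1_star G f) (right_rep G (ell1_star G h) x) = x"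
proof -
  let ?y = "right_rep G (ell1_star G f) (right_rep G (ell1_star G h) x)"
  have hx: "right_rep G (ell1_star G h) x \<in> HG"
    by (rule right_rep_bounded[OF ell1_star_ell1(1)[OF h] x])
  have y: "?y \<in> HG"
    by (rule right_rep_bounded[OF ell1_star_ell1(1)[OF f] hx])
  have eq: "ip z ?y = ip z x" if z: "z \<in> HG" for z
    using right_rep_adjoint[OF f z hx] right_rep_adjoint[OF h right_rep_bounded(1)[OF f z] x]
      right_rep_inverse[OF h f fh z] by simp
  have "ip (?y - x) (?y - x) = 0"
    using eq[of "?y - x"] x y by (simp add: inner_diff_right[of ?y x "?y - x"])
  then have "nrm (?y - x) = 0" using inner_self[of "?y - x"] x y by simp
  then show ?thesis using x y by simp
qed

text \<open>The interval depends only on M, so p and \<epsilon> can be fixed before the group is.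
  The same estimate then applies to \<Gamma> and to all its quotients.\<close>

lemma L1_det_approx:
  assumes f: "f \<in> ell1 G" and h: "h \<in> ell1 G"
    and inv: "convolution G f h = delta \<one>" "convolution G h f = delta \<one>"
    and M: "0 < M" "ell1_norm G f \<le> M" "ell1_norm G h \<le> M"
    and p: "\<And>t. t \<in> {1 / M\<^sup>2..M\<^sup>2} \<Longrightarrow> norm (poly p (complex_of_real t) - complex_of_real (ln (sqrt t))) \<le> \<epsilon>"
  shows "\<bar>ln (L1_det G f) -
    Re (\<Sum>k\<le>degree p. coeff p k * conv_power G (convolution G (ell1_star G f) f) k \<one>)\<bar> \<le> \<epsilon>"
proof -
  note sf = ell1_star_ell1[OF f] and sh = ell1_star_ell1[OF h]
  note bd = op_bound_right_rep[OF f] op_bound_right_rep[OF h] op_bound_right_rep[OF sf(1)] op_bound_right_rep[OF sh(1)]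
  have T: "op_mult (right_rep G (ell1_star G f)) (right_rep G f) = right_rep G (convolution G (ell1_star G f) f)"
    by (rule NG_eqI) (auto simp: right_rep_NG f sf convolution_ell1 right_rep_convolution)
  have unit: "right_rep G f \<in> Units (group_vN G)" by (rule right_rep_unit[OF f h inv])
  have "norm (vN_trace G (op_log G (op_abs G (right_rep G f))) -
      vN_trace G (op_poly G p (op_mult (right_rep G (ell1_star G f)) (right_rep G f)))) \<le> \<epsilon>"
  proof (rule vN_trace_log_abs_approx)
    show "op_bound (right_rep G f) M" "op_bound (right_rep G (ell1_star G f)) M"
      "op_bound (right_rep G h) M" "op_bound (right_rep G (ell1_star G h)) M"
      using bd sf(2) sh(2) M by (auto elim: op_bound_mono)
  qed (use right_rep_NG f h sf sh right_rep_adjoint right_rep_inverse right_rep_star_inverse inv M(1) p in auto)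
  then have "norm (vN_trace G (op_log G (op_abs G (right_rep G f))) -
      (\<Sum>k\<le>degree p. coeff p k * conv_power G (convolution G (ell1_star G f) f) k \<one>)) \<le> \<epsilon>"
    unfolding T by (simp add: vN_trace_op_poly_right_rep convolution_ell1 f sf)
  then have "\<bar>Re (vN_trace G (op_log G (op_abs G (right_rep G f))) -
      (\<Sum>k\<le>degree p. coeff p k * conv_power G (convolution G (ell1_star G f) f) k \<one>))\<bar> \<le> \<epsilon>"
    using abs_Re_le_cmod order_trans by blast
  \<comment> \<open>As \<open>right_rep G f\<close> is a unit, \<open>FK_det\<close> takes its first
    branch and no limit in \<epsilon> appears.\<close>
  then show ?thesis
    using unit by (simp add: L1_det_def FK_det_def FK_det_invertible_def)
qed

end


section \<open>Homomorphisms and balls in Cayley graphs\<close>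

text \<open>The disjoint union of the fibres is identified with A by \<open>snd\<close>, after which
  both claims are instances of Fubini.\<close>

lemma infsum_fibres:
  fixes F :: "'a \<Rightarrow> 'c::banach"
  assumes F: "F summable_on A" and im: "\<phi> ` A \<subseteq> B"
  shows "(\<lambda>b. \<Sum>\<^sub>\<infinity>a\<in>{a \<in> A. \<phi> a = b}. F a) summable_on B"
    and "(\<Sum>\<^sub>\<infinity>b\<in>B. \<Sum>\<^sub>\<infinity>a\<in>{a \<in> A. \<phi> a = b}. F a) = (\<Sum>\<^sub>\<infinity>a\<in>A. F a)"
proof -
  let ?P = "SIGMA b:B. {a \<in> A. \<phi> a = b}"
  have bij: "bij_betw snd ?P A"
    by (rule bij_betwI[where g = "\<lambda>a. (\<phi> a, a)"]) (use im in auto)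
  have sum: "(\<lambda>(b, a). F a) summable_on ?P"
    using summable_on_reindex_bij_betw[OF bij, of F] F by (simp add: case_prod_unfold)
  show "(\<lambda>b. \<Sum>\<^sub>\<infinity>a\<in>{a \<in> A. \<phi> a = b}. F a) summable_on B"
    by (rule summable_on_Sigma_banach[OF sum])
  show "(\<Sum>\<^sub>\<infinity>b\<in>B. \<Sum>\<^sub>\<infinity>a\<in>{a \<in> A. \<phi> a = b}. F a) = (\<Sum>\<^sub>\<infinity>a\<in>A. F a)"
    unfolding infsum_Sigma'_banach[OF sum]
    using infsum_reindex_bij_betw[OF bij, of F] by (simp add: case_prod_unfold)
qed

context group_hom
begin

section \<open>Push-forward along a homomorphism\<close>

lemma hom_image_subset: "h ` carrier G \<subseteq> carrier H"
  by auto

lemma L1_map_outside: "k \<notin> carrier H \<Longrightarrow> L1_map G h f k = 0"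
  unfolding L1_map_def by (rule infsum_0) auto

lemma fibre_summable: "f \<in> ell1 G \<Longrightarrow> (\<lambda>g. norm (f g)) summable_on {g \<in> carrier G. h g = k}"
  by (rule summable_on_subset_banach[OF ell1_summable]) auto

lemma L1_map_ell1:
  assumes f: "f \<in> ell1 G"
  shows "L1_map G h f \<in> ell1 H" "ell1_norm H (L1_map G h f) \<le> ell1_norm G f"
proof -
  let ?N = "\<lambda>k. \<Sum>\<^sub>\<infinity>g\<in>{g \<in> carrier G. h g = k}. norm (f g)"
  note N = infsum_fibres[OF ell1_summable[OF f] hom_image_subset]
  have le: "norm (L1_map G h f k) \<le> ?N k" for k
    unfolding L1_map_def by (rule norm_infsum_bound[OF fibre_summable[OF f]])
  have sum: "(\<lambda>k. norm (L1_map G h f k)) summable_on carrier H"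
    by (rule Infinite_Sum.abs_summable_on_comparison_test'[OF N(1) le])
  then show "L1_map G h f \<in> ell1 H" by (simp add: ell1_def L1_map_outside)
  show "ell1_norm H (L1_map G h f) \<le> ell1_norm G f"
    unfolding ell1_norm_def N(2)[symmetric] by (rule infsum_mono[OF sum N(1) le])
qed

text \<open>Change of variables: \<open>L1_map\<close> is the push-forward of f regarded as a
  complex measure.\<close>

lemma L1_map_pairing:
  assumes f: "f \<in> ell1 G" and u: "\<And>k. k \<in> carrier H \<Longrightarrow> norm (u k) \<le> K"
  shows "(\<Sum>\<^sub>\<infinity>k\<in>carrier H. L1_map G h f k * u k) = (\<Sum>\<^sub>\<infinity>g\<in>carrier G. f g * u (h g))"
proof -
  have "(\<lambda>g. f g * u (h g)) summable_on carrier G"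
    by (rule ell1_pairing_summable[OF f, where K = K]) (use u in simp)
  note infsum_fibres(2)[OF this hom_image_subset]
  moreover have "L1_map G h f k * u k = (\<Sum>\<^sub>\<infinity>g\<in>{g \<in> carrier G. h g = k}. f g * u (h g))" for k
    unfolding L1_map_def
    by (subst infsum_cmult_left'[symmetric]) (rule infsum_cong, simp)
  ultimately show ?thesis by simp
qed

lemma L1_map_eq_pairing:
  assumes "f \<in> ell1 G" "k \<in> carrier H"
  shows "L1_map G h f k = (\<Sum>\<^sub>\<infinity>g\<in>carrier G. f g * delta k (h g))"
  using L1_map_pairing[OF assms(1) norm_delta_le[of k]] infsum_mult_delta[OF assms(2), of "L1_map G h f"] by simp

text \<open>The coefficient at k is the pairing with \<open>delta k\<close>. In this form the change
  of variables can be applied to each of the two factors in turn.\<close>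

lemma L1_map_convolution:
  assumes f: "f \<in> ell1 G" and f': "f' \<in> ell1 G"
  shows "L1_map G h (convolution G f f') = convolution H (L1_map G h f) (L1_map G h f')"
proof
  fix k
  show "L1_map G h (convolution G f f') k = convolution H (L1_map G h f) (L1_map G h f') k"
  proof (cases "k \<in> carrier H")
    case k: True
    note mf = L1_map_ell1[OF f] and mf' = L1_map_ell1[OF f']
    let ?v = "\<lambda>\<gamma>. \<Sum>\<^sub>\<infinity>\<eta>\<in>carrier H. L1_map G h f' \<eta> * delta k (\<gamma> \<otimes>\<^bsub>H\<^esub> \<eta>)"
    have "convolution H (L1_map G h f) (L1_map G h f') k =
        (\<Sum>\<^sub>\<infinity>g\<in>carrier H. convolution H (L1_map G h f) (L1_map G h f') g * delta k g)"
      by (rule infsum_mult_delta[OF k, symmetric])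
    also have "\<dots> = (\<Sum>\<^sub>\<infinity>\<gamma>\<in>carrier H. L1_map G h f \<gamma> * ?v \<gamma>)"
      by (rule H.convolution_pairing[OF mf(1) mf'(1) norm_delta_le])
    also have "\<dots> = (\<Sum>\<^sub>\<infinity>\<gamma>\<in>carrier G. f \<gamma> * ?v (h \<gamma>))"
      by (rule L1_map_pairing[OF f norm_ell1_pairing_le[OF mf'(1) norm_delta_le]])
    also have "\<dots> = (\<Sum>\<^sub>\<infinity>\<gamma>\<in>carrier G. f \<gamma> * (\<Sum>\<^sub>\<infinity>\<eta>\<in>carrier G. f' \<eta> * delta k (h (\<gamma> \<otimes> \<eta>))))"
    proof (rule infsum_cong)
      fix \<gamma> assume g: "\<gamma> \<in> carrier G"
      have "?v (h \<gamma>) = (\<Sum>\<^sub>\<infinity>\<eta>\<in>carrier G. f' \<eta> * delta k (h \<gamma> \<otimes>\<^bsub>H\<^esub> h \<eta>))"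
        by (rule L1_map_pairing[OF f' norm_delta_le])
      also have "\<dots> = (\<Sum>\<^sub>\<infinity>\<eta>\<in>carrier G. f' \<eta> * delta k (h (\<gamma> \<otimes> \<eta>)))"
        by (rule infsum_cong) (use g in simp)
      finally show "f \<gamma> * ?v (h \<gamma>) = f \<gamma> * (\<Sum>\<^sub>\<infinity>\<eta>\<in>carrier G. f' \<eta> * delta k (h (\<gamma> \<otimes> \<eta>)))" by simp
    qed
    also have "\<dots> = (\<Sum>\<^sub>\<infinity>g\<in>carrier G. convolution G f f' g * delta k (h g))"
      by (rule G.convolution_pairing[OF f f' norm_delta_le, symmetric])
    also have "\<dots> = L1_map G h (convolution G f f') k"
      by (rule L1_map_eq_pairing[OF G.convolution_ell1[OF f f'] k, symmetric])
    finally show ?thesis ..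
  qed (simp add: L1_map_outside convolution_def)
qed

lemma L1_map_delta_one: "L1_map G h (delta \<one>) = delta \<one>\<^bsub>H\<^esub>"
proof
  fix k
  show "L1_map G h (delta \<one>) k = delta \<one>\<^bsub>H\<^esub> k"
  proof (cases "k \<in> carrier H")
    case True
    then have "L1_map G h (delta \<one>) k = (\<Sum>\<^sub>\<infinity>g\<in>carrier G. delta k (h g) * delta \<one> g)"
      by (subst L1_map_eq_pairing) (auto simp: delta_ell1 mult.commute)
    then show ?thesis by (simp add: infsum_mult_delta) (simp add: delta_def)
  qed (auto simp: L1_map_outside delta_def)
qed

lemma L1_map_star: "L1_map G h (ell1_star G f) = ell1_star H (L1_map G h f)"
proof
  fix k
  show "L1_map G h (ell1_star G f) k = ell1_star H (L1_map G h f) k"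
  proof (cases "k \<in> carrier H")
    case k: True
    have bij: "bij_betw (\<lambda>g. inv g) {g \<in> carrier G. h g = k} {g \<in> carrier G. h g = inv\<^bsub>H\<^esub> k}"
      by (rule bij_betwI[where g = "\<lambda>g. inv g"]) (use k in auto)
    have "L1_map G h (ell1_star G f) k = (\<Sum>\<^sub>\<infinity>g\<in>{g \<in> carrier G. h g = k}. cnj (f (inv g)))"
      unfolding L1_map_def by (rule infsum_cong) (simp add: ell1_star_def)
    also have "\<dots> = (\<Sum>\<^sub>\<infinity>g\<in>{g \<in> carrier G. h g = inv\<^bsub>H\<^esub> k}. cnj (f g))"
      by (rule infsum_reindex_bij_betw[OF bij])
    also have "\<dots> = ell1_star H (L1_map G h f) k"
      using k by (simp add: ell1_star_def L1_map_def)
    finally show ?thesis .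
  qed (simp add: L1_map_outside ell1_star_def)
qed

lemma L1_map_conv_power:
  "f \<in> ell1 G \<Longrightarrow> L1_map G h (conv_power G f k) = conv_power H (L1_map G h f) k"
proof (induction k)
  case (Suc k)
  then show ?case
    using L1_map_convolution[OF Suc.prems G.conv_power_ell1[OF Suc.prems, of k]] by (simp add: conv_power_def)
qed (simp add: conv_power_def L1_map_delta_one)

text \<open>The coefficient of the push-forward at the unit is the sum of f over the kernel. Apart
  from the unit, the kernel lies outside F, so the error is at most the mass of f there.\<close>

lemma L1_map_at_one:
  assumes f: "f \<in> ell1 G" and F: "finite F" "F \<subseteq> carrier G"
    and ker: "\<And>g. g \<in> F \<Longrightarrow> h g = \<one>\<^bsub>H\<^esub> \<Longrightarrow> g = \<one>"
  shows "norm (L1_map G h f \<one>\<^bsub>H\<^esub> - f \<one>) \<le> ell1_norm G f - (\<Sum>g\<in>F. norm (f g))"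
proof -
  let ?K = "{g \<in> carrier G. h g = \<one>\<^bsub>H\<^esub>}"
  have K: "insert \<one> (?K - {\<one>}) = ?K" by auto
  have abs: "(\<lambda>g. norm (f g)) summable_on A" if "A \<subseteq> carrier G" for A
    by (rule summable_on_subset_banach[OF ell1_summable[OF f] that])
  have sum: "f summable_on ?K - {\<one>}"
    by (rule Infinite_Sum.abs_summable_summable[OF abs]) auto
  have "L1_map G h f \<one>\<^bsub>H\<^esub> = f \<one> + infsum f (?K - {\<one>})"
    using infsum_insert[OF sum, of \<one>] unfolding L1_map_def K by simp
  then have "norm (L1_map G h f \<one>\<^bsub>H\<^esub> - f \<one>) = norm (infsum f (?K - {\<one>}))" by simp
  also have "\<dots> \<le> (\<Sum>\<^sub>\<infinity>g\<in>?K - {\<one>}. norm (f g))"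
    by (rule norm_infsum_bound[OF abs]) auto
  also have "\<dots> \<le> (\<Sum>\<^sub>\<infinity>g\<in>carrier G - F. norm (f g))"
    by (rule infsum_mono_neutral) (use ker in \<open>auto intro!: abs\<close>)
  also have "\<dots> = ell1_norm G f - (\<Sum>g\<in>F. norm (f g))"
  proof -
    have "ell1_norm G f = (\<Sum>\<^sub>\<infinity>g\<in>F \<union> (carrier G - F). norm (f g))"
      unfolding ell1_norm_def using F by (simp add: Un_absorb1)
    also have "\<dots> = (\<Sum>g\<in>F. norm (f g)) + (\<Sum>\<^sub>\<infinity>g\<in>carrier G - F. norm (f g))"
      using F by (subst infsum_Un_disjoint) (auto intro!: abs)
    finally show ?thesis by simp
  qed
  finally show ?thesis .
qed

lemma foldr_hom:
  "set w \<subseteq> carrier G \<Longrightarrow> h (foldr (\<otimes>) w \<one>) = foldr (\<otimes>\<^bsub>H\<^esub>) (map h w) \<one>\<^bsub>H\<^esub>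
     \<and> foldr (\<otimes>) w \<one> \<in> carrier G"
  by (induction w) auto

end

context group
begin

section \<open>Words and balls\<close>

lemma foldr_closed: "set w \<subseteq> carrier G \<Longrightarrow> foldr (\<otimes>) w \<one> \<in> carrier G"
  by (induction w) auto

lemma foldr_mult_append:
  assumes "set v \<subseteq> carrier G" "set w \<subseteq> carrier G"
  shows "foldr (\<otimes>) (v @ w) \<one> = foldr (\<otimes>) v \<one> \<otimes> foldr (\<otimes>) w \<one>"
  using assms(1)
proof (induction v)
  case (Cons a v)
  then show ?case using foldr_closed[OF assms(2)] foldr_closed[of v] by (simp add: m_assoc)
qed (use foldr_closed[OF assms(2)] in simp)

lemma cayley_ball_mono: "M \<le> N \<Longrightarrow> cayley_ball G S M \<subseteq> cayley_ball G S N"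
  unfolding cayley_ball_def using order_trans by blast

lemma cayley_ball_carrier: "set S \<subseteq> carrier G \<Longrightarrow> cayley_ball G S N \<subseteq> carrier G"
  unfolding cayley_ball_def by (auto intro!: foldr_closed)

lemma generate_in_cayley_ball:
  assumes S: "set S \<subseteq> carrier G" and g: "g \<in> generate G (set S)"
  shows "\<exists>N. g \<in> cayley_ball G S N"
proof -
  let ?A = "set S \<union> m_inv G ` set S"
  have A: "?A \<subseteq> carrier G" using S by auto
  have "\<exists>w. set w \<subseteq> ?A \<and> g = foldr (\<otimes>) w \<one>"
    using g
  proof induction
    case one
    then show ?case by (intro exI[of _ "[]"]) simp
  next
    case (incl h)
    then show ?case using A by (intro exI[of _ "[h]"]) auto
  next
    case (inv h)
    then show ?case using A by (intro exI[of _ "[inv h]"]) auto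
  next
    case (eng h1 h2)
    then obtain v w where vw: "set v \<subseteq> ?A" "h1 = foldr (\<otimes>) v \<one>" "set w \<subseteq> ?A" "h2 = foldr (\<otimes>) w \<one>"
      by blast
    then have "h1 \<otimes> h2 = foldr (\<otimes>) (v @ w) \<one>"
      using foldr_mult_append[OF order_trans[OF vw(1) A] order_trans[OF vw(3) A]] by (simp only:)
    then show ?case using vw(1,3) by (intro exI[of _ "v @ w"] conjI) auto
  qed
  then show ?thesis unfolding cayley_ball_def by blast
qed

lemma finite_subset_cayley_ball:
  assumes S: "set S \<subseteq> carrier G" "generate G (set S) = carrier G"
  shows "finite F \<Longrightarrow> F \<subseteq> carrier G \<Longrightarrow> \<exists>N. F \<subseteq> cayley_ball G S N"
proof (induction F rule: finite_induct)
  case (insert g F)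
  then obtain N where N: "F \<subseteq> cayley_ball G S N" by auto
  obtain M where M: "g \<in> cayley_ball G S M"
    using generate_in_cayley_ball[OF S(1), of g] insert S(2) by auto
  have "insert g F \<subseteq> cayley_ball G S (max M N)"
    using M N cayley_ball_mono[of M "max M N" S] cayley_ball_mono[of N "max M N" S] by auto
  then show ?case by blast
qed simp

end

text \<open>
  Reading a word letter by letter shows that an isomorphism of balls inverts \<open>h\<close> on the ball of \<open>G\<close>.
\<close>
lemma (in group_hom) cayley_ball_iso_kernel:
  assumes S: "set S \<subseteq> carrier G" "length S = d"
    and iso: "cayley_ball_iso d N H (map h S) G S"
    and g: "g \<in> cayley_ball G S N" "h g = \<one>\<^bsub>H\<^esub>"
  shows "g = \<one>"
proof -
  let ?A = "set S \<union> m_inv G ` set S"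
  let ?ev = "\<lambda>w. foldr (\<otimes>) w \<one>"
  have A: "?A \<subseteq> carrier G" using S by auto
  obtain \<alpha> where bij: "bij_betw \<alpha> (cayley_ball H (map h S) N) (cayley_ball G S N)"
    and one: "\<alpha> \<one>\<^bsub>H\<^esub> = \<one>"
    and edge: "\<And>x y i. x \<in> cayley_ball H (map h S) N \<Longrightarrow> y \<in> cayley_ball H (map h S) N \<Longrightarrow> i < d \<Longrightarrow>
        y = x \<otimes>\<^bsub>H\<^esub> map h S ! i \<Longrightarrow> \<alpha> y = \<alpha> x \<otimes> S ! i"
    using iso unfolding cayley_ball_iso_def by blast
  have ball: "h (?ev w) \<in> cayley_ball H (map h S) N" if "set w \<subseteq> ?A" "length w \<le> N" for w
  proof -
    have "set (map h w) \<subseteq> set (map h S) \<union> m_inv H ` set (map h S)"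
      using that S(1) by (force simp: image_iff)
    moreover have "h (?ev w) = foldr (\<otimes>\<^bsub>H\<^esub>) (map h w) \<one>\<^bsub>H\<^esub>"
      using foldr_hom that A by blast
    ultimately show ?thesis
      unfolding cayley_ball_def by (intro CollectI exI[of _ "map h w"]) (use that in simp)
  qed
  \<comment> \<open>The word grows at its end, because edges of the Cayley graph multiply on the
    right. Every prefix stays in the ball, so the edges may be followed by \<alpha>.\<close>
  have lift: "set w \<subseteq> ?A \<Longrightarrow> length w \<le> N \<Longrightarrow> \<alpha> (h (?ev w)) = ?ev w" for w
  proof (induction w rule: rev_induct)
    case (snoc s u)
    have u: "set u \<subseteq> ?A" "length u \<le> N" "s \<in> ?A" using snoc.prems by auto
    have uc: "?ev u \<in> carrier G" and sc: "s \<in> carrier G"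
      using G.foldr_closed u A by blast+
    have IH: "\<alpha> (h (?ev u)) = ?ev u" using snoc.IH u by blast
    have ev: "?ev (u @ [s]) = ?ev u \<otimes> s"
      using G.foldr_mult_append[of u "[s]"] u A sc by auto
    note b1 = ball[OF u(1,2)] and b2 = ball[OF snoc.prems]
    from u(3) consider i where "i < d" "s = S ! i" | i where "i < d" "s = inv (S ! i)"
      using S(2) by (auto simp: in_set_conv_nth)
    then show ?case
    proof cases
      case 1
      then have "h (?ev (u @ [s])) = h (?ev u) \<otimes>\<^bsub>H\<^esub> map h S ! i"
        using ev uc sc S(2) by simp
      from edge[OF b1 b2 1(1) this] show ?thesis using IH ev 1 by simp
    next
      \<comment> \<open>An inverse letter is an edge traversed backwards, from the longer word to
        the shorter one.\<close>
      case 2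
      have t: "S ! i \<in> carrier G" using 2 S by auto
      have "?ev u = ?ev (u @ [s]) \<otimes> S ! i"
        unfolding ev unfolding 2(2) using uc t by (simp add: G.m_assoc)
      moreover have "?ev (u @ [s]) \<in> carrier G" using ev uc sc by simp
      ultimately have "h (?ev u) = h (?ev (u @ [s])) \<otimes>\<^bsub>H\<^esub> map h S ! i"
        using hom_mult[of "?ev (u @ [s])" "S ! i"] t 2(1) S(2) by simp
      from edge[OF b2 b1 2(1) this] have *: "?ev u = \<alpha> (h (?ev (u @ [s]))) \<otimes> S ! i" using IH by simp
      have "\<alpha> (h (?ev (u @ [s]))) \<in> carrier G"
        using bij b2 G.cayley_ball_carrier[OF S(1)] by (auto simp: bij_betw_def)
      then have "\<alpha> (h (?ev (u @ [s]))) = \<alpha> (h (?ev (u @ [s]))) \<otimes> S ! i \<otimes> inv (S ! i)"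
        using t by (simp add: G.m_assoc del: List.foldr_append)
      also have "\<dots> = ?ev u \<otimes> s" unfolding *[symmetric] by (simp only: 2(2))
      also have "\<dots> = ?ev (u @ [s])" by (simp only: ev)
      finally show ?thesis .
    qed
  qed (simp add: one)
  obtain w where "set w \<subseteq> ?A" "length w \<le> N" "g = ?ev w"
    using g(1) unfolding cayley_ball_def by auto
  then show ?thesis using lift[of w] g(2) one by simp
qed

text \<open>The supremum of the admissible radii exceeds N, so some admissible radius does. A larger
  ball serves as well, since it contains the one of radius N.\<close>

lemma marked_dist_less:
  assumes "marked_dist d G S H T < (1 / 2) ^ N"
  shows "\<exists>N'\<ge>N. cayley_ball_iso d N' G S H T"
proof -
  have "enat N < Sup (enat ` {N. cayley_ball_iso d N G S H T})"
  proof (cases "Sup (enat ` {N. cayley_ball_iso d N G S H T})")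
    case (enat M)
    then have "(1 / 2 :: real) ^ M < (1 / 2) ^ N" using assms by (simp add: marked_dist_def)
    then have "N < M" by (simp add: power_strict_decreasing_iff)
    then show ?thesis using enat by simp
  qed simp
  then obtain N' where "cayley_ball_iso d N' G S H T" "enat N < enat N'"
    unfolding less_Sup_iff by auto
  then show ?thesis using less_imp_le by auto
qed

section \<open>Convergence of determinants\<close>

lemma L1_Units:
  assumes "f \<in> Units (L1_alg G)"
  obtains f' where "f \<in> ell1 G" "f' \<in> ell1 G"
    "convolution G f f' = delta \<one>\<^bsub>G\<^esub>" "convolution G f' f = delta \<one>\<^bsub>G\<^esub>"
  using assms by (auto simp: Units_def L1_alg_def)

lemma (in group) L1_det_pos:
  assumes f: "f \<in> ell1 G" and h: "h \<in> ell1 G"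
    and inv: "convolution G f h = delta \<one>" "convolution G h f = delta \<one>"
  shows "0 < L1_det G f"
proof -
  have "right_rep G f \<in> Units (group_vN G)" by (rule right_rep_unit[OF assms])
  then show ?thesis by (simp add: L1_det_def FK_det_def FK_det_invertible_def)
qed

text \<open>The assumption \<open>ker\<close> is the form in which convergence of marked groups
  enters. The set F is chosen to carry all but e / 2 of the norm of f.\<close>

lemma L1_map_at_one_tendsto:
  fixes \<Gamma> :: "('a, 'm) monoid_scheme" and \<Gamma>n :: "nat \<Rightarrow> ('b, 'k) monoid_scheme"
  assumes hom: "\<And>n. n \<ge> 1 \<Longrightarrow> group_hom \<Gamma> (\<Gamma>n n) (\<phi> n)"
    and ker: "\<And>F. finite F \<Longrightarrow> F \<subseteq> carrier \<Gamma> \<Longrightarrow>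
      \<forall>\<^sub>F n in sequentially. \<forall>g\<in>F. \<phi> n g = \<one>\<^bsub>\<Gamma>n n\<^esub> \<longrightarrow> g = \<one>\<^bsub>\<Gamma>\<^esub>"
    and f: "f \<in> ell1 \<Gamma>"
  shows "(\<lambda>n. L1_map \<Gamma> (\<phi> n) f \<one>\<^bsub>\<Gamma>n n\<^esub>) \<longlonglongrightarrow> f \<one>\<^bsub>\<Gamma>\<^esub>"
proof (rule tendstoI)
  fix e :: real assume e: "0 < e"
  then obtain F where F: "finite F" "F \<subseteq> carrier \<Gamma>"
      "dist (\<Sum>g\<in>F. norm (f g)) (\<Sum>\<^sub>\<infinity>g\<in>carrier \<Gamma>. norm (f g)) \<le> e / 2"
    using infsum_finite_approximation[OF ell1_summable[OF f], of "e / 2"] by auto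
  show "\<forall>\<^sub>F n in sequentially. dist (L1_map \<Gamma> (\<phi> n) f \<one>\<^bsub>\<Gamma>n n\<^esub>) (f \<one>\<^bsub>\<Gamma>\<^esub>) < e"
    using ker[OF F(1,2)] eventually_ge_at_top[of 1]
  proof eventually_elim
    case (elim n)
    interpret group_hom \<Gamma> "\<Gamma>n n" "\<phi> n" by (rule hom[OF elim(2)])
    have "norm (L1_map \<Gamma> (\<phi> n) f \<one>\<^bsub>\<Gamma>n n\<^esub> - f \<one>\<^bsub>\<Gamma>\<^esub>) \<le> ell1_norm \<Gamma> f - (\<Sum>g\<in>F. norm (f g))"
      by (rule L1_map_at_one[OF f F(1,2)]) (use elim(1) in blast)
    then show ?case
      using F(3) e unfolding dist_norm ell1_norm_def real_norm_def by linarith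
  qed
qed

lemma L1_det_tendsto:
  fixes \<Gamma> :: "('a, 'm) monoid_scheme" and \<Gamma>n :: "nat \<Rightarrow> ('b, 'k) monoid_scheme"
  assumes "group \<Gamma>"
    and hom: "\<And>n. n \<ge> 1 \<Longrightarrow> group_hom \<Gamma> (\<Gamma>n n) (\<phi> n)"
    and ker: "\<And>F. finite F \<Longrightarrow> F \<subseteq> carrier \<Gamma> \<Longrightarrow>
      \<forall>\<^sub>F n in sequentially. \<forall>g\<in>F. \<phi> n g = \<one>\<^bsub>\<Gamma>n n\<^esub> \<longrightarrow> g = \<one>\<^bsub>\<Gamma>\<^esub>"
    and "f \<in> Units (L1_alg \<Gamma>)"
  shows "(\<lambda>n. L1_det (\<Gamma>n n) (L1_map \<Gamma> (\<phi> n) f)) \<longlonglongrightarrow> L1_det \<Gamma> f"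
proof -
  interpret \<Gamma>: group \<Gamma> by fact
  obtain f' where f: "f \<in> ell1 \<Gamma>" and f': "f' \<in> ell1 \<Gamma>"
    and inv: "convolution \<Gamma> f f' = delta \<one>\<^bsub>\<Gamma>\<^esub>" "convolution \<Gamma> f' f = delta \<one>\<^bsub>\<Gamma>\<^esub>"
    using L1_Units[OF assms(4)] .
  \<comment> \<open>The summand 1 makes M positive, as the interval with endpoint 1 / M^2
    requires.\<close>
  define M where "M = 1 + ell1_norm \<Gamma> f + ell1_norm \<Gamma> f'"
  have M: "0 < M" "ell1_norm \<Gamma> f \<le> M" "ell1_norm \<Gamma> f' \<le> M"
    using ell1_norm_nonneg[of \<Gamma> f] ell1_norm_nonneg[of \<Gamma> f'] unfolding M_def by linarith+
  let ?b = "convolution \<Gamma> (ell1_star \<Gamma> f) f"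
  have b: "?b \<in> ell1 \<Gamma>"
    by (intro \<Gamma>.convolution_ell1 \<Gamma>.ell1_star_ell1 f)
  let ?det = "\<lambda>n. L1_det (\<Gamma>n n) (L1_map \<Gamma> (\<phi> n) f)"
  have pos: "0 < L1_det \<Gamma> f" by (rule \<Gamma>.L1_det_pos[OF f f' inv])
  have mapped: "L1_map \<Gamma> (\<phi> n) f \<in> ell1 (\<Gamma>n n)" "L1_map \<Gamma> (\<phi> n) f' \<in> ell1 (\<Gamma>n n)"
      "convolution (\<Gamma>n n) (L1_map \<Gamma> (\<phi> n) f) (L1_map \<Gamma> (\<phi> n) f') = delta \<one>\<^bsub>\<Gamma>n n\<^esub>"
      "convolution (\<Gamma>n n) (L1_map \<Gamma> (\<phi> n) f') (L1_map \<Gamma> (\<phi> n) f) = delta \<one>\<^bsub>\<Gamma>n n\<^esub>"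
      "ell1_norm (\<Gamma>n n) (L1_map \<Gamma> (\<phi> n) f) \<le> M" "ell1_norm (\<Gamma>n n) (L1_map \<Gamma> (\<phi> n) f') \<le> M"
      "conv_power (\<Gamma>n n) (convolution (\<Gamma>n n) (ell1_star (\<Gamma>n n) (L1_map \<Gamma> (\<phi> n) f)) (L1_map \<Gamma> (\<phi> n) f)) k =
        L1_map \<Gamma> (\<phi> n) (conv_power \<Gamma> ?b k)"
    if n: "n \<ge> 1" for n k
  proof -
    interpret group_hom \<Gamma> "\<Gamma>n n" "\<phi> n" by (rule hom[OF n])
    note L1_map_ell1[OF f] L1_map_ell1[OF f']
    then show "L1_map \<Gamma> (\<phi> n) f \<in> ell1 (\<Gamma>n n)" "L1_map \<Gamma> (\<phi> n) f' \<in> ell1 (\<Gamma>n n)"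
      "ell1_norm (\<Gamma>n n) (L1_map \<Gamma> (\<phi> n) f) \<le> M" "ell1_norm (\<Gamma>n n) (L1_map \<Gamma> (\<phi> n) f') \<le> M"
      using M by auto
    show "convolution (\<Gamma>n n) (L1_map \<Gamma> (\<phi> n) f) (L1_map \<Gamma> (\<phi> n) f') = delta \<one>\<^bsub>\<Gamma>n n\<^esub>"
      "convolution (\<Gamma>n n) (L1_map \<Gamma> (\<phi> n) f') (L1_map \<Gamma> (\<phi> n) f) = delta \<one>\<^bsub>\<Gamma>n n\<^esub>"
      using L1_map_convolution[OF f f'] L1_map_convolution[OF f' f] inv L1_map_delta_one by simp_all
    show "conv_power (\<Gamma>n n) (convolution (\<Gamma>n n) (ell1_star (\<Gamma>n n) (L1_map \<Gamma> (\<phi> n) f)) (L1_map \<Gamma> (\<phi> n) f)) k =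
        L1_map \<Gamma> (\<phi> n) (conv_power \<Gamma> ?b k)"
      using L1_map_convolution[OF \<Gamma>.ell1_star_ell1(1)[OF f] f] L1_map_star[of f] L1_map_conv_power[OF b, of k]
      by simp
  qed
  \<comment> \<open>\<open>L1_det_approx\<close> is an additive estimate for logarithms;
    exponentiation and positivity of the determinants return to the claim.\<close>
  have "(\<lambda>n. ln (?det n)) \<longlonglongrightarrow> ln (L1_det \<Gamma> f)"
  proof (rule tendstoI)
    fix e :: real assume "0 < e"
    \<comment> \<open>Three errors are added: the approximation over the quotient, the convergence
      of the coefficients and the approximation over \<Gamma>. Quarters keep their sum strictly
      below e.\<close>
    then have e: "0 < e / 4" by simp
    have "continuous_on {1 / M\<^sup>2..M\<^sup>2} (\<lambda>t. ln (sqrt t))"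
    proof (intro continuous_intros ballI)
      fix t assume "t \<in> {1 / M\<^sup>2..M\<^sup>2}"
      moreover have "0 < 1 / M\<^sup>2" using M(1) by simp
      ultimately have "0 < t" by (meson atLeastAtMost_iff less_le_trans)
      then show "sqrt t \<noteq> 0" by simp
    qed
    from complex_poly_approximation[OF this e] obtain p where
      p: "\<And>t. t \<in> {1 / M\<^sup>2..M\<^sup>2} \<Longrightarrow> norm (poly p (complex_of_real t) - complex_of_real (ln (sqrt t))) \<le> e / 4"
      by blast
    define a where "a n = Re (\<Sum>k\<le>degree p. coeff p k * L1_map \<Gamma> (\<phi> n) (conv_power \<Gamma> ?b k) \<one>\<^bsub>\<Gamma>n n\<^esub>)" for n
    define a0 where "a0 = Re (\<Sum>k\<le>degree p. coeff p k * conv_power \<Gamma> ?b k \<one>\<^bsub>\<Gamma>\<^esub>)"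
    have "a \<longlonglongrightarrow> a0"
      unfolding a_def a0_def
      by (intro tendsto_intros L1_map_at_one_tendsto[OF hom ker] \<Gamma>.conv_power_ell1[OF b])
    from tendstoD[OF this e] have "\<forall>\<^sub>F n in sequentially. dist (a n) a0 < e / 4" .
    then show "\<forall>\<^sub>F n in sequentially. dist (ln (?det n)) (ln (L1_det \<Gamma> f)) < e"
      using eventually_ge_at_top[of 1]
    proof eventually_elim
      case (elim n)
      interpret group_hom \<Gamma> "\<Gamma>n n" "\<phi> n" by (rule hom[OF elim(2)])
      have "\<bar>ln (?det n) - a n\<bar> \<le> e / 4"
        using H.L1_det_approx[OF mapped(1-4)[OF elim(2)] M(1) mapped(5,6)[OF elim(2)] p]
        unfolding mapped(7)[OF elim(2)] a_def .
      moreover have "\<bar>ln (L1_det \<Gamma> f) - a0\<bar> \<le> e / 4"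
        unfolding a0_def by (rule \<Gamma>.L1_det_approx[OF f f' inv M p])
      ultimately show ?case
        using elim(1) \<open>0 < e\<close> unfolding dist_real_def by linarith
    qed
  qed
  then have "(\<lambda>n. exp (ln (?det n))) \<longlonglongrightarrow> exp (ln (L1_det \<Gamma> f))"
    by (rule tendsto_exp)
  then have "(\<lambda>n. exp (ln (?det n))) \<longlonglongrightarrow> L1_det \<Gamma> f"
    using pos by simp
  moreover have "\<forall>\<^sub>F n in sequentially. exp (ln (?det n)) = ?det n"
    using eventually_ge_at_top[of 1]
  proof eventually_elim
    case (elim n)
    interpret group_hom \<Gamma> "\<Gamma>n n" "\<phi> n" by (rule hom[OF elim])
    show ?case using H.L1_det_pos[OF mapped(1-4)[OF elim]] by simp
  qed
  ultimately show ?thesis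
    by (rule Lim_transform_eventually)
qed

theorem corollary18:
  fixes d :: nat
    and \<Gamma> :: "'a monoid" and S :: "'a list"
    and \<Gamma>n :: "nat \<Rightarrow> 'b monoid"
    and \<phi> :: "nat \<Rightarrow> 'a \<Rightarrow> 'b"
    and f :: "'a \<Rightarrow> complex"
  assumes "d \<ge> 1"
    and "marked_group d \<Gamma> S"
    and "\<And>n. n \<ge> 1 \<Longrightarrow> group (\<Gamma>n n)"
    and "\<And>n. n \<ge> 1 \<Longrightarrow> \<phi> n \<in> epi \<Gamma> (\<Gamma>n n)"
    and "f \<in> Units (L1_alg \<Gamma>)"
    and "(\<lambda>n. marked_dist d (\<Gamma>n n) (map (\<phi> n) S) \<Gamma> S) \<longlonglongrightarrow> 0"
  shows "(\<lambda>n. L1_det (\<Gamma>n n) (L1_map \<Gamma> (\<phi> n) f)) \<longlonglongrightarrow> L1_det \<Gamma> f"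
proof -
  have "group \<Gamma>" and S: "length S = d" "set S \<subseteq> carrier \<Gamma>" "generate \<Gamma> (set S) = carrier \<Gamma>"
    using assms(2) by (auto simp: marked_group_def)
  then interpret \<Gamma>: group \<Gamma> by simp
  have hom: "group_hom \<Gamma> (\<Gamma>n n) (\<phi> n)" if "n \<ge> 1" for n
    using assms(3,4)[OF that] \<open>group \<Gamma>\<close>
    by (simp add: group_hom_def group_hom_axioms_def epi_def)
  show ?thesis
  proof (rule L1_det_tendsto[OF \<open>group \<Gamma>\<close> hom _ assms(5)])
    fix F assume F: "finite F" "F \<subseteq> carrier \<Gamma>"
    obtain N where N: "F \<subseteq> cayley_ball \<Gamma> S N"
      using \<Gamma>.finite_subset_cayley_ball[OF S(2,3) F] by blast
    have "\<forall>\<^sub>F n in sequentially. marked_dist d (\<Gamma>n n) (map (\<phi> n) S) \<Gamma> S < (1 / 2) ^ N"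
      by (rule order_tendstoD(2)[OF assms(6)]) simp
    then show "\<forall>\<^sub>F n in sequentially. \<forall>g\<in>F. \<phi> n g = \<one>\<^bsub>\<Gamma>n n\<^esub> \<longrightarrow> g = \<one>\<^bsub>\<Gamma>\<^esub>"
      using eventually_ge_at_top[of 1]
    proof eventually_elim
      case (elim n)
      interpret group_hom \<Gamma> "\<Gamma>n n" "\<phi> n" by (rule hom[OF elim(2)])
      obtain N' where "N \<le> N'" "cayley_ball_iso d N' (\<Gamma>n n) (map (\<phi> n) S) \<Gamma> S"
        using marked_dist_less[OF elim(1)] by blast
      then show ?case
        using cayley_ball_iso_kernel[OF S(2,1), of N'] N \<Gamma>.cayley_ball_mono[of N N' S] by blast
    qed
  qed
qed

end
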